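(* Let $V=\mathbb{R}^N$ and let $\mathcal{T}_{poly}(V)\simeq\mathbb{R}[[x^\alpha,\psi_\alpha]]$, $1\le\alpha\le N$, with its standard Gerstenhaber algebra structure (wedge product and Schouten bracket). For any Lie coalgebra structure on an $N$-dimensional real vector space, with structure constants $C_{\alpha\beta}^\gamma$, the formulae $$\{x^\alpha\bullet x^\beta\}=0,$$ $$\{\psi_\alpha\bullet x^\beta\}=\delta_\alpha^\beta+\sum_{n=1}^\infty\frac{B_n\hbar^n}{n!}\sum_{\xi_i,\zeta_i}C_{\alpha\xi_1}^{\zeta_1}C_{\zeta_1\xi_2}^{\zeta_2}\cdots C_{\zeta_{n-1}\xi_n}^{\beta}x^{\xi_1}x^{\xi_2}\cdots x^{\xi_n},$$ $$\{\psi_\alpha\bullet\psi_\beta\}=\hbar\sum_\gamma C_{\alpha\beta}^\gamma\psi_\gamma$$ define a 1-parameter deformation, with formal parameter $\hbar$, of the standard Gerstenhaber algebra structure on $\mathcal{T}_{poly}(V)$. That is, together with the unchanged product, they determine a Gerstenhaber algebra structure on $\mathbb{R}[[x^\alpha,\psi_\alpha]][[\hbar]]$ which reduces to the standard one at $\hbar=0$.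
   Context: $x^\alpha$ are commuting formal variables of degree $0$ and $\psi_\alpha$ are anticommuting variables of degree $1$ ($\psi_\alpha$ corresponds to $\partial/\partial x^\alpha$). $\mathcal{T}_{poly}(V)$ is the algebra of formal polyvector fields on $V$; its product is the graded commutative product of $\mathbb{R}[[x^\alpha,\psi_\alpha]]$, and its Schouten bracket, of degree $-1$, is a biderivation uniquely determined by $\{x^\alpha\bullet x^\beta\}=0$, $\{\psi_\alpha\bullet x^\beta\}=\delta_\alpha^\beta$, $\{\psi_\alpha\bullet\psi_\beta\}=0$. A Gerstenhaber algebra is a graded commutative algebra with a degree $-1$ Lie bracket which is a (graded) biderivation of the product. The bracket of the corollary is extended from generators as a continuous $\mathbb{R}[[\hbar]]$-bilinear graded biderivation. The structure constants of a Lie coalgebra with cobracket $\Delta$ and basis $x^\alpha$ are defined by $\Delta(x^\gamma)=\sum_{\alpha,\beta}C_{\alpha\beta}^\gamma x^\alpha x^\beta$ in the exterior square, with $C^\gamma_{\alpha\beta}=-C^\gamma_{\beta\alpha}$; the co-Jacobi identity means that the dual vector space, with dual basis $e_\alpha$, is a Lie algebra with bracket $[e_\alpha,e_\beta]=\sum_\gamma C_{\alpha\beta}^\gamma e_\gamma$. $B_n$ are the Bernoulli numbers with $B_1=-\frac12$, $B_2=\frac16$, $B_3=0$, $B_4=-\frac1{30}$, etc. *)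

theory Defs
  imports "HOL-Analysis.Analysis" "HOL-Library.Multiset"
    "HOL-Computational_Algebra.Formal_Power_Series"
begin

section \<open>Formal polyvector fields\<close>

text \<open>An element of \<open>\<real>[[x\<^sup>\<alpha>, \<psi>\<^sub>\<alpha>]]\<close> is given by its coefficients: the coefficient at \<open>m\<close>, \<open>S\<close>
  belongs to the monomial whose even part is the product of the \<open>x\<^sup>\<alpha>\<close> over the multiset \<open>m\<close> and
  whose odd part is the product of the \<open>\<psi>\<^sub>\<alpha>\<close>, \<open>\<alpha> \<in> S\<close>, taken in increasing order of \<open>\<alpha>\<close>.
  The index set \<open>{1..N}\<close> is a finite linearly ordered type \<open>'n\<close>.\<close>

typedef 'n polyvec = "UNIV :: ('n multiset \<Rightarrow> 'n set \<Rightarrow> real) set"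
  morphisms coeff Polyvec ..

setup_lifting type_definition_polyvec

lemma polyvec_eqI: "(\<And>m S. coeff a m S = coeff b m S) \<Longrightarrow> a = b"
  by (simp add: coeff_inject[symmetric] fun_eq_iff)

text \<open>For disjoint \<open>U\<close>, \<open>V\<close>, the ordered odd monomials satisfy
  \<open>\<psi>\<^sub>U \<psi>\<^sub>V = shuffle_sign U V \<cdot> \<psi>\<^bsub>U \<union> V\<^esub>\<close>.\<close>

definition shuffle_sign :: "'n::linorder set \<Rightarrow> 'n set \<Rightarrow> real" where
  "shuffle_sign U V = (-1) ^ card {(i, j). i \<in> U \<and> j \<in> V \<and> j < i}"

lemma finite_inversions:
  "finite U \<Longrightarrow> finite V \<Longrightarrow> finite {(i, j). i \<in> U \<and> j \<in> V \<and> j < (i::'n::linorder)}"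
  by (rule finite_subset[of _ "U \<times> V"]) auto

lemma shuffle_sign_empty [simp]: "shuffle_sign {} V = 1" "shuffle_sign U {} = 1"
  by (simp_all add: shuffle_sign_def)

lemma shuffle_sign_Un_left:
  assumes "finite U" "finite V" "finite W" "U \<inter> V = {}"
  shows "shuffle_sign (U \<union> V) W = shuffle_sign U W * shuffle_sign V W"
proof -
  have "{(i, j). i \<in> U \<union> V \<and> j \<in> W \<and> j < i} =
      {(i, j). i \<in> U \<and> j \<in> W \<and> j < i} \<union> {(i, j). i \<in> V \<and> j \<in> W \<and> j < i}" by auto
  moreover have "{(i, j). i \<in> U \<and> j \<in> W \<and> j < i} \<inter> {(i, j). i \<in> V \<and> j \<in> W \<and> j < i} = {}"
    using assms(4) by auto
  ultimately show ?thesis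
    by (simp add: shuffle_sign_def card_Un_disjoint finite_inversions assms power_add)
qed

lemma shuffle_sign_Un_right:
  assumes "finite U" "finite V" "finite W" "V \<inter> W = {}"
  shows "shuffle_sign U (V \<union> W) = shuffle_sign U V * shuffle_sign U W"
proof -
  have "{(i, j). i \<in> U \<and> j \<in> V \<union> W \<and> j < i} =
      {(i, j). i \<in> U \<and> j \<in> V \<and> j < i} \<union> {(i, j). i \<in> U \<and> j \<in> W \<and> j < i}" by auto
  moreover have "{(i, j). i \<in> U \<and> j \<in> V \<and> j < i} \<inter> {(i, j). i \<in> U \<and> j \<in> W \<and> j < i} = {}"
    using assms(4) by auto
  ultimately show ?thesis
    by (simp add: shuffle_sign_def card_Un_disjoint finite_inversions assms power_add)
qed

lemma finite_submsets [simp]: "finite {p. p \<subseteq># m}"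
proof (induction m)
  case (add x m)
  have "{p. p \<subseteq># add_mset x m} \<subseteq> {p. p \<subseteq># m} \<union> add_mset x ` {p. p \<subseteq># m}"
  proof
    fix p assume "p \<in> {p. p \<subseteq># add_mset x m}"
    then have p: "p \<subseteq># add_mset x m" by simp
    show "p \<in> {p. p \<subseteq># m} \<union> add_mset x ` {p. p \<subseteq># m}"
    proof (cases "x \<in># p")
      case True
      then obtain q where "p = add_mset x q" by (metis multi_member_split)
      with p show ?thesis by auto
    next
      case False
      with p have "p \<subseteq># m" 
        by (metis diff_single_trivial subset_eq_diff_conv add_mset_add_single)
      then show ?thesis by simp
    qed
  qed
  then show ?case using add.IH by (meson finite_UnI finite_imageI finite_subset)
qed simp

lemma sum_submset_assoc:
  fixes f :: "'n multiset \<Rightarrow> 'n multiset \<Rightarrow> 'n multiset \<Rightarrow> 'a::comm_monoid_add"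
  shows "(\<Sum>p | p \<subseteq># m. \<Sum>q | q \<subseteq># p. f q (p - q) (m - p)) =
    (\<Sum>q | q \<subseteq># m. \<Sum>r | r \<subseteq># m - q. f q r (m - q - r))"
proof -
  have "(\<Sum>p | p \<subseteq># m. \<Sum>q | q \<subseteq># p. f q (p - q) (m - p)) =
      (\<Sum>(p, q)\<in>Sigma {p. p \<subseteq># m} (\<lambda>p. {q. q \<subseteq># p}). f q (p - q) (m - p))"
    by (simp add: sum.Sigma)
  also have "\<dots> = (\<Sum>(q, r)\<in>Sigma {q. q \<subseteq># m} (\<lambda>q. {r. r \<subseteq># m - q}). f q r (m - q - r))"
  proof -
    have 1: "q \<subseteq># m" "p - q \<subseteq># m - q" "m - q - (p - q) = m - p"
      if "q \<subseteq># p" "p \<subseteq># m" for p q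
    proof -
      have le: "count q x \<le> count p x" "count p x \<le> count m x" for x
        using that by (simp_all add: subseteq_mset_def)
      show "q \<subseteq># m" "p - q \<subseteq># m - q"
        using le by (auto simp: subseteq_mset_def intro: diff_le_mono order_trans)
      show "m - q - (p - q) = m - p"
        by (rule multiset_eqI) (use le in \<open>simp add: diff_diff_add\<close>)
    qed
    have 2: "q + r \<subseteq># m" if "r \<subseteq># m - q" "q \<subseteq># m" for q r
      using that by (simp add: subset_eq_diff_conv subset_mset.le_diff_conv2 add.commute)
    show ?thesis
      by (rule sum.reindex_bij_witness[of _ "\<lambda>(q, r). (q + r, q)" "\<lambda>(p, q). (q, p - q)"])
        (auto simp: 1 2)
  qed
  also have "\<dots> = (\<Sum>q | q \<subseteq># m. \<Sum>r | r \<subseteq># m - q. f q r (m - q - r))"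
    by (simp add: sum.Sigma)
  finally show ?thesis .
qed

lemma sum_subset_assoc:
  fixes f :: "'n set \<Rightarrow> 'n set \<Rightarrow> 'n set \<Rightarrow> 'a::comm_monoid_add"
  assumes "finite S"
  shows "(\<Sum>U | U \<subseteq> S. \<Sum>W | W \<subseteq> U. f W (U - W) (S - U)) =
    (\<Sum>W | W \<subseteq> S. \<Sum>Z | Z \<subseteq> S - W. f W Z (S - W - Z))"
proof -
  have fin: "finite U" if "U \<subseteq> S" for U using assms that finite_subset by blast
  have "(\<Sum>U | U \<subseteq> S. \<Sum>W | W \<subseteq> U. f W (U - W) (S - U)) =
      (\<Sum>(U, W)\<in>Sigma {U. U \<subseteq> S} (\<lambda>U. {W. W \<subseteq> U}). f W (U - W) (S - U))"
    by (rule sum.Sigma) (use assms fin in auto)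
  also have "\<dots> = (\<Sum>(W, Z)\<in>Sigma {W. W \<subseteq> S} (\<lambda>W. {Z. Z \<subseteq> S - W}). f W Z (S - W - Z))"
    by (rule sum.reindex_bij_witness[of _ "\<lambda>(W, Z). (W \<union> Z, W)" "\<lambda>(U, W). (W, U - W)"])
      (auto intro!: arg_cong2[of _ _ _ _ "f _"] arg_cong[of _ _ "f _ _"])
  also have "\<dots> = (\<Sum>W | W \<subseteq> S. \<Sum>Z | Z \<subseteq> S - W. f W Z (S - W - Z))"
    by (rule sum.Sigma[symmetric]) (use assms in auto)
  finally show ?thesis .
qed

instantiation polyvec :: ("{finite, linorder}") real_algebra_1
begin

lift_definition zero_polyvec :: "'a polyvec" is "\<lambda>m S. 0" .

lift_definition one_polyvec :: "'a polyvec" is "\<lambda>m S. if m = {#} \<and> S = {} then 1 else 0" .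

lift_definition plus_polyvec :: "'a polyvec \<Rightarrow> 'a polyvec \<Rightarrow> 'a polyvec"
  is "\<lambda>a b m S. a m S + b m S" .

lift_definition minus_polyvec :: "'a polyvec \<Rightarrow> 'a polyvec \<Rightarrow> 'a polyvec"
  is "\<lambda>a b m S. a m S - b m S" .

lift_definition uminus_polyvec :: "'a polyvec \<Rightarrow> 'a polyvec" is "\<lambda>a m S. - a m S" .

lift_definition scaleR_polyvec :: "real \<Rightarrow> 'a polyvec \<Rightarrow> 'a polyvec" is "\<lambda>r a m S. r * a m S" .

lift_definition times_polyvec :: "'a polyvec \<Rightarrow> 'a polyvec \<Rightarrow> 'a polyvec"
  is "\<lambda>a b m S. \<Sum>p | p \<subseteq># m. \<Sum>U | U \<subseteq> S.
        shuffle_sign U (S - U) * a p U * b (m - p) (S - U)" .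

instance
proof
  fix a b c :: "'a polyvec" and r s :: real
  show "a + b + c = a + (b + c)" by transfer (simp add: add.assoc)
  show "a + b = b + a" by transfer (simp add: add.commute)
  show "0 + a = a" by transfer simp
  show "- a + a = 0" by transfer simp
  show "a - b = a + - b" by transfer simp
  show "r *\<^sub>R (a + b) = r *\<^sub>R a + r *\<^sub>R b" by transfer (simp add: distrib_left)
  show "(r + s) *\<^sub>R a = r *\<^sub>R a + s *\<^sub>R a" by transfer (simp add: distrib_right)
  show "r *\<^sub>R s *\<^sub>R a = (r * s) *\<^sub>R a" by transfer (simp add: mult.assoc)
  show "1 *\<^sub>R a = a" by transfer simp
  show "(a + b) * c = a * c + b * c"
    by transfer (simp add: algebra_simps sum.distrib)
  show "a * (b + c) = a * b + a * c"
    by transfer (simp add: algebra_simps sum.distrib)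
  show "r *\<^sub>R a * b = r *\<^sub>R (a * b)"
    by transfer (simp add: sum_distrib_left algebra_simps)
  show "a * r *\<^sub>R b = r *\<^sub>R (a * b)"
    by transfer (simp add: sum_distrib_left algebra_simps)
  show "(0::'a polyvec) \<noteq> 1"
    by transfer (auto simp: fun_eq_iff)
  show "1 * a = a"
  proof (transfer, intro ext)
    fix a :: "'a multiset \<Rightarrow> 'a set \<Rightarrow> real" and m S
    have "(\<Sum>p | p \<subseteq># m. \<Sum>U | U \<subseteq> S. shuffle_sign U (S - U) *
          (if p = {#} \<and> U = {} then 1 else 0) * a (m - p) (S - U)) =
        (\<Sum>p | p \<subseteq># m. \<Sum>U | U \<subseteq> S. if U = {} then if p = {#} then a m S else 0 else 0)"
      by (intro sum.cong refl) auto
    also have "\<dots> = a m S" by (simp add: sum.delta)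
    finally show "(\<Sum>p | p \<subseteq># m. \<Sum>U | U \<subseteq> S. shuffle_sign U (S - U) *
          (if p = {#} \<and> U = {} then 1 else 0) * a (m - p) (S - U)) = a m S" .
  qed
  show "a * 1 = a"
  proof (transfer, intro ext)
    fix a :: "'a multiset \<Rightarrow> 'a set \<Rightarrow> real" and m S
    have "(\<Sum>p | p \<subseteq># m. \<Sum>U | U \<subseteq> S. shuffle_sign U (S - U) * a p U *
          (if m - p = {#} \<and> S - U = {} then 1 else 0)) =
        (\<Sum>p | p \<subseteq># m. \<Sum>U | U \<subseteq> S. if U = S then if p = m then a m S else 0 else 0)"
    proof (intro sum.cong refl)
      fix p U assume "p \<in> {p. p \<subseteq># m}" "U \<in> {U. U \<subseteq> S}"
      then have "m - p = {#} \<longleftrightarrow> p = m" "S - U = {} \<longleftrightarrow> U = S"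
        by (auto simp: Diff_eq_empty_iff_mset subset_mset.antisym)
      then show "shuffle_sign U (S - U) * a p U *
          (if m - p = {#} \<and> S - U = {} then 1 else 0) =
          (if U = S then if p = m then a m S else 0 else 0)" by auto
    qed
    also have "\<dots> = a m S" by (simp add: sum.delta)
    finally show "(\<Sum>p | p \<subseteq># m. \<Sum>U | U \<subseteq> S. shuffle_sign U (S - U) * a p U *
          (if m - p = {#} \<and> S - U = {} then 1 else 0)) = a m S" .
  qed
  show "a * b * c = a * (b * c)"
  proof (transfer, intro ext)
    fix a b c :: "'a multiset \<Rightarrow> 'a set \<Rightarrow> real" and m S
    let ?f = "\<lambda>q r s W Z Y. shuffle_sign (W \<union> Z) Y * shuffle_sign W Z * a q W * b r Z * c s Y"
    have "(\<Sum>p | p \<subseteq># m. \<Sum>U | U \<subseteq> S. shuffle_sign U (S - U) *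
          (\<Sum>q | q \<subseteq># p. \<Sum>W | W \<subseteq> U. shuffle_sign W (U - W) * a q W * b (p - q) (U - W)) *
          c (m - p) (S - U)) =
        (\<Sum>p | p \<subseteq># m. \<Sum>U | U \<subseteq> S. \<Sum>q | q \<subseteq># p. \<Sum>W | W \<subseteq> U.
          ?f q (p - q) (m - p) W (U - W) (S - U))"
      unfolding sum_distrib_left sum_distrib_right
      by (intro sum.cong refl) (simp add: Un_absorb1 mult.assoc)
    also have "\<dots> = (\<Sum>p | p \<subseteq># m. \<Sum>q | q \<subseteq># p. \<Sum>U | U \<subseteq> S. \<Sum>W | W \<subseteq> U.
          ?f q (p - q) (m - p) W (U - W) (S - U))"
      by (intro sum.cong refl sum.swap)
    also have "\<dots> = (\<Sum>p | p \<subseteq># m. \<Sum>q | q \<subseteq># p. \<Sum>W | W \<subseteq> S. \<Sum>Z | Z \<subseteq> S - W.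
          ?f q (p - q) (m - p) W Z (S - W - Z))"
      by (intro sum.cong refl sum_subset_assoc) simp
    also have "\<dots> = (\<Sum>q | q \<subseteq># m. \<Sum>r | r \<subseteq># m - q. \<Sum>W | W \<subseteq> S. \<Sum>Z | Z \<subseteq> S - W.
          ?f q r (m - q - r) W Z (S - W - Z))"
      by (rule sum_submset_assoc)
    also have "\<dots> = (\<Sum>q | q \<subseteq># m. \<Sum>W | W \<subseteq> S. \<Sum>r | r \<subseteq># m - q. \<Sum>Z | Z \<subseteq> S - W.
          ?f q r (m - q - r) W Z (S - W - Z))"
      by (intro sum.cong refl sum.swap)
    also have "\<dots> = (\<Sum>q | q \<subseteq># m. \<Sum>W | W \<subseteq> S. \<Sum>r | r \<subseteq># m - q. \<Sum>Z | Z \<subseteq> S - W.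
          shuffle_sign W (S - W) * a q W *
          (shuffle_sign Z (S - W - Z) * b r Z * c (m - q - r) (S - W - Z)))"
    proof (intro sum.cong refl)
      fix q W r Z assume "W \<in> {W. W \<subseteq> S}" "Z \<in> {Z. Z \<subseteq> S - W}"
      then have Z: "S - W = Z \<union> (S - W - Z)" and d: "W \<inter> Z = {}" by auto
      have "shuffle_sign W (S - W) = shuffle_sign W Z * shuffle_sign W (S - W - Z)"
        by (subst Z) (rule shuffle_sign_Un_right, auto)
      moreover have "shuffle_sign (W \<union> Z) (S - W - Z) =
          shuffle_sign W (S - W - Z) * shuffle_sign Z (S - W - Z)"
        by (rule shuffle_sign_Un_left) (use d in auto)
      ultimately show "?f q r (m - q - r) W Z (S - W - Z) = shuffle_sign W (S - W) * a q W *
          (shuffle_sign Z (S - W - Z) * b r Z * c (m - q - r) (S - W - Z))"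
        by (simp add: mult_ac)
    qed
    also have "\<dots> = (\<Sum>q | q \<subseteq># m. \<Sum>W | W \<subseteq> S. shuffle_sign W (S - W) * a q W *
          (\<Sum>r | r \<subseteq># m - q. \<Sum>Z | Z \<subseteq> S - W.
            shuffle_sign Z (S - W - Z) * b r Z * c (m - q - r) (S - W - Z)))"
      by (simp add: sum_distrib_left)
    finally show "(\<Sum>p | p \<subseteq># m. \<Sum>U | U \<subseteq> S. shuffle_sign U (S - U) *
          (\<Sum>q | q \<subseteq># p. \<Sum>W | W \<subseteq> U. shuffle_sign W (U - W) * a q W * b (p - q) (U - W)) *
          c (m - p) (S - U)) =
        (\<Sum>q | q \<subseteq># m. \<Sum>W | W \<subseteq> S. shuffle_sign W (S - W) * a q W *
          (\<Sum>r | r \<subseteq># m - q. \<Sum>Z | Z \<subseteq> S - W.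
            shuffle_sign Z (S - W - Z) * b r Z * c (m - q - r) (S - W - Z)))" .
  qed
qed

end

lift_definition xvar :: "'n \<Rightarrow> 'n polyvec"
  is "\<lambda>\<alpha> m S. if m = {#\<alpha>#} \<and> S = {} then 1 else 0" .

lift_definition psi :: "'n \<Rightarrow> 'n polyvec"
  is "\<lambda>\<alpha> m S. if m = {#} \<and> S = {\<alpha>} then 1 else 0" .

lemma coeff_mult:
  "coeff (a * b) m S = (\<Sum>p | p \<subseteq># m. \<Sum>U | U \<subseteq> S.
     shuffle_sign U (S - U) * coeff a p U * coeff b (m - p) (S - U))"
  for a b :: "'n::{finite, linorder} polyvec"
  by transfer simp

lemma psi_anticommute: "psi \<alpha> * psi \<beta> = - (psi \<beta> * psi \<alpha> :: 'n::{finite, linorder} polyvec)"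
proof -
  have val: "coeff (psi \<alpha> * psi \<beta>) m S = (if m = {#} \<and> S = {\<alpha>, \<beta>} \<and> \<alpha> \<noteq> \<beta>
      then if \<beta> < \<alpha> then -1 else 1 else 0)" for \<alpha> \<beta> :: 'n and m S
  proof -
    define c where
      "c = (if m = {#} \<and> S = {\<alpha>, \<beta>} \<and> \<alpha> \<noteq> \<beta> then shuffle_sign {\<alpha>} {\<beta>} else 0)"
    have "shuffle_sign U (S - U) * coeff (psi \<alpha>) p U * coeff (psi \<beta>) (m - p) (S - U) =
        (if U = {\<alpha>} then if p = {#} then c else 0 else 0)" if "p \<subseteq># m" "U \<subseteq> S" for p U
    proof -
      have "S - {\<alpha>} = {\<beta>} \<longleftrightarrow> S = {\<alpha>, \<beta>} \<and> \<alpha> \<noteq> \<beta>" if "\<alpha> \<in> S" using that by auto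
      then show ?thesis using that by (auto simp: psi.rep_eq c_def)
    qed
    then have "coeff (psi \<alpha> * psi \<beta>) m S =
        (\<Sum>p | p \<subseteq># m. \<Sum>U | U \<subseteq> S. if U = {\<alpha>} then if p = {#} then c else 0 else 0)"
      unfolding coeff_mult by (intro sum.cong refl) simp
    also have "\<dots> = (\<Sum>p | p \<subseteq># m. if p = {#} then if \<alpha> \<in> S then c else 0 else 0)"
      by (intro sum.cong refl) (simp add: sum.delta)
    also have "\<dots> = c" by (subst sum.delta) (auto simp: c_def)
    also note c_def
    also have "shuffle_sign {\<alpha>} {\<beta>} = (if \<beta> < \<alpha> then -1 else 1)"
    proof -
      have "{(i, j). i \<in> {\<alpha>} \<and> j \<in> {\<beta>} \<and> j < i} = (if \<beta> < \<alpha> then {(\<alpha>, \<beta>)} else {})" by auto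
      then show ?thesis by (simp add: shuffle_sign_def)
    qed
    finally show ?thesis .
  qed
  show ?thesis
    by (rule polyvec_eqI) (auto simp: val uminus_polyvec.rep_eq insert_commute)
qed

definition polyvec_deg :: "int \<Rightarrow> 'n polyvec set" where
  "polyvec_deg d = {a. \<forall>m S. coeff a m S \<noteq> 0 \<longrightarrow> int (card S) = d}"

text \<open>Coefficientwise convergence, with discrete coefficients; this is the adic topology of the
  power series ring.\<close>

definition polyvec_topology :: "'n polyvec topology" where
  "polyvec_topology = pullback_topology UNIV (\<lambda>a (m, S). coeff a m S)
     (product_topology (\<lambda>_. discrete_topology UNIV) UNIV)"

text \<open>\<open>\<real>[[x\<^sup>\<alpha>, \<psi>\<^sub>\<alpha>]][[\<hbar>]]\<close> is the type \<open>'n polyvec fps\<close>, with \<open>\<hbar> = fps_X\<close> of degree 0.\<close>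

definition hscale :: "real fps \<Rightarrow> 'a::real_algebra_1 fps \<Rightarrow> 'a fps" where
  "hscale c a = Abs_fps (\<lambda>k. of_real (fps_nth c k)) * a"

definition hpolyvec_deg :: "int \<Rightarrow> 'n polyvec fps set" where
  "hpolyvec_deg d = {a. \<forall>k. fps_nth a k \<in> polyvec_deg d}"

definition hpolyvec_topology :: "'n polyvec fps topology" where
  "hpolyvec_topology = pullback_topology UNIV (\<lambda>a (k, m, S). coeff (fps_nth a k) m S)
     (product_topology (\<lambda>_. discrete_topology UNIV) UNIV)"


section \<open>Gerstenhaber algebras\<close>

definition neg_pow :: "int \<Rightarrow> 'a::group_add \<Rightarrow> 'a" where
  "neg_pow k a = (if even k then a else - a)"

locale graded_commutative_algebra = module scale
  for scale :: "'k::comm_ring_1 \<Rightarrow> 'a::ring_1 \<Rightarrow> 'a" +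
  fixes D :: "int \<Rightarrow> 'a set"
  assumes scale_mult_left: "scale k a * b = scale k (a * b)"
    and scale_mult_right: "a * scale k b = scale k (a * b)"
    and subspace_D: "subspace (D d)"
    and one_D: "1 \<in> D 0"
    and mult_D: "a \<in> D d \<Longrightarrow> b \<in> D e \<Longrightarrow> a * b \<in> D (d + e)"
    and direct_sum: "\<exists>!c. finite {d. c d \<noteq> 0} \<and> (\<forall>d. c d \<in> D d) \<and> a = (\<Sum>d | c d \<noteq> 0. c d)"
    and graded_commute: "a \<in> D d \<Longrightarrow> b \<in> D e \<Longrightarrow> a * b = neg_pow (d * e) (b * a)"

text \<open>The bracket has degree \<open>-1\<close>, so an element of degree \<open>d\<close> enters its sign rules with the
  shifted degree \<open>d - 1\<close>.\<close>

locale skew_biderivation =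
  fixes scale :: "'k::comm_ring_1 \<Rightarrow> 'a::ring_1 \<Rightarrow> 'a"
    and D :: "int \<Rightarrow> 'a set"
    and br :: "'a \<Rightarrow> 'a \<Rightarrow> 'a"
  assumes linear_left: "module_hom scale scale (\<lambda>a. br a b)"
    and linear_right: "module_hom scale scale (br a)"
    and br_D: "a \<in> D d \<Longrightarrow> b \<in> D e \<Longrightarrow> br a b \<in> D (d + e - 1)"
    and skew: "a \<in> D d \<Longrightarrow> b \<in> D e \<Longrightarrow> br a b = - neg_pow ((d - 1) * (e - 1)) (br b a)"
    and derivation_left: "a \<in> D d \<Longrightarrow> b \<in> D e \<Longrightarrow> c \<in> D f \<Longrightarrow>
          br (a * b) c = a * br b c + neg_pow (e * (f - 1)) (br a c * b)"
    and derivation_right: "a \<in> D d \<Longrightarrow> b \<in> D e \<Longrightarrow> c \<in> D f \<Longrightarrow>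
          br a (b * c) = br a b * c + neg_pow ((d - 1) * e) (b * br a c)"

locale gerstenhaber_algebra = graded_commutative_algebra scale D + skew_biderivation scale D br
  for scale :: "'k::comm_ring_1 \<Rightarrow> 'a::ring_1 \<Rightarrow> 'a"
    and D :: "int \<Rightarrow> 'a set"
    and br :: "'a \<Rightarrow> 'a \<Rightarrow> 'a" +
  assumes jacobi: "a \<in> D d \<Longrightarrow> b \<in> D e \<Longrightarrow> c \<in> D f \<Longrightarrow>
    br a (br b c) = br (br a b) c + neg_pow ((d - 1) * (e - 1)) (br b (br a c))"

definition continuous_bracket :: "'a topology \<Rightarrow> ('a \<Rightarrow> 'a \<Rightarrow> 'a) \<Rightarrow> bool" where
  "continuous_bracket T br \<longleftrightarrow> continuous_map (prod_topology T T) T (\<lambda>(a, b). br a b)"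

definition is_schouten_bracket ::
    "('n::{finite, linorder} polyvec \<Rightarrow> 'n polyvec \<Rightarrow> 'n polyvec) \<Rightarrow> bool" where
  "is_schouten_bracket br \<longleftrightarrow>
     skew_biderivation scaleR polyvec_deg br \<and> continuous_bracket polyvec_topology br \<and>
     (\<forall>\<alpha> \<beta>. br (xvar \<alpha>) (xvar \<beta>) = 0 \<and>
            br (psi \<alpha>) (xvar \<beta>) = (if \<alpha> = \<beta> then 1 else 0) \<and>
            br (psi \<alpha>) (psi \<beta>) = 0)"

definition schouten :: "'n::{finite, linorder} polyvec \<Rightarrow> 'n polyvec \<Rightarrow> 'n polyvec" where
  "schouten = (THE br. is_schouten_bracket br)"

text \<open>A one-parameter deformation of a Gerstenhaber algebra structure \<open>br0\<close> on formal polyvector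
  fields with unchanged product.\<close>

definition gerstenhaber_deformation ::
    "('n::{finite, linorder} polyvec \<Rightarrow> 'n polyvec \<Rightarrow> 'n polyvec) \<Rightarrow>
     ('n polyvec fps \<Rightarrow> 'n polyvec fps \<Rightarrow> 'n polyvec fps) \<Rightarrow> bool" where
  "gerstenhaber_deformation br0 br \<longleftrightarrow>
     gerstenhaber_algebra scaleR polyvec_deg br0 \<and>
     gerstenhaber_algebra hscale hpolyvec_deg br \<and>
     (\<forall>a b. fps_nth (br a b) 0 = br0 (fps_nth a 0) (fps_nth b 0))"


section \<open>Lie coalgebras\<close>

definition lie_bracket :: "('v::real_vector \<Rightarrow> 'v \<Rightarrow> 'v) \<Rightarrow> bool" where
  "lie_bracket br \<longleftrightarrow> bilinear br \<and> (\<forall>u. br u u = 0) \<and>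
     (\<forall>u v w. br u (br v w) + br v (br w u) + br w (br u v) = 0)"

text \<open>The underlying space is \<open>real ^ 'n\<close> with basis \<open>x\<^sup>\<gamma> = axis \<gamma> 1\<close>. Its exterior square is
  represented by the antisymmetric matrices, \<open>A\<close> standing for the sum of
  \<open>A\<^sub>\<alpha>\<^sub>\<beta> x\<^sup>\<alpha> \<and> x\<^sup>\<beta>\<close> over all \<open>\<alpha>\<close> and \<open>\<beta>\<close>. The dual space is \<open>real ^ 'n\<close> with the dual basis
  \<open>e\<^sub>\<alpha> = axis \<alpha> 1\<close>; the value of \<open>[f, g]\<close> at \<open>w\<close> is the pairing of \<open>f \<otimes> g\<close> with \<open>\<Delta> w\<close>.\<close>

definition dual_bracket :: "(real ^ 'n \<Rightarrow> real ^ 'n ^ 'n) \<Rightarrow> real ^ 'n \<Rightarrow> real ^ 'n \<Rightarrow> real ^ 'n" where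
  "dual_bracket \<Delta> f g = (\<chi> \<gamma>. f \<bullet> (\<Delta> (axis \<gamma> 1) *v g))"

definition lie_coalgebra :: "(real ^ 'n \<Rightarrow> real ^ 'n ^ 'n) \<Rightarrow> bool" where
  "lie_coalgebra \<Delta> \<longleftrightarrow>
     linear \<Delta> \<and> (\<forall>w. transpose (\<Delta> w) = - \<Delta> w) \<and> lie_bracket (dual_bracket \<Delta>)"

text \<open>\<open>structure_const \<Delta> \<alpha> \<beta> \<gamma>\<close> is \<open>C\<^sub>\<alpha>\<^sub>\<beta>\<^sup>\<gamma>\<close>.\<close>

definition structure_const :: "(real ^ 'n \<Rightarrow> real ^ 'n ^ 'n) \<Rightarrow> 'n \<Rightarrow> 'n \<Rightarrow> 'n \<Rightarrow> real" where
  "structure_const \<Delta> \<alpha> \<beta> \<gamma> = \<Delta> (axis \<gamma> 1) $ \<alpha> $ \<beta>"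

lemma dual_bracket_axis:
  "dual_bracket \<Delta> (axis \<alpha> 1) (axis \<beta> 1) = (\<Sum>\<gamma>\<in>UNIV. structure_const \<Delta> \<alpha> \<beta> \<gamma> *\<^sub>R axis \<gamma> 1)"
  by (simp add: vec_eq_iff dual_bracket_def structure_const_def inner_axis' sum_component)
    (simp add: matrix_vector_mult_def axis_def if_distrib[of "\<lambda>x. _ * x"] cong: if_cong)


section \<open>The deformed bracket\<close>

definition bernoulli :: "nat \<Rightarrow> real" where
  "bernoulli n = fact n * fps_nth (fps_X / (fps_exp 1 - 1)) n"

lemma bernoulli_recurrence:
  "(\<Sum>k\<le>n. real (Suc n choose k) * bernoulli k) = (if n = 0 then 1 else 0)"
proof -
  let ?E = "fps_exp 1 - 1 :: real fps" and ?F = "fps_X / (fps_exp 1 - 1) :: real fps"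
  have sub: "subdegree ?E = 1" by (rule subdegreeI) auto
  then have "?E dvd fps_X" by (simp add: fps_dvd_iff)
  then have "?F * ?E = fps_X" by simp
  then have "fps_nth (?F * ?E) (Suc n) = (if n = 0 then 1 else 0)" by simp
  moreover have "fps_nth (?F * ?E) (Suc n) =
      (\<Sum>k\<le>n. fps_nth ?F k * (1 / fact (Suc n - k)))"
    by (simp add: fps_mult_nth atLeast0AtMost del: fact_Suc)
  moreover have "real (Suc n choose k) * bernoulli k =
      fact (Suc n) * (fps_nth ?F k * (1 / fact (Suc n - k)))" if "k \<le> n" for k
    using that by (simp add: bernoulli_def binomial_fact del: fact_Suc)
  then have "(\<Sum>k\<le>n. real (Suc n choose k) * bernoulli k) =
      fact (Suc n) * (\<Sum>k\<le>n. fps_nth ?F k * (1 / fact (Suc n - k)))"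
    by (simp add: sum_distrib_left del: fact_Suc)
  ultimately show ?thesis by simp
qed

lemma bernoulli_values:
  "bernoulli 0 = 1" "bernoulli 1 = - 1 / 2" "bernoulli 2 = 1 / 6" "bernoulli 3 = 0"
  "bernoulli 4 = - 1 / 30"
  using bernoulli_recurrence[of 0] bernoulli_recurrence[of 1] bernoulli_recurrence[of 2]
    bernoulli_recurrence[of 3] bernoulli_recurrence[of 4]
  by (simp_all add: eval_nat_numeral)

text \<open>The sum of \<open>C\<^sub>\<alpha>\<^sub>\<xi>\<^sub>1\<^sup>\<zeta>\<^sup>1 C\<^sub>\<zeta>\<^sub>1\<^sub>\<xi>\<^sub>2\<^sup>\<zeta>\<^sup>2 \<dots> x\<^sup>\<xi>\<^sup>1 \<dots> x\<^sup>\<xi>\<^sup>n\<close> over \<open>\<xi>\<^sub>1, \<dots>, \<xi>\<^sub>n\<close> and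
  \<open>\<zeta>\<^sub>1, \<dots>, \<zeta>\<^bsub>n-1\<^esub>\<close>, for \<open>n \<ge> 1\<close>; the upper index of the \<open>i\<close>-th factor, which is the first lower
  index of the next, is the \<open>i\<close>-th entry of \<open>\<alpha> # \<zeta> @ [\<beta>]\<close>, counted from 0.\<close>

definition chain_sum ::
    "('n::{finite, linorder} \<Rightarrow> 'n \<Rightarrow> 'n \<Rightarrow> real) \<Rightarrow> nat \<Rightarrow> 'n \<Rightarrow> 'n \<Rightarrow> 'n polyvec" where
  "chain_sum C n \<alpha> \<beta> = (\<Sum>\<xi> | length \<xi> = n. \<Sum>\<zeta> | length \<zeta> = n - 1.
     (\<Prod>i<n. C ((\<alpha> # \<zeta> @ [\<beta>]) ! i) (\<xi> ! i) ((\<alpha> # \<zeta> @ [\<beta>]) ! Suc i)) *\<^sub>R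
       prod_list (map xvar \<xi>))"

definition is_deformed_bracket ::
    "('n::{finite, linorder} \<Rightarrow> 'n \<Rightarrow> 'n \<Rightarrow> real) \<Rightarrow>
     ('n polyvec fps \<Rightarrow> 'n polyvec fps \<Rightarrow> 'n polyvec fps) \<Rightarrow> bool" where
  "is_deformed_bracket C br \<longleftrightarrow>
     skew_biderivation hscale hpolyvec_deg br \<and> continuous_bracket hpolyvec_topology br \<and>
     (\<forall>\<alpha> \<beta>.
        br (fps_const (xvar \<alpha>)) (fps_const (xvar \<beta>)) = 0 \<and>
        br (fps_const (psi \<alpha>)) (fps_const (xvar \<beta>)) =
          Abs_fps (\<lambda>n. if n = 0 then if \<alpha> = \<beta> then 1 else 0
                       else (bernoulli n / fact n) *\<^sub>R chain_sum C n \<alpha> \<beta>) \<and>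
        br (fps_const (psi \<alpha>)) (fps_const (psi \<beta>)) =
          fps_X * fps_const (\<Sum>\<gamma>\<in>UNIV. C \<alpha> \<beta> \<gamma> *\<^sub>R psi \<gamma>))"

end

theory Submission
  imports Defs
begin

text \<open>Both algebras are topologically generated by the \<open>x\<^sup>\<alpha>\<close> and \<open>\<psi>\<^sub>\<alpha>\<close>, so a continuous
  biderivation is determined by its values on these, and the Jacobiator of one, being a derivation in
  each argument up to sign, vanishes as soon as it does so on generators. Existence of a bracket with
  prescribed values is given by a bidifferential operator.

  The only Jacobi identity on generators with content is the one for
  \<open>\<psi>\<^sub>\<alpha>, \<psi>\<^sub>\<beta>, x\<^sup>\<kappa>\<close>. It says that \<open>\<psi>\<^sub>\<alpha>\<close> acts on functions by vector
  fields \<open>X\<^sub>\<alpha>\<close> with \<open>[X\<^sub>\<alpha>, X\<^sub>\<beta>] = \<hbar> \<Sum>\<^sub>\<gamma> C\<^sub>\<alpha>\<^sub>\<beta>\<^sup>\<gamma> X\<^sub>\<gamma>\<close>. With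
  \<open>R u = [u, x]\<close>, the \<open>X\<^sub>\<alpha>\<close> are the rows of \<open>t / (e\<^sup>t - 1)\<close> at \<open>t = \<hbar> R\<close>, i.e. the left
  invariant vector fields in exponential coordinates. They are dual to the rows of
  \<open>(e\<^sup>t - 1) / t = \<Sum>\<^sub>n t\<^sup>n / (n + 1)!\<close>, for which the Maurer--Cartan equation follows from \<open>R\<close> being a
  derivation of the Lie bracket and a binomial identity.

  The Schouten bracket is the part of the deformed bracket of degree 0 in \<open>\<hbar>\<close>.\<close>

section \<open>Spaces of formal coefficient functions\<close>

text \<open>The given brackets determine nothing algebraically, because the generators span only
  polynomials; everything must pass through limits. Density is therefore used in the form "a
  continuous linear map that vanishes on words in the generators is zero", applied to maps that are
  derivations up to sign.

  The inverse matrix has the coefficients \<open>1 / (n + 1)!\<close> instead, so its exterior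
  derivative involves only binomial coefficients, and the Bernoulli numbers enter solely through
  their defining recurrence, as the coefficients of the inverse.

  That computation inverts matrices over functions and needs a commutative ring, whereas polyvector
  fields commute only up to sign; hence the separate ring of degree 0 elements.

  Signs depend on degrees, but a bracket has to be defined on inhomogeneous elements as well. Since
  there are finitely many odd variables, each series is a finite sum of homogeneous ones, and the
  parity operator makes the sign a linear map.\<close>

lemma continuous_map_discrete_binop:
  assumes "continuous_map X (discrete_topology UNIV) f" "continuous_map X (discrete_topology UNIV) g"
  shows "continuous_map X (discrete_topology UNIV) (\<lambda>z. h (f z) (g z))"
proof -
  have "continuous_map X (prod_topology (discrete_topology UNIV) (discrete_topology UNIV))
      (\<lambda>z. (f z, g z))"
    using assms by (simp add: continuous_map_pairedI)
  then have "continuous_map X (discrete_topology UNIV) (\<lambda>z. (f z, g z))"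
    by (simp add: prod_topology_discrete_topology[symmetric])
  then have "continuous_map X (discrete_topology UNIV) ((\<lambda>(u, v). h u v) \<circ> (\<lambda>z. (f z, g z)))"
    by (rule continuous_map_compose) simp
  then show ?thesis by (simp add: comp_def)
qed

lemma continuous_map_discrete_sum:
  fixes f :: "'j \<Rightarrow> 'x \<Rightarrow> 'b::comm_monoid_add"
  assumes "\<And>j. j \<in> J \<Longrightarrow> continuous_map X (discrete_topology UNIV) (f j)"
  shows "continuous_map X (discrete_topology UNIV) (\<lambda>z. \<Sum>j\<in>J. f j z)"
  using assms
proof (induction J rule: infinite_finite_induct)
  case (insert j J)
  then show ?case by (simp add: continuous_map_discrete_binop[where h="(+)"])
qed simp_all

text \<open>Serves twice: for \<open>polyvec\<close> with indices \<open>(m, S)\<close> and for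
  \<open>polyvec fps\<close> with indices \<open>(k, m, S)\<close>, so that topology and grading are
  treated only once.\<close>

locale coefficient_space =
  fixes cf :: "'a::ab_group_add \<Rightarrow> 'i \<Rightarrow> real"
  assumes bij_cf: "bij cf"
    and cf_add: "cf (a + b) i = cf a i + cf b i"
begin

lemma cf_eqI: "(\<And>i. cf a i = cf b i) \<Longrightarrow> a = b"
  using bij_cf by (metis bij_is_inj ext injD)

lemma cf_zero: "cf 0 i = 0"
  using cf_add[of 0 0 i] by simp

lemma cf_uminus: "cf (- a) i = - cf a i"
  using cf_add[of a "- a" i] by (simp add: cf_zero)

lemma cf_diff: "cf (a - b) i = cf a i - cf b i"
  using cf_add[of a "- b" i] by (simp add: cf_uminus)

lemma cf_sum: "cf (sum f J) i = (\<Sum>j\<in>J. cf (f j) i)"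
  by (induction J rule: infinite_finite_induct) (simp_all add: cf_zero cf_add)

definition coeff_topology :: "'a topology" where
  "coeff_topology = pullback_topology UNIV cf (product_topology (\<lambda>_. discrete_topology UNIV) UNIV)"

lemma topspace_coeff_topology [simp]: "topspace coeff_topology = UNIV"
  by (simp add: coeff_topology_def topspace_pullback_topology)

lemma continuous_map_into_coeff_topology:
  "continuous_map X coeff_topology f \<longleftrightarrow>
    (\<forall>i. continuous_map X (discrete_topology UNIV) (\<lambda>z. cf (f z) i))"
proof -
  have "continuous_map X coeff_topology f \<longleftrightarrow>
      continuous_map X (product_topology (\<lambda>_. discrete_topology UNIV) UNIV) (cf \<circ> f)"
  proof
    assume "continuous_map X coeff_topology f"
    moreover have "continuous_map coeff_topology (product_topology (\<lambda>_. discrete_topology UNIV) UNIV) cf"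
      unfolding coeff_topology_def using continuous_map_pullback[OF continuous_map_id] by fastforce
    ultimately show "continuous_map X (product_topology (\<lambda>_. discrete_topology UNIV) UNIV) (cf \<circ> f)"
      by (rule continuous_map_compose)
  next
    assume "continuous_map X (product_topology (\<lambda>_. discrete_topology UNIV) UNIV) (cf \<circ> f)"
    then show "continuous_map X coeff_topology f"
      unfolding coeff_topology_def by (rule continuous_map_pullback') auto
  qed
  then show ?thesis by (simp add: continuous_map_componentwise_UNIV comp_def)
qed

lemma continuous_map_cf:
  assumes "continuous_map X coeff_topology f"
  shows "continuous_map X (discrete_topology UNIV) (\<lambda>z. cf (f z) i)"
  using assms continuous_map_into_coeff_topology by blast

lemma continuous_map_coeff_add:
  assumes "continuous_map X coeff_topology f" "continuous_map X coeff_topology g"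
  shows "continuous_map X coeff_topology (\<lambda>z. f z + g z)"
  using assms unfolding continuous_map_into_coeff_topology cf_add
  by (simp add: continuous_map_discrete_binop[where h="(+)"])

lemma continuous_coeff_plus:
  "continuous_map (prod_topology coeff_topology coeff_topology) coeff_topology (\<lambda>(a, b). a + b)"
  unfolding case_prod_beta
  by (intro continuous_map_coeff_add continuous_map_fst continuous_map_snd)

lemma continuous_map_coeff_uminus:
  assumes "continuous_map X coeff_topology f"
  shows "continuous_map X coeff_topology (\<lambda>z. - f z)"
  using assms unfolding continuous_map_into_coeff_topology cf_uminus
  by (intro allI) (rule continuous_map_discrete_binop[where h="\<lambda>u _. - u"], auto)

lemma continuous_map_coeff_sum:
  assumes "\<And>j. j \<in> J \<Longrightarrow> continuous_map X coeff_topology (f j)"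
  shows "continuous_map X coeff_topology (\<lambda>z. \<Sum>j\<in>J. f j z)"
  using assms unfolding continuous_map_into_coeff_topology cf_sum
  by (simp add: continuous_map_discrete_sum)

text \<open>The set on which coordinate \<open>i\<close> of \<open>L a\<close> vanishes is open and
  contains 0, hence contains a box around 0; a box in the product topology restricts only finitely
  many coordinates.\<close>

lemma continuous_at_zero:
  assumes "continuous_map coeff_topology coeff_topology L" "L 0 = 0"
  obtains I where "finite I" "\<And>a. (\<And>j. j \<in> I \<Longrightarrow> cf a j = 0) \<Longrightarrow> cf (L a) i = 0"
proof -
  have "continuous_map coeff_topology (discrete_topology UNIV) (\<lambda>a. cf (L a) i)"
    using assms(1) by (rule continuous_map_cf)
  then have "openin coeff_topology {a \<in> topspace coeff_topology. cf (L a) i \<in> {0}}"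
    by (rule openin_continuous_map_preimage) simp
  then obtain U where U: "openin (product_topology (\<lambda>_. discrete_topology UNIV) UNIV) U"
      "{a. cf (L a) i = 0} = cf -` U"
    unfolding coeff_topology_def openin_pullback_topology by (auto simp: topspace_pullback_topology)
  have "0 \<in> {a. cf (L a) i = 0}" using assms(2) by (simp add: cf_zero)
  then have "cf 0 \<in> U" using U(2) by simp
  with U(1) obtain W where W: "finite {j. W j \<noteq> UNIV}" "cf 0 \<in> Pi\<^sub>E UNIV W" "Pi\<^sub>E UNIV W \<subseteq> U"
    by (force simp: openin_product_topology_alt)
  have "cf (L a) i = 0" if a: "\<And>j. j \<in> {j. W j \<noteq> UNIV} \<Longrightarrow> cf a j = 0" for a
  proof -
    have "cf a j \<in> W j" for j
    proof (cases "W j = UNIV")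
      case False
      then have "cf a j = cf 0 j" using a by (simp add: cf_zero)
      then show ?thesis using W(2) by auto
    qed simp
    then have "cf a \<in> U" using W(3) by auto
    then show ?thesis using U(2) by auto
  qed
  with W(1) show ?thesis by (rule that)
qed

text \<open>Finitely many degrees occur among the indices, so splitting the coordinates by degree
  gives a finite sum even for an infinite series; no completed direct sum is involved.\<close>

lemma direct_sum_by_index_degree:
  fixes deg :: "'i \<Rightarrow> int"
  assumes fin: "finite (range deg)"
    and D: "\<And>d. D d = {a. \<forall>i. cf a i \<noteq> 0 \<longrightarrow> deg i = d}"
  shows "\<exists>!c. finite {d. c d \<noteq> 0} \<and> (\<forall>d. c d \<in> D d) \<and> a = (\<Sum>d | c d \<noteq> 0. c d)"
proof
  define c where "c d = inv cf (\<lambda>i. if deg i = d then cf a i else 0)" for d :: int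
  have cf_c: "cf (c d) i = (if deg i = d then cf a i else 0)" for d i
    unfolding c_def by (subst surj_f_inv_f) (use bij_cf bij_is_surj in auto)
  have "{d. c d \<noteq> 0} \<subseteq> range deg"
  proof (rule subsetI, rule ccontr)
    fix d assume "d \<in> {d. c d \<noteq> 0}" "d \<notin> range deg"
    moreover have "c d = 0" if "d \<notin> range deg"
      by (rule cf_eqI) (use that in \<open>auto simp: cf_c cf_zero\<close>)
    ultimately show False by blast
  qed
  then have fin_c: "finite {d. c d \<noteq> 0}" using fin finite_subset by blast
  moreover have "\<forall>d. c d \<in> D d" by (simp add: D cf_c)
  moreover have "a = (\<Sum>d | c d \<noteq> 0. c d)"
  proof (rule cf_eqI)
    fix i
    have "cf (\<Sum>d | c d \<noteq> 0. c d) i = (\<Sum>d | c d \<noteq> 0. if deg i = d then cf a i else 0)"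
      by (simp add: cf_sum cf_c)
    also have "\<dots> = cf a i"
      using cf_c[of "deg i" i] cf_zero[of i] by (auto simp: fin_c)
    finally show "cf a i = cf (\<Sum>d | c d \<noteq> 0. c d) i" by simp
  qed
  ultimately show "finite {d. c d \<noteq> 0} \<and> (\<forall>d. c d \<in> D d) \<and> a = (\<Sum>d | c d \<noteq> 0. c d)" by blast
  fix c' assume c': "finite {d. c' d \<noteq> 0} \<and> (\<forall>d. c' d \<in> D d) \<and> a = (\<Sum>d | c' d \<noteq> 0. c' d)"
  show "c' = c"
  proof (rule ext, rule cf_eqI)
    fix d i
    \<comment> \<open>At index \<open>i\<close> only the component of degree \<open>deg i\<close>
      can be nonzero, so any decomposition is read off from the coordinates of
      \<open>a\<close>.\<close>
    have out: "cf (c' e) i = 0" if "e \<noteq> deg i" for e using c' that by (auto simp: D)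
    have "cf a i = (\<Sum>e | c' e \<noteq> 0. cf (c' e) i)" using c' cf_sum by metis
    also have "\<dots> = (\<Sum>e | c' e \<noteq> 0. if e = deg i then cf (c' (deg i)) i else 0)"
      by (intro sum.cong refl) (auto simp: out)
    also have "\<dots> = cf (c' (deg i)) i" using c' by (auto simp: cf_zero)
    finally show "cf (c' d) i = cf (c d) i" using out by (auto simp: cf_c)
  qed
qed

end


section \<open>Biderivations on topologically generated algebras\<close>

lemma neg_pow_simps:
  "neg_pow k (neg_pow k a) = a" "neg_pow k (- a) = - neg_pow k a" "neg_pow k 0 = 0"
  "neg_pow k (b + c) = neg_pow k b + neg_pow k c"
  for a b c :: "'a::ab_group_add"
  by (auto simp: neg_pow_def)

context graded_commutative_algebra
begin

lemmas D_add = subspace_add[OF subspace_D]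
  and D_uminus = subspace_neg[OF subspace_D]
  and D_diff = subspace_diff[OF subspace_D]
  and D_zero = subspace_0[OF subspace_D]
  and D_sum = subspace_sum[OF subspace_D]
  and D_scale = subspace_scale[OF subspace_D]

lemma D_neg_pow: "a \<in> D d \<Longrightarrow> neg_pow k a \<in> D d"
  by (simp add: neg_pow_def D_uminus)

lemma module_hom_ext_homogeneous:
  assumes f: "module_hom scale scale f" and "module_hom scale scale g"
    and eq: "\<And>d a. a \<in> D d \<Longrightarrow> f a = g a"
  shows "f = g"
proof
  fix a
  obtain c where c: "\<forall>d. c d \<in> D d" "a = (\<Sum>d | c d \<noteq> 0. c d)"
    using direct_sum[of a] by blast
  have "f a = (\<Sum>d | c d \<noteq> 0. f (c d))" by (subst c(2)) (rule module_hom.sum[OF f])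
  also have "\<dots> = (\<Sum>d | c d \<noteq> 0. g (c d))" using eq[OF c(1)[rule_format]] by simp
  also have "\<dots> = g a" by (subst c(2)) (rule module_hom.sum[OF assms(2), symmetric])
  finally show "f a = g a" .
qed

lemma module_hom_mult: "module_hom scale scale f \<Longrightarrow> module_hom scale scale (\<lambda>a. f a * b)"
  "module_hom scale scale f \<Longrightarrow> module_hom scale scale (\<lambda>a. b * f a)"
  by (simp_all add: module_hom_iff scale_mult_left scale_mult_right distrib_left distrib_right)

end

text \<open>Density of the span of the words is assumed through its consequence for continuous
  linear maps, the only form in which it is applied.\<close>

locale generated_algebra = graded_commutative_algebra scale D
  for scale :: "'k::comm_ring_1 \<Rightarrow> 'a::ring_1 \<Rightarrow> 'a" and D +
  fixes T :: "'a topology" and G :: "'a set"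
  assumes topspace_T [simp]: "topspace T = UNIV"
    and continuous_plus: "continuous_map (prod_topology T T) T (\<lambda>(a, b). a + b)"
    and continuous_minus: "continuous_map T T uminus"
    and generator_homogeneous: "g \<in> G \<Longrightarrow> \<exists>d. g \<in> D d"
    and words_dense: "module_hom scale scale L \<Longrightarrow> continuous_map T T L \<Longrightarrow>
      (\<And>w. set w \<subseteq> G \<Longrightarrow> L (prod_list w) = 0) \<Longrightarrow> L a = 0"
begin

lemma continuous_add:
  assumes "continuous_map X T f" "continuous_map X T f'"
  shows "continuous_map X T (\<lambda>z. f z + f' z)"
proof -
  have "continuous_map X T ((\<lambda>(a, b). a + b) \<circ> (\<lambda>z. (f z, f' z)))"
    by (rule continuous_map_compose[OF _ continuous_plus]) (simp add: assms continuous_map_pairedI)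
  then show ?thesis by (simp add: comp_def)
qed

lemma continuous_uminus:
  assumes "continuous_map X T f"
  shows "continuous_map X T (\<lambda>z. - f z)"
  using continuous_map_compose[OF assms continuous_minus] by (simp add: comp_def)

lemma word_homogeneous: "set w \<subseteq> G \<Longrightarrow> \<exists>d. prod_list w \<in> D d"
proof (induction w)
  case Nil
  then show ?case using one_D by auto
next
  case (Cons g w)
  then obtain d e where "g \<in> D d" "prod_list w \<in> D e" using generator_homogeneous by force
  then show ?case using mult_D by fastforce
qed

text \<open>The Leibniz rule at \<open>1 * 1\<close> forces \<open>L 1 = 0\<close>, and then kills
  every word by induction on its length. The integer \<open>e\<close> is the degree of
  \<open>L\<close> as far as signs are concerned.\<close>

lemma derivation_eq_zero:
  assumes hom: "module_hom scale scale L" and cont: "continuous_map T T L"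
    and leibniz: "\<And>a b d f. a \<in> D d \<Longrightarrow> b \<in> D f \<Longrightarrow> L (a * b) = L a * b + neg_pow (e * d) (a * L b)"
    and gens: "\<And>g. g \<in> G \<Longrightarrow> L g = 0"
  shows "L a = 0"
proof (rule words_dense[OF hom cont])
  have "L 1 = L 1 + L 1" using leibniz[OF one_D one_D] by (simp add: neg_pow_def)
  then have L1: "L 1 = 0" by simp
  show "L (prod_list w) = 0" if "set w \<subseteq> G" for w
    using that
  proof (induction w)
    case (Cons g w)
    then obtain d f where "g \<in> D d" "prod_list w \<in> D f"
      using generator_homogeneous word_homogeneous by force
    with Cons show ?case by (simp add: leibniz gens neg_pow_simps)
  qed (simp add: L1)
qed

end

locale continuous_biderivation = generated_algebra scale D T G + skew_biderivation scale D br
  for scale :: "'k::comm_ring_1 \<Rightarrow> 'a::ring_1 \<Rightarrow> 'a" and D T G br +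
  assumes continuous: "continuous_bracket T br"
begin

lemma continuous_right: "continuous_map X T f \<Longrightarrow> continuous_map X T (\<lambda>z. br a (f z))"
proof -
  assume f: "continuous_map X T f"
  then have "continuous_map X (prod_topology T T) (\<lambda>z. (a, f z))"
    by (simp add: continuous_map_pairedI)
  then have "continuous_map X T ((\<lambda>(a, b). br a b) \<circ> (\<lambda>z. (a, f z)))"
    by (rule continuous_map_compose) (use continuous in \<open>simp add: continuous_bracket_def\<close>)
  then show ?thesis by (simp add: comp_def)
qed

lemma br_right_simps:
  "br a (b + c) = br a b + br a c" "br a (- b) = - br a b" "br a 0 = 0" "br a (b - c) = br a b - br a c"
  "br a (scale r b) = scale r (br a b)" "br a (neg_pow k b) = neg_pow k (br a b)"
  using module_hom.add[OF linear_right] module_hom.neg[OF linear_right] module_hom.zero[OF linear_right]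
    module_hom.diff[OF linear_right] module_hom.scale[OF linear_right] by (auto simp: neg_pow_def)

lemma br_left_simps:
  "br (b + c) a = br b a + br c a" "br (- b) a = - br b a" "br 0 a = 0" "br (b - c) a = br b a - br c a"
  "br (scale r b) a = scale r (br b a)" "br (neg_pow k b) a = neg_pow k (br b a)"
  using module_hom.add[OF linear_left] module_hom.neg[OF linear_left] module_hom.zero[OF linear_left]
    module_hom.diff[OF linear_left] module_hom.scale[OF linear_left] by (auto simp: neg_pow_def)

lemma br_sum_right: "br a (sum f J) = (\<Sum>j\<in>J. br a (f j))"
  and br_sum_left: "br (sum f J) a = (\<Sum>j\<in>J. br (f j) a)"
  by (rule module_hom.sum[OF linear_right], rule module_hom.sum[OF linear_left])

text \<open>The degrees are arguments because 0 is homogeneous of every degree, so the sign is not a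
  function of the elements. The degree of \<open>c\<close> does not enter the sign.\<close>

definition jacobi_at :: "int \<Rightarrow> int \<Rightarrow> 'a \<Rightarrow> 'a \<Rightarrow> 'a \<Rightarrow> bool" where
  "jacobi_at d e a b c \<longleftrightarrow>
     br a (br b c) = br (br a b) c + neg_pow ((d - 1) * (e - 1)) (br b (br a c))"

text \<open>Together with \<open>jacobi_swap_right\<close> this generates all permutations of the
  three arguments, so that a reduction to generators in the last argument alone is enough.\<close>

lemma jacobi_swap_left:
  assumes "a \<in> D d" "b \<in> D e" "jacobi_at d e a b c"
  shows "jacobi_at e d b a c"
proof -
  have "br (br b a) c = - neg_pow ((d - 1) * (e - 1)) (br (br a b) c)"
    using skew[OF assms(2,1)] by (simp add: br_left_simps mult.commute)
  then show ?thesis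
    using assms(3) by (simp add: jacobi_at_def mult.commute[of "e - 1"] neg_pow_simps)
qed

lemma jacobi_swap_right:
  assumes "a \<in> D d" "b \<in> D e" "c \<in> D f" "jacobi_at d e a b c"
  shows "jacobi_at d f a c b"
proof -
  have 1: "br a (br c b) = - neg_pow ((e - 1) * (f - 1)) (br a (br b c))"
    using skew[OF assms(3,2)] by (simp add: br_right_simps mult.commute)
  have 2: "br (br a c) b = - neg_pow ((d + f - 1 - 1) * (e - 1)) (br b (br a c))"
    by (rule skew) (use assms br_D in auto)
  have 3: "br c (br a b) = - neg_pow ((f - 1) * (d + e - 1 - 1)) (br (br a b) c)"
    by (rule skew) (use assms br_D in auto)
  show ?thesis
    using assms(4) unfolding jacobi_at_def 1 2 3
    by (cases "even d"; cases "even e"; cases "even f") (simp_all add: neg_pow_def)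
qed

text \<open>For fixed \<open>a\<close> and \<open>b\<close> the difference \<open>L\<close> of the
  two sides is a derivation of degree \<open>d + e - 2\<close> in \<open>c\<close>, being built from
  the derivations \<open>br a\<close>, \<open>br b\<close> and \<open>br (br a b)\<close> like a
  graded commutator.\<close>

lemma jacobi_generators_right:
  assumes a: "a \<in> D d" and b: "b \<in> D e" and gens: "\<And>g. g \<in> G \<Longrightarrow> jacobi_at d e a b g"
  shows "jacobi_at d e a b c"
proof -
  define L where "L c = br a (br b c) + - br (br a b) c + - neg_pow ((d - 1) * (e - 1)) (br b (br a c))" for c
  have "L c = 0" for c
  proof (rule derivation_eq_zero[where L=L and e="d + e - 2"])
    show "module_hom scale scale L"
      unfolding module_hom_iff L_def neg_pow_def
      using module_axioms by (simp add: br_right_simps scale_right_diff_distrib scale_right_distrib)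
    have "continuous_map T T (\<lambda>c. neg_pow ((d - 1) * (e - 1)) (br b (br a c)))"
      unfolding neg_pow_def by (simp add: continuous_right continuous_uminus)
    then show "continuous_map T T L"
      unfolding L_def by (intro continuous_add continuous_uminus continuous_right) simp_all
    show "L g = 0" if "g \<in> G" for g
      using gens[OF that] by (simp add: jacobi_at_def L_def)
    fix u v i j assume u: "u \<in> D i" and v: "v \<in> D j"
    note R = derivation_right
    \<comment> \<open>The mixed products \<open>br b u * br a v\<close> and
      \<open>br a u * br b v\<close> occur both here and in the next expansion; with the sign in
      front of the latter they cancel in \<open>L\<close>.\<close>
    have 1: "br a (br b (u * v)) = br a (br b u) * v + neg_pow ((d - 1) * (e + i - 1)) (br b u * br a v)
        + neg_pow ((e - 1) * i) (br a u * br b v + neg_pow ((d - 1) * i) (u * br a (br b v)))"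
      by (simp add: R[OF b u v] br_right_simps R[OF a br_D[OF b u] v] R[OF a u br_D[OF b v]])
    have 2: "br b (br a (u * v)) = br b (br a u) * v + neg_pow ((e - 1) * (d + i - 1)) (br a u * br b v)
        + neg_pow ((d - 1) * i) (br b u * br a v + neg_pow ((e - 1) * i) (u * br b (br a v)))"
      by (simp add: R[OF a u v] br_right_simps R[OF b br_D[OF a u] v] R[OF b u br_D[OF a v]])
    have 3: "br (br a b) (u * v) = br (br a b) u * v + neg_pow ((d + e - 1 - 1) * i) (u * br (br a b) v)"
      by (rule R[OF br_D[OF a b] u v])
    show "L (u * v) = L u * v + neg_pow ((d + e - 2) * i) (u * L v)"
      unfolding L_def 1 2 3
      by (cases "even d"; cases "even e"; cases "even i") (simp_all add: neg_pow_def algebra_simps)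
  qed
  from this[of c] show ?thesis by (simp add: jacobi_at_def L_def diff_diff_eq)
qed

text \<open>Each round frees the last argument and then permutes the next generator into last place:
  generators in two slots, then in one, then in none. Uniqueness of degrees turns the sign supplied
  by \<open>gens\<close> into the sign belonging to the chosen degrees.\<close>

lemma jacobi_from_generators:
  assumes gens: "\<And>g h k. g \<in> G \<Longrightarrow> h \<in> G \<Longrightarrow> k \<in> G \<Longrightarrow>
      \<exists>d e. g \<in> D d \<and> h \<in> D e \<and> jacobi_at d e g h k"
    and unique_degree: "\<And>g d e. g \<in> G \<Longrightarrow> g \<in> D d \<Longrightarrow> g \<in> D e \<Longrightarrow> d = e"
    and a: "a \<in> D d" and b: "b \<in> D e" and c: "c \<in> D f"
  shows "jacobi_at d e a b c"
proof -
  have 1: "jacobi_at i j g h k" if gh: "g \<in> G" "h \<in> G" "g \<in> D i" "h \<in> D j" for g h i j k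
  proof (rule jacobi_generators_right[OF gh(3,4)])
    fix k assume "k \<in> G"
    then obtain d' e' where "g \<in> D d'" "h \<in> D e'" "jacobi_at d' e' g h k"
      using gens gh by blast
    with gh unique_degree show "jacobi_at i j g h k" by metis
  qed
  have 2: "jacobi_at i j g u v" if "g \<in> G" "g \<in> D i" "u \<in> D j" for g u v i j
  proof (rule jacobi_generators_right[OF that(2,3)])
    fix h assume h: "h \<in> G"
    then obtain k where "h \<in> D k" using generator_homogeneous by blast
    with 1[OF that(1) h that(2)] show "jacobi_at i j g u h"
      using jacobi_swap_right[OF that(2) _ that(3)] by blast
  qed
  show ?thesis
  proof (rule jacobi_generators_right[OF a b])
    fix g assume g: "g \<in> G"
    then obtain k where k: "g \<in> D k" using generator_homogeneous by blast
    have "jacobi_at d k a g b" using jacobi_swap_left[OF k a 2[OF g k a]] .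
    then show "jacobi_at d e a b g" by (rule jacobi_swap_right[OF a k b])
  qed
qed

end

text \<open>For homogeneous \<open>a\<close> the difference of \<open>br a\<close> and
  \<open>br' a\<close> is a derivation of degree \<open>d - 1\<close>. This is applied first with
  \<open>a\<close> a generator, then, after exchanging arguments by skew symmetry, with arbitrary
  homogeneous \<open>a\<close>; linearity removes homogeneity.\<close>

lemma continuous_biderivation_unique:
  fixes scale :: "'k::comm_ring_1 \<Rightarrow> 'a::ring_1 \<Rightarrow> 'a"
  assumes "continuous_biderivation scale D T G br" "continuous_biderivation scale D T G br'"
    and gens: "\<And>g h. g \<in> G \<Longrightarrow> h \<in> G \<Longrightarrow> br g h = br' g h"
  shows "br = br'"
proof -
  interpret b: continuous_biderivation scale D T G br by fact
  interpret b': continuous_biderivation scale D T G br' by fact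
  have ext: "br a c = br' a c" if a: "a \<in> D d" and eq: "\<And>g. g \<in> G \<Longrightarrow> br a g = br' a g" for a c d
  proof -
    have "br a c + - br' a c = 0"
    proof (rule b.derivation_eq_zero[where L="\<lambda>c. br a c + - br' a c" and e="d - 1"])
      show "module_hom scale scale (\<lambda>c. br a c + - br' a c)"
        unfolding module_hom_iff using b.module_axioms
        by (simp add: b.br_right_simps b'.br_right_simps b.scale_right_diff_distrib)
      show "continuous_map T T (\<lambda>c. br a c + - br' a c)"
        by (intro b.continuous_add b.continuous_uminus b.continuous_right b'.continuous_right) simp_all
      show "br a g + - br' a g = 0" if "g \<in> G" for g using eq[OF that] by simp
      fix u v i j assume "u \<in> D i" "v \<in> D j"
      then show "br a (u * v) + - br' a (u * v) =
          (br a u + - br' a u) * v + neg_pow ((d - 1) * i) (u * (br a v + - br' a v))"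
        by (cases "even d"; cases "even i")
          (simp_all add: b.derivation_right[OF a] b'.derivation_right[OF a] neg_pow_def algebra_simps)
    qed
    then show ?thesis by simp
  qed
  have hom: "br a c = br' a c" if a: "a \<in> D d" for a c d
  proof (rule ext[OF a])
    fix g assume g: "g \<in> G"
    then obtain e where e: "g \<in> D e" using b.generator_homogeneous by blast
    have "br g a = br' g a" by (rule ext[OF e]) (use gens g in blast)
    then show "br a g = br' a g" using b.skew[OF a e] b'.skew[OF a e] by simp
  qed
  have "(\<lambda>a. br a c) = (\<lambda>a. br' a c)" for c
    by (rule b.module_hom_ext_homogeneous[OF b.linear_left b'.linear_left hom])
  then show ?thesis by (simp add: fun_eq_iff)
qed


section \<open>The bracket of a bidifferential operator\<close>

lemma neg_pow_sum: "neg_pow k (sum f J) = (\<Sum>j\<in>J. neg_pow k (f j))"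
  for f :: "'j \<Rightarrow> 'a::ab_group_add"
  by (simp add: neg_pow_def sum_negf)

lemma neg_pow_mult: "neg_pow k a * b = neg_pow k (a * b)" "b * neg_pow k a = neg_pow k (b * a)"
  for a b :: "'a::ring_1"
  by (simp_all add: neg_pow_def)

text \<open>\<open>F\<close> and \<open>P\<close> are the values to be prescribed for \<psi> with x
  and \<psi> with \<psi>. Elements of degree 1 have shifted degree 0, so skew symmetry requires
  \<open>P\<close> to be antisymmetric. \<open>par\<close> carries the sign of the degree as a
  linear map on all elements.\<close>

locale graded_calculus = graded_commutative_algebra scale D
  for scale :: "'k::comm_ring_1 \<Rightarrow> 'a::ring_1 \<Rightarrow> 'a" and D +
  fixes par :: "'a \<Rightarrow> 'a" and dx dpsi :: "'n::finite \<Rightarrow> 'a \<Rightarrow> 'a" and x psi :: "'n \<Rightarrow> 'a"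
    and F P :: "'n \<Rightarrow> 'n \<Rightarrow> 'a"
  assumes par_hom: "module_hom scale scale par"
    and dx_hom: "module_hom scale scale (dx \<alpha>)"
    and dpsi_hom: "module_hom scale scale (dpsi \<alpha>)"
    and par_D: "a \<in> D d \<Longrightarrow> par a = neg_pow d a"
    and dx_D: "a \<in> D d \<Longrightarrow> dx \<alpha> a \<in> D d"
    and dpsi_D: "a \<in> D d \<Longrightarrow> dpsi \<alpha> a \<in> D (d - 1)"
    and dx_mult: "dx \<alpha> (a * b) = dx \<alpha> a * b + a * dx \<alpha> b"
    and dpsi_mult: "a \<in> D d \<Longrightarrow> dpsi \<alpha> (a * b) = dpsi \<alpha> a * b + neg_pow d (a * dpsi \<alpha> b)"
    and x_D: "x \<alpha> \<in> D 0" and psi_D: "psi \<alpha> \<in> D 1"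
    and dx_x: "dx \<alpha> (x \<beta>) = (if \<alpha> = \<beta> then 1 else 0)" and dx_psi: "dx \<alpha> (psi \<beta>) = 0"
    and dpsi_x: "dpsi \<alpha> (x \<beta>) = 0" and dpsi_psi: "dpsi \<alpha> (psi \<beta>) = (if \<alpha> = \<beta> then 1 else 0)"
    and F_D: "F \<alpha> \<beta> \<in> D 0" and P_D: "P \<alpha> \<beta> \<in> D 1" and P_antisym: "P \<beta> \<alpha> = - P \<alpha> \<beta>"
begin

text \<open>The formula is forced: \<open>{a, \<cdot>}\<close> must be \<open>\<Sum>\<^sub>\<beta> {a, x\<^sup>\<beta>} \<partial>\<^sub>\<beta> + {a, \<psi>\<^sub>\<beta>} \<partial>/\<partial>\<psi>\<^sub>\<beta>\<close>, and the
  coefficients are found by skew symmetry from the analogous expansion of \<open>{x\<^sup>\<beta>, \<cdot>}\<close> and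
  \<open>{\<psi>\<^sub>\<beta>, \<cdot>}\<close>.\<close>

definition bracket :: "'a \<Rightarrow> 'a \<Rightarrow> 'a" where
  "bracket a b = - (\<Sum>\<beta>\<in>UNIV. (\<Sum>\<alpha>\<in>UNIV. F \<alpha> \<beta> * dpsi \<alpha> (par a)) * dx \<beta> b
     + (\<Sum>\<alpha>\<in>UNIV. F \<beta> \<alpha> * dx \<alpha> a + P \<beta> \<alpha> * dpsi \<alpha> a) * dpsi \<beta> b)"

text \<open>Up to sign these sums are the brackets of \<open>a\<close> with \<open>x \<beta>\<close>
  and with \<open>psi \<beta>\<close>; their degrees govern the signs when a factor is moved past
  them.\<close>

lemma coefficient_D:
  assumes "a \<in> D d"
  shows "(\<Sum>\<alpha>\<in>UNIV. F \<alpha> \<beta> * dpsi \<alpha> (par a)) \<in> D (d - 1)"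
    and "(\<Sum>\<alpha>\<in>UNIV. F \<beta> \<alpha> * dx \<alpha> a + P \<beta> \<alpha> * dpsi \<alpha> a) \<in> D d"
proof -
  have "par a \<in> D d" using assms par_D D_neg_pow by simp
  then show "(\<Sum>\<alpha>\<in>UNIV. F \<alpha> \<beta> * dpsi \<alpha> (par a)) \<in> D (d - 1)"
    by (intro D_sum) (metis F_D dpsi_D mult_D add_0)
  have "F \<beta> \<alpha> * dx \<alpha> a \<in> D d" for \<alpha>
    using mult_D[OF F_D dx_D[OF assms]] by simp
  moreover have "P \<beta> \<alpha> * dpsi \<alpha> a \<in> D d" for \<alpha>
    using mult_D[OF P_D dpsi_D[OF assms]] by simp
  ultimately show "(\<Sum>\<alpha>\<in>UNIV. F \<beta> \<alpha> * dx \<alpha> a + P \<beta> \<alpha> * dpsi \<alpha> a) \<in> D d"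
    by (intro D_sum D_add)
qed

lemma bracket_D:
  assumes "a \<in> D d" "b \<in> D e"
  shows "bracket a b \<in> D (d + e - 1)"
proof -
  have "u * dx \<beta> b \<in> D (d + e - 1)" if "u \<in> D (d - 1)" for u \<beta>
    using mult_D[OF that dx_D[OF assms(2)]] by (simp add: algebra_simps)
  moreover have "u * dpsi \<beta> b \<in> D (d + e - 1)" if "u \<in> D d" for u \<beta>
    using mult_D[OF that dpsi_D[OF assms(2)]] by (simp add: algebra_simps)
  ultimately show ?thesis
    unfolding bracket_def by (intro D_uminus D_sum D_add) (simp_all add: coefficient_D assms)
qed

text \<open>Of the three kinds of terms, skew symmetry exchanges those pairing an odd with an even
  derivative (\<open>S1\<close> and \<open>S2\<close>) and preserves those with two odd derivatives
  (\<open>S3\<close>), the latter by antisymmetry of \<open>P\<close>. The involution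
  \<open>s\<close> collects the expected sign.\<close>

lemma bracket_skew:
  assumes a: "a \<in> D d" and b: "b \<in> D e"
  shows "bracket a b = - neg_pow ((d - 1) * (e - 1)) (bracket b a)"
proof -
  define s where "s = neg_pow ((d - 1) * (e - 1)) \<circ> (uminus :: 'a \<Rightarrow> 'a)"
  define S1 where "S1 d a b = (\<Sum>\<beta>\<in>UNIV. \<Sum>\<alpha>\<in>UNIV. neg_pow d (F \<alpha> \<beta> * dpsi \<alpha> a * dx \<beta> b))" for d a b
  define S2 where "S2 a b = (\<Sum>\<beta>\<in>UNIV. \<Sum>\<alpha>\<in>UNIV. F \<beta> \<alpha> * dx \<alpha> a * dpsi \<beta> b)" for a b
  define S3 where "S3 a b = (\<Sum>\<beta>\<in>UNIV. \<Sum>\<alpha>\<in>UNIV. P \<beta> \<alpha> * dpsi \<alpha> a * dpsi \<beta> b)" for a b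
  have s_add: "s (u + v) = s u + s v" and s_neg: "s (- u) = - s u" and s_s: "s (s u) = u"
    and s_sum: "s (sum f J) = (\<Sum>j\<in>J. s (f j))" for u v f and J :: "'n set"
    by (simp_all add: s_def neg_pow_def sum_negf)
  have dec: "bracket a b = - (S1 d a b + S2 a b + S3 a b)" if "a \<in> D d" for a b d
  proof -
    have "dpsi \<alpha> (par a) = neg_pow d (dpsi \<alpha> a)" for \<alpha>
      using that module_hom.neg[OF dpsi_hom] by (simp add: par_D neg_pow_def)
    then show ?thesis
      by (simp add: bracket_def S1_def S2_def S3_def sum_distrib_right neg_pow_mult
          distrib_right sum.distrib)
  qed
  \<comment> \<open>Stated for arbitrary arguments and degrees because it is also needed with the
    roles of \<open>a\<close> and \<open>b\<close> exchanged.\<close>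
  have 1: "S1 d a b = s (S2 b a)" if a: "a \<in> D d" and b: "b \<in> D e"
    and s: "s = neg_pow ((d - 1) * (e - 1)) \<circ> uminus" for a b d e
  proof -
    have "neg_pow d (F \<alpha> \<beta> * dpsi \<alpha> a * dx \<beta> b) = s (F \<alpha> \<beta> * dx \<beta> b * dpsi \<alpha> a)" for \<alpha> \<beta>
      using graded_commute[OF dpsi_D[OF a] dx_D[OF b], of \<alpha> \<beta>]
      by (cases "even d"; cases "even e") (simp_all add: s neg_pow_def mult.assoc)
    then show ?thesis unfolding S1_def S2_def s_sum by (subst sum.swap) simp
  qed
  have "s = neg_pow ((e - 1) * (d - 1)) \<circ> uminus" by (simp add: s_def mult.commute)
  from 1[OF b a this] have 2: "S2 a b = s (S1 e b a)" by (simp add: s_s)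
  have "P \<beta> \<alpha> * dpsi \<alpha> a * dpsi \<beta> b = s (P \<alpha> \<beta> * dpsi \<beta> b * dpsi \<alpha> a)" for \<alpha> \<beta>
    using graded_commute[OF dpsi_D[OF a] dpsi_D[OF b], of \<alpha> \<beta>]
    by (simp add: s_def neg_pow_def mult.assoc P_antisym[of \<beta> \<alpha>])
  then have 3: "S3 a b = s (S3 b a)" unfolding S3_def s_sum by (subst sum.swap) simp
  have "bracket a b = s (bracket b a)"
    unfolding dec[OF a] dec[OF b] s_neg s_add 1[OF a b s_def] 2 3 s_s by (simp add: add.commute add.left_commute)
  then show ?thesis by (simp add: s_def neg_pow_simps)
qed

lemma bracket_linear_right: "module_hom scale scale (bracket a)"
proof -
  interpret module_pair scale scale by unfold_locales
  show ?thesis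
    unfolding bracket_def
    by (intro module_hom_neg module_hom_sum module_hom_add module_hom_mult dx_hom dpsi_hom)
      (simp_all add: module_axioms)
qed

lemma bracket_linear_left: "module_hom scale scale (\<lambda>a. bracket a b)"
proof -
  interpret module_pair scale scale by unfold_locales
  have "module_hom scale scale (dpsi \<alpha> \<circ> par)" for \<alpha>
    by (rule module_hom_compose[OF par_hom dpsi_hom])
  then have "module_hom scale scale (\<lambda>a. dpsi \<alpha> (par a))" for \<alpha> by (simp add: comp_def)
  then show ?thesis
    unfolding bracket_def
    by (intro module_hom_neg module_hom_sum module_hom_add module_hom_mult dx_hom dpsi_hom)
      (simp_all add: module_axioms)
qed

text \<open>Moving \<open>b\<close> past a coefficient of degree \<open>d - 1\<close> gives the sign
  at once. In the odd terms the coefficient has degree \<open>d\<close>, and the missing sign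
  \<open>(-1)^e\<close> comes from the odd Leibniz rule.\<close>

lemma bracket_derivation_right:
  assumes a: "a \<in> D d" and b: "b \<in> D e"
  shows "bracket a (b * c) = bracket a b * c + neg_pow ((d - 1) * e) (b * bracket a c)"
proof -
  have 1: "u * dx \<beta> (b * c) = u * dx \<beta> b * c + neg_pow ((d - 1) * e) (b * (u * dx \<beta> c))"
    if "u \<in> D (d - 1)" for u \<beta>
    using graded_commute[OF that b] by (simp add: dx_mult distrib_left mult.assoc[symmetric] neg_pow_mult)
  have 2: "u * dpsi \<beta> (b * c) = u * dpsi \<beta> b * c + neg_pow ((d - 1) * e) (b * (u * dpsi \<beta> c))"
    if "u \<in> D d" for u \<beta>
    using graded_commute[OF that b]
    by (cases "even d"; cases "even e")
      (simp_all add: dpsi_mult[OF b] distrib_left right_diff_distrib mult.assoc[symmetric] neg_pow_def)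
  show ?thesis
    unfolding bracket_def 1[OF coefficient_D(1)[OF a]] 2[OF coefficient_D(2)[OF a]]
    by (simp only: sum.distrib distrib_right distrib_left sum_distrib_left sum_distrib_right
        minus_add_distrib mult_minus_left mult_minus_right neg_pow_simps neg_pow_sum add_ac)
qed

text \<open>Exchange the arguments by skew symmetry, use the rule on the right, and exchange
  back.\<close>

lemma bracket_derivation_left:
  assumes a: "a \<in> D d" and b: "b \<in> D e" and c: "c \<in> D f"
  shows "bracket (a * b) c = a * bracket b c + neg_pow (e * (f - 1)) (bracket a c * b)"
  using bracket_skew[OF mult_D[OF a b] c] bracket_derivation_right[OF c a, of b]
    bracket_skew[OF c a] bracket_skew[OF c b]
  by (cases "even d"; cases "even e"; cases "even f") (simp_all add: neg_pow_def)

lemma bracket_skew_biderivation: "skew_biderivation scale D bracket"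
  by (intro skew_biderivation.intro bracket_linear_left bracket_linear_right bracket_D bracket_skew
      bracket_derivation_left bracket_derivation_right)

text \<open>On a generator only one derivative survives in each sum. The outer minus sign is
  cancelled by the parity sign of \<open>psi \<alpha>\<close> in the first part and by antisymmetry
  of \<open>P\<close> in the second.\<close>

lemma bracket_psi: "bracket (psi \<alpha>) b = (\<Sum>\<beta>\<in>UNIV. F \<alpha> \<beta> * dx \<beta> b + P \<alpha> \<beta> * dpsi \<beta> b)"
proof -
  have "(\<Sum>\<gamma>\<in>UNIV. F \<gamma> \<beta> * dpsi \<gamma> (par (psi \<alpha>))) = - F \<alpha> \<beta>" for \<beta>
    using module_hom.neg[OF dpsi_hom]
    by (simp add: par_D[OF psi_D] neg_pow_def dpsi_psi if_distrib[of "(*) _"] if_distrib[of uminus] cong: if_cong)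
  moreover have "(\<Sum>\<gamma>\<in>UNIV. F \<beta> \<gamma> * dx \<gamma> (psi \<alpha>) + P \<beta> \<gamma> * dpsi \<gamma> (psi \<alpha>)) = - P \<alpha> \<beta>" for \<beta>
    by (simp add: dpsi_psi dx_psi if_distrib[of "(*) _"] P_antisym[of \<beta> \<alpha>] cong: if_cong)
  ultimately show ?thesis by (simp add: bracket_def sum_negf[symmetric] add.commute)
qed

lemma bracket_psi_x: "bracket (psi \<alpha>) (x \<beta>) = F \<alpha> \<beta>"
  by (simp add: bracket_psi dx_x dpsi_x if_distrib[of "(*) _"] cong: if_cong)

lemma bracket_psi_psi: "bracket (psi \<alpha>) (psi \<beta>) = P \<alpha> \<beta>"
  by (simp add: bracket_psi dx_psi dpsi_psi if_distrib[of "(*) _"] cong: if_cong)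

lemma bracket_x_x: "bracket (x \<alpha>) (x \<beta>) = 0"
proof -
  have "par (x \<alpha>) = x \<alpha>" using par_D[OF x_D] by (simp add: neg_pow_def)
  then show ?thesis by (simp add: bracket_def dpsi_x)
qed

end


section \<open>The algebra of formal polyvector fields\<close>

text \<open>One coordinate of \<open>L a\<close> is controlled by finitely many coordinates of
  \<open>a\<close>, and on these \<open>a\<close> agrees with a finite combination of words.\<close>

lemma (in coefficient_space) words_dense_criterion:
  fixes scale :: "'k::comm_ring_1 \<Rightarrow> 'a \<Rightarrow> 'a"
  assumes L: "module_hom scale scale L" and cont: "continuous_map coeff_topology coeff_topology L"
    and W: "\<And>w. w \<in> W \<Longrightarrow> L w = 0"
    and mon: "\<And>i r. \<exists>b\<in>module.span scale W. \<forall>j. cf b j = (if j = i then r else 0)"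
  shows "L a = 0"
proof (rule cf_eqI)
  fix i
  interpret L: module_hom scale scale L by fact
  obtain I where I: "finite I" "\<And>a. (\<And>j. j \<in> I \<Longrightarrow> cf a j = 0) \<Longrightarrow> cf (L a) i = 0"
    using continuous_at_zero[OF cont L.zero] by blast
  have "\<exists>b. \<forall>k. b k \<in> L.m1.span W \<and> (\<forall>j. cf (b k) j = (if j = k then cf a k else 0))"
    using mon by (intro choice) blast
  then obtain b where b: "\<And>k. b k \<in> L.m1.span W"
      "\<And>k j. cf (b k) j = (if j = k then cf a k else 0)" by blast
  \<comment> \<open>The sum is the truncation of \<open>a\<close> to the index set \<open>I\<close>,
    so the remainder vanishes on \<open>I\<close>.\<close>
  have "cf (a - (\<Sum>k\<in>I. b k)) j = 0" if "j \<in> I" for j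
    using that I(1) by (simp add: cf_diff cf_sum b(2))
  then have "cf (L (a - (\<Sum>k\<in>I. b k))) i = 0" by (rule I(2))
  moreover have "L (\<Sum>k\<in>I. b k) = 0"
    using L.eq_0_on_span[of W] W b(1) by (simp add: L.m1.span_sum)
  ultimately show "cf (L a) i = cf 0 i" by (simp add: L.diff cf_zero)
qed

section \<open>Coefficients and graded commutativity\<close>

lemma coeff_simps [simp]:
  "coeff 0 m S = 0" "coeff (a + b) m S = coeff a m S + coeff b m S"
  "coeff (a - b) m S = coeff a m S - coeff b m S" "coeff (- a) m S = - coeff a m S"
  "coeff (r *\<^sub>R a) m S = r * coeff a m S" "coeff 1 m S = (if m = {#} \<and> S = {} then 1 else 0)"
  for a b :: "'n::{finite, linorder} polyvec"
  by (simp_all add: zero_polyvec.rep_eq plus_polyvec.rep_eq minus_polyvec.rep_eq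
      uminus_polyvec.rep_eq scaleR_polyvec.rep_eq one_polyvec.rep_eq)

lemma coeff_sum: "coeff (sum f J) m S = (\<Sum>j\<in>J. coeff (f j) m S)"
  for f :: "'j \<Rightarrow> 'n::{finite, linorder} polyvec"
  by (induction J rule: infinite_finite_induct) simp_all

lemma coeff_neg_pow: "coeff (neg_pow k a) m S = neg_pow k (coeff a m S)"
  for a :: "'n::{finite, linorder} polyvec"
  by (simp add: neg_pow_def)

lemma shuffle_sign_square: "shuffle_sign U V * shuffle_sign U V = 1"
  by (simp add: shuffle_sign_def flip: power_mult_distrib)

text \<open>For disjoint sets each pair in \<open>U \<times> V\<close> is an inversion in exactly
  one of the two orders, so the inversion numbers add up to \<open>card U * card V\<close>.\<close>

lemma shuffle_sign_commute:
  fixes U V :: "'n::{finite, linorder} set"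
  assumes "U \<inter> V = {}"
  shows "shuffle_sign V U = (-1) ^ (card U * card V) * shuffle_sign U V"
proof -
  let ?A = "{(i, j). i \<in> U \<and> j \<in> V \<and> j < i}" and ?B = "{(i, j). i \<in> V \<and> j \<in> U \<and> j < i}"
  have "U \<times> V = ?A \<union> prod.swap ` ?B" using assms by (auto simp: image_iff)
  moreover have "?A \<inter> prod.swap ` ?B = {}" by auto
  ultimately have "card (U \<times> V) = card ?A + card (prod.swap ` ?B)"
    by (simp add: card_Un_disjoint)
  then have "card U * card V = card ?A + card ?B"
    by (simp add: card_image card_cartesian_product)
  then have "(-1::real) ^ (card U * card V) * shuffle_sign U V = shuffle_sign V U * (shuffle_sign U V * shuffle_sign U V)"
    by (simp add: shuffle_sign_def power_add)
  then show ?thesis by (simp add: shuffle_sign_square)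
qed

lemma sum_submset_reverse:
  "(\<Sum>p | p \<subseteq># m. f p (m - p)) = (\<Sum>p | p \<subseteq># m. f (m - p) p)"
  by (rule sum.reindex_bij_witness[of _ "\<lambda>p. m - p" "\<lambda>p. m - p"])
    (auto simp: subset_mset.diff_diff_right multiset_eq_iff subseteq_mset_def)

lemma sum_subset_reverse: "(\<Sum>U | U \<subseteq> S. f U (S - U)) = (\<Sum>U | U \<subseteq> S. f (S - U) U)"
  by (rule sum.reindex_bij_witness[of _ "\<lambda>U. S - U" "\<lambda>U. S - U"]) (auto simp: double_diff)

lemma polyvec_deg_mult:
  fixes a b :: "'n::{finite, linorder} polyvec"
  assumes "a \<in> polyvec_deg d" "b \<in> polyvec_deg e"
  shows "a * b \<in> polyvec_deg (d + e)"
  unfolding polyvec_deg_def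
proof (intro CollectI allI impI)
  fix m S assume "coeff (a * b) m S \<noteq> 0"
  then obtain p U where "U \<subseteq> S" "coeff a p U \<noteq> 0" "coeff b (m - p) (S - U) \<noteq> 0"
    unfolding coeff_mult by (metis (no_types, lifting) mem_Collect_eq mult_eq_0_iff sum.not_neutral_contains_not_neutral)
  then have "int (card U) = d" "int (card (S - U)) = e"
    using assms by (auto simp: polyvec_deg_def)
  moreover have "card S = card U + card (S - U)"
    using \<open>U \<subseteq> S\<close> by (simp add: card_Diff_subset card_mono)
  ultimately show "int (card S) = d + e" by simp
qed

lemma polyvec_graded_commute:
  fixes a b :: "'n::{finite, linorder} polyvec"
  assumes "a \<in> polyvec_deg d" "b \<in> polyvec_deg e"
  shows "a * b = neg_pow (d * e) (b * a)"
proof (rule polyvec_eqI)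
  fix m S
  have "coeff (a * b) m S = (\<Sum>p | p \<subseteq># m. \<Sum>U | U \<subseteq> S.
      shuffle_sign (S - U) U * coeff a (m - p) (S - U) * coeff b p U)"
    unfolding coeff_mult
    by (subst sum_submset_reverse[where f="\<lambda>p q. \<Sum>U | U \<subseteq> S. shuffle_sign U (S - U) * coeff a p U * coeff b q (S - U)"],
       subst sum_subset_reverse) rule
  also have "\<dots> = (\<Sum>p | p \<subseteq># m. \<Sum>U | U \<subseteq> S.
      neg_pow (d * e) (shuffle_sign U (S - U) * coeff b p U * coeff a (m - p) (S - U)))"
  proof (intro sum.cong refl)
    fix p U
    show "shuffle_sign (S - U) U * coeff a (m - p) (S - U) * coeff b p U =
        neg_pow (d * e) (shuffle_sign U (S - U) * coeff b p U * coeff a (m - p) (S - U))"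
    proof (cases "coeff a (m - p) (S - U) = 0 \<or> coeff b p U = 0")
      case False
      then have "int (card (S - U)) = d" "int (card U) = e" using assms by (auto simp: polyvec_deg_def)
      then have "d * e = int (card U * card (S - U))" by simp
      moreover have "shuffle_sign (S - U) U = (-1) ^ (card U * card (S - U)) * shuffle_sign U (S - U)"
        by (rule shuffle_sign_commute) auto
      ultimately show ?thesis by (auto simp: neg_pow_def uminus_power_if)
    qed (auto simp: neg_pow_def)
  qed
  also have "\<dots> = coeff (neg_pow (d * e) (b * a)) m S"
    by (simp add: coeff_neg_pow coeff_mult neg_pow_def sum_negf)
  finally show "coeff (a * b) m S = coeff (neg_pow (d * e) (b * a)) m S" .
qed

interpretation pv: coefficient_space "\<lambda>a (m, S). coeff (a :: 'n::{finite, linorder} polyvec) m S"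
proof
  show "bij (\<lambda>a (m, S). coeff (a :: 'n polyvec) m S)"
  proof (rule bijI)
    show "inj (\<lambda>a (m, S). coeff (a :: 'n polyvec) m S)"
      by (rule injI, rule polyvec_eqI) (metis case_prod_conv)
    show "surj (\<lambda>a (m, S). coeff (a :: 'n polyvec) m S)"
      unfolding surj_def
    proof
      fix f :: "'n multiset \<times> 'n set \<Rightarrow> real"
      have "f = (\<lambda>(m, S). coeff (Polyvec (\<lambda>m S. f (m, S))) m S)"
        by (auto simp: Polyvec_inverse)
      then show "\<exists>a. f = (\<lambda>(m, S). coeff a m S)" by blast
    qed
  qed
qed auto

lemma pv_topology: "pv.coeff_topology = polyvec_topology"
  by (simp add: pv.coeff_topology_def polyvec_topology_def)

lemma module_scaleR: "module (scaleR :: real \<Rightarrow> 'b::real_vector \<Rightarrow> 'b)"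
  by unfold_locales (simp_all add: scaleR_add_right scaleR_add_left)

lemma finite_range_card: "finite (range (\<lambda>i. int (card (f i :: 'n::finite set))))"
  by (rule finite_subset[of _ "int ` {..CARD('n)}"]) (auto intro!: imageI card_mono)

interpretation pv: graded_commutative_algebra scaleR
  "polyvec_deg :: int \<Rightarrow> 'n::{finite, linorder} polyvec set"
proof (intro graded_commutative_algebra.intro module_scaleR graded_commutative_algebra_axioms.intro)
  show "module.subspace scaleR (polyvec_deg d :: 'n polyvec set)" for d
    unfolding module.subspace_def[OF module_scaleR] by (auto simp: polyvec_deg_def) (metis add_0)
  show "1 \<in> (polyvec_deg 0 :: 'n polyvec set)" by (simp add: polyvec_deg_def)
  show "\<exists>!c. finite {d. c d \<noteq> 0} \<and> (\<forall>d. c d \<in> polyvec_deg d) \<and> a = (\<Sum>d | c d \<noteq> 0. c d)"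
    for a :: "'n polyvec"
    by (rule pv.direct_sum_by_index_degree[where deg="\<lambda>i. int (card (snd i))", OF finite_range_card])
      (simp add: polyvec_deg_def)
qed (rule mult_scaleR_left mult_scaleR_right polyvec_deg_mult polyvec_graded_commute; assumption?)+

section \<open>Partial derivatives in the even and odd variables\<close>

lift_definition pv_dx :: "'n \<Rightarrow> 'n polyvec \<Rightarrow> 'n polyvec"
  is "\<lambda>\<alpha> a m S. (real (count m \<alpha>) + 1) * a (add_mset \<alpha> m) S" .

text \<open>This is the left derivative: \<open>shuffle_sign {\<alpha>} S\<close> is the sign for
  bringing \<psi>_\<alpha> to the front of the ordered monomial before deleting it.\<close>

lift_definition pv_dpsi :: "'n::linorder \<Rightarrow> 'n polyvec \<Rightarrow> 'n polyvec"
  is "\<lambda>\<alpha> a m S. if \<alpha> \<in> S then 0 else shuffle_sign {\<alpha>} S * a m (insert \<alpha> S)" .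

lift_definition pv_par :: "'n polyvec \<Rightarrow> 'n polyvec"
  is "\<lambda>a m S. (-1) ^ card S * a m S" .

text \<open>Submultisets without \<alpha> have weight 0; every other one arises by adding an
  \<alpha> to a submultiset of \<open>m\<close>, which raises the count by one.\<close>

lemma sum_submset_add_mset_count:
  fixes g :: "'n multiset \<Rightarrow> 'n multiset \<Rightarrow> real"
  shows "(\<Sum>p | p \<subseteq># add_mset \<alpha> m. real (count p \<alpha>) * g p (add_mset \<alpha> m - p)) =
    (\<Sum>p | p \<subseteq># m. (real (count p \<alpha>) + 1) * g (add_mset \<alpha> p) (m - p))"
proof -
  have "(\<Sum>p | p \<subseteq># add_mset \<alpha> m. real (count p \<alpha>) * g p (add_mset \<alpha> m - p)) =
      (\<Sum>p | p \<subseteq># add_mset \<alpha> m \<and> \<alpha> \<in># p. real (count p \<alpha>) * g p (add_mset \<alpha> m - p))"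
    by (rule sum.mono_neutral_right) (auto simp: count_eq_zero_iff)
  also have "\<dots> = (\<Sum>p | p \<subseteq># m. (real (count p \<alpha>) + 1) * g (add_mset \<alpha> p) (m - p))"
  proof (rule sum.reindex_bij_witness[of _ "add_mset \<alpha>" "\<lambda>p. p - {#\<alpha>#}"], goal_cases)
    case (2 p)
    then obtain q where "p = add_mset \<alpha> q" by (metis mem_Collect_eq multi_member_split)
    with 2 show ?case by simp
  next
    case (5 p)
    then obtain q where "p = add_mset \<alpha> q" by (metis mem_Collect_eq multi_member_split)
    with 5 show ?case by simp
  qed auto
  finally show ?thesis .
qed

text \<open>For each factorization of the monomial, the number of factors x^\<alpha> to be
  differentiated is the number in the left part plus the number in the right part. The odd variables
  are spectators and are packed into \<open>g\<close>.\<close>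

lemma pv_dx_mult: "pv_dx \<alpha> (a * b) = pv_dx \<alpha> a * b + a * pv_dx \<alpha> b"
  for a b :: "'n::{finite, linorder} polyvec"
proof (rule polyvec_eqI)
  fix m S
  let ?M = "add_mset \<alpha> m"
  define g where "g p q = (\<Sum>U | U \<subseteq> S. shuffle_sign U (S - U) * coeff a p U * coeff b q (S - U))" for p q
  have "(\<Sum>p | p \<subseteq># ?M. (real (count m \<alpha>) + 1) * g p (?M - p)) =
      (\<Sum>p | p \<subseteq># ?M. real (count p \<alpha>) * g p (?M - p)) +
      (\<Sum>p | p \<subseteq># ?M. real (count (?M - p) \<alpha>) * g p (?M - p))"
    unfolding sum.distrib[symmetric] distrib_right[symmetric]
  proof (intro sum.cong refl)
    fix p assume "p \<in> {p. p \<subseteq># ?M}"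
    then have "count p \<alpha> \<le> Suc (count m \<alpha>)" using mset_subset_eq_count[of p ?M \<alpha>] by simp
    then show "(real (count m \<alpha>) + 1) * g p (?M - p) =
        (real (count p \<alpha>) + real (count (?M - p) \<alpha>)) * g p (?M - p)"
      by (simp add: of_nat_diff)
  qed
  also have "(\<Sum>p | p \<subseteq># ?M. real (count (?M - p) \<alpha>) * g p (?M - p)) =
      (\<Sum>p | p \<subseteq># ?M. real (count p \<alpha>) * g (?M - p) p)"
    by (rule sum_submset_reverse[where f="\<lambda>p q. real (count q \<alpha>) * g p q"])
  also have "\<dots> = (\<Sum>p | p \<subseteq># m. (real (count p \<alpha>) + 1) * g (m - p) (add_mset \<alpha> p))"
    by (rule sum_submset_add_mset_count[where g="\<lambda>p q. g q p"])
  also have "\<dots> = (\<Sum>p | p \<subseteq># m. (real (count (m - p) \<alpha>) + 1) * g p (add_mset \<alpha> (m - p)))"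
    by (rule sum_submset_reverse[where f="\<lambda>p q. (real (count p \<alpha>) + 1) * g q (add_mset \<alpha> p)"])
  finally have "(\<Sum>p | p \<subseteq># ?M. (real (count m \<alpha>) + 1) * g p (?M - p)) =
      (\<Sum>p | p \<subseteq># m. (real (count p \<alpha>) + 1) * g (add_mset \<alpha> p) (m - p)) +
      (\<Sum>p | p \<subseteq># m. (real (count (m - p) \<alpha>) + 1) * g p (add_mset \<alpha> (m - p)))"
    unfolding sum_submset_add_mset_count .
  then show "coeff (pv_dx \<alpha> (a * b)) m S = coeff (pv_dx \<alpha> a * b + a * pv_dx \<alpha> b) m S"
    by (simp add: coeff_mult pv_dx.rep_eq g_def sum_distrib_left mult_ac)
qed

text \<open>The product of the exterior algebra on the \<psi> alone. With it and
  \<open>odd_derivative\<close> the sign computation is separated from the even variables.\<close>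

definition odd_convolution :: "('n::linorder set \<Rightarrow> real) \<Rightarrow> ('n set \<Rightarrow> real) \<Rightarrow> 'n set \<Rightarrow> real" where
  "odd_convolution f g S = (\<Sum>U | U \<subseteq> S. shuffle_sign U (S - U) * f U * g (S - U))"

definition odd_derivative :: "'n::linorder \<Rightarrow> ('n set \<Rightarrow> real) \<Rightarrow> 'n set \<Rightarrow> real" where
  "odd_derivative \<alpha> f S = (if \<alpha> \<in> S then 0 else shuffle_sign {\<alpha>} S * f (insert \<alpha> S))"

lemma sum_subset_insert:
  assumes "\<alpha> \<notin> S" "finite S"
  shows "(\<Sum>U | U \<subseteq> insert \<alpha> S. h U) = (\<Sum>U | U \<subseteq> S. h U) + (\<Sum>U | U \<subseteq> S. h (insert \<alpha> U))"
proof -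
  have "{U. U \<subseteq> insert \<alpha> S} = {U. U \<subseteq> S} \<union> insert \<alpha> ` {U. U \<subseteq> S}"
    using Pow_insert[of \<alpha> S] by (simp add: Pow_def)
  moreover have "inj_on (insert \<alpha>) {U. U \<subseteq> S}" using assms by (auto simp: inj_on_def)
  ultimately show ?thesis
    using assms by (subst \<open>_ = _ \<union> _\<close>, subst sum.union_disjoint) (auto simp: sum.reindex)
qed

text \<open>Outside \<open>S\<close>, the subsets of \<open>insert \<alpha> S\<close> split by
  whether the left factor receives \<alpha>, which decides on which factor the derivative falls.
  Inside \<open>S\<close> the derivative of the product is 0, and the two terms on the right have to
  cancel.\<close>

lemma odd_derivative_convolution:
  fixes f g :: "'n::{finite, linorder} set \<Rightarrow> real"
  assumes f: "\<And>U. f U \<noteq> 0 \<Longrightarrow> int (card U) = d"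
  shows "odd_derivative \<alpha> (odd_convolution f g) S =
    odd_convolution (odd_derivative \<alpha> f) g S + neg_pow d (odd_convolution f (odd_derivative \<alpha> g) S)"
proof -
  \<comment> \<open>Moving \<psi>_\<alpha> past \<open>U\<close> costs \<open>(-1) ^ card U\<close>.
    Homogeneity of \<open>f\<close> expresses this through \<open>d\<close>; the set
    \<open>V\<close> is \<open>U\<close> for \<open>k = 0\<close> and
    \<open>insert \<alpha> U\<close> for \<open>k = 1\<close>.\<close>
  have sgn: "shuffle_sign U {\<alpha>} * (shuffle_sign {\<alpha>} U * f V) = neg_pow (d + int k) (f V)"
    if "\<alpha> \<notin> U" "card V = card U + k" for U V k
  proof (cases "f V = 0")
    case False
    then have "d = int (card U) + int k" using f that(2) by fastforce
    then have "neg_pow (d + int k) (f V) = (-1) ^ card U * f V" by (simp add: neg_pow_def uminus_power_if)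
    moreover have "shuffle_sign U {\<alpha>} * shuffle_sign {\<alpha>} U = (-1) ^ card U"
      using shuffle_sign_commute[of "{\<alpha>}" U] shuffle_sign_square[of "{\<alpha>}" U] that(1) by simp
    ultimately show ?thesis by (metis mult.assoc)
  qed (simp add: neg_pow_def)
  have sgn0: "shuffle_sign U {\<alpha>} * f U = neg_pow d (shuffle_sign {\<alpha>} U * f U)" if "\<alpha> \<notin> U" for U
  proof -
    have "shuffle_sign U {\<alpha>} * f U = shuffle_sign U {\<alpha>} * f U * (shuffle_sign {\<alpha>} U * shuffle_sign {\<alpha>} U)"
      by (simp only: shuffle_sign_square mult_1_right)
    also have "\<dots> = shuffle_sign U {\<alpha>} * (shuffle_sign {\<alpha>} U * f U) * shuffle_sign {\<alpha>} U"
      by (simp only: mult_ac)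
    also have "\<dots> = neg_pow (d + int 0) (f U) * shuffle_sign {\<alpha>} U"
      by (simp only: sgn[OF that, of U 0, OF add_0_right[symmetric]])
    finally show ?thesis by (simp add: neg_pow_def mult.commute)
  qed
  have ins_left: "shuffle_sign (insert \<alpha> U) W = shuffle_sign {\<alpha>} W * shuffle_sign U W" if "\<alpha> \<notin> U" for U W
    using shuffle_sign_Un_left[of "{\<alpha>}" U W] that by simp
  have ins_right: "shuffle_sign W (insert \<alpha> U) = shuffle_sign W {\<alpha>} * shuffle_sign W U" if "\<alpha> \<notin> U" for U W
    using shuffle_sign_Un_right[of W "{\<alpha>}" U] that by simp
  show ?thesis
  proof (cases "\<alpha> \<in> S")
    case False
    have split: "shuffle_sign {\<alpha>} S = shuffle_sign {\<alpha>} U * shuffle_sign {\<alpha>} (S - U)" if "U \<subseteq> S" for U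
      using shuffle_sign_Un_right[of "{\<alpha>}" U "S - U"] that by (simp add: Un_absorb1)
    have "odd_derivative \<alpha> (odd_convolution f g) S = shuffle_sign {\<alpha>} S *
        ((\<Sum>U | U \<subseteq> S. shuffle_sign U (insert \<alpha> S - U) * f U * g (insert \<alpha> S - U)) +
         (\<Sum>U | U \<subseteq> S. shuffle_sign (insert \<alpha> U) (insert \<alpha> S - insert \<alpha> U) * f (insert \<alpha> U) *
            g (insert \<alpha> S - insert \<alpha> U)))"
      using False by (simp add: odd_derivative_def odd_convolution_def sum_subset_insert)
    also have "(\<Sum>U | U \<subseteq> S. shuffle_sign U (insert \<alpha> S - U) * f U * g (insert \<alpha> S - U)) =
        (\<Sum>U | U \<subseteq> S. neg_pow d (shuffle_sign {\<alpha>} U * f U * shuffle_sign U (S - U) * g (insert \<alpha> (S - U))))"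
    proof (intro sum.cong refl)
      fix U assume "U \<in> {U. U \<subseteq> S}"
      then have U: "\<alpha> \<notin> U" "insert \<alpha> S - U = insert \<alpha> (S - U)" using False by auto
      have "shuffle_sign U (insert \<alpha> S - U) * f U * g (insert \<alpha> S - U) =
          (shuffle_sign U {\<alpha>} * shuffle_sign U (S - U)) * f U * g (insert \<alpha> (S - U))"
        unfolding U(2) by (subst ins_right) (use False in auto)
      also have "\<dots> = (shuffle_sign U {\<alpha>} * f U) * (shuffle_sign U (S - U) * g (insert \<alpha> (S - U)))"
        by (simp only: mult_ac)
      finally show "shuffle_sign U (insert \<alpha> S - U) * f U * g (insert \<alpha> S - U) =
          neg_pow d (shuffle_sign {\<alpha>} U * f U * shuffle_sign U (S - U) * g (insert \<alpha> (S - U)))"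
        unfolding sgn0[OF U(1)] by (simp add: neg_pow_def mult.assoc)
    qed
    also have "(\<Sum>U | U \<subseteq> S. shuffle_sign (insert \<alpha> U) (insert \<alpha> S - insert \<alpha> U) * f (insert \<alpha> U) *
            g (insert \<alpha> S - insert \<alpha> U)) =
        (\<Sum>U | U \<subseteq> S. shuffle_sign {\<alpha>} (S - U) * shuffle_sign U (S - U) * f (insert \<alpha> U) * g (S - U))"
    proof (intro sum.cong refl)
      fix U assume "U \<in> {U. U \<subseteq> S}"
      then have U: "\<alpha> \<notin> U" "insert \<alpha> S - insert \<alpha> U = S - U" using False by auto
      show "shuffle_sign (insert \<alpha> U) (insert \<alpha> S - insert \<alpha> U) * f (insert \<alpha> U) *
            g (insert \<alpha> S - insert \<alpha> U) =
          shuffle_sign {\<alpha>} (S - U) * shuffle_sign U (S - U) * f (insert \<alpha> U) * g (S - U)"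
        unfolding U(2) ins_left[OF U(1)] ..
    qed
    also have "shuffle_sign {\<alpha>} S * ((\<Sum>U | U \<subseteq> S. neg_pow d (shuffle_sign {\<alpha>} U * f U * shuffle_sign U (S - U) * g (insert \<alpha> (S - U)))) +
         (\<Sum>U | U \<subseteq> S. shuffle_sign {\<alpha>} (S - U) * shuffle_sign U (S - U) * f (insert \<alpha> U) * g (S - U))) =
        (\<Sum>U | U \<subseteq> S. neg_pow d (shuffle_sign U (S - U) * f U * (shuffle_sign {\<alpha>} (S - U) * g (insert \<alpha> (S - U))))) +
        (\<Sum>U | U \<subseteq> S. shuffle_sign U (S - U) * (shuffle_sign {\<alpha>} U * f (insert \<alpha> U)) * g (S - U))"
    proof -
      have s: "u * u * z = z" if "u * u = 1" for u z :: real using that by simp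
      have "shuffle_sign {\<alpha>} S * neg_pow d (shuffle_sign {\<alpha>} U * f U * shuffle_sign U (S - U) * g (insert \<alpha> (S - U))) =
          neg_pow d (shuffle_sign U (S - U) * f U * (shuffle_sign {\<alpha>} (S - U) * g (insert \<alpha> (S - U))))"
        if "U \<subseteq> S" for U
        using s[OF shuffle_sign_square[of "{\<alpha>}" U]] by (simp add: split[OF that] neg_pow_def mult_ac)
      moreover have "shuffle_sign {\<alpha>} S * (shuffle_sign {\<alpha>} (S - U) * shuffle_sign U (S - U) * f (insert \<alpha> U) * g (S - U)) =
          shuffle_sign U (S - U) * (shuffle_sign {\<alpha>} U * f (insert \<alpha> U)) * g (S - U)" if "U \<subseteq> S" for U
        using s[OF shuffle_sign_square[of "{\<alpha>}" "S - U"]] by (simp add: split[OF that] mult_ac)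
      ultimately show ?thesis unfolding distrib_left sum_distrib_left by (intro arg_cong2[where f="(+)"] sum.cong) auto
    qed
    also have "\<dots> = odd_convolution (odd_derivative \<alpha> f) g S + neg_pow d (odd_convolution f (odd_derivative \<alpha> g) S)"
    proof -
      have "odd_convolution (odd_derivative \<alpha> f) g S =
          (\<Sum>U | U \<subseteq> S. shuffle_sign U (S - U) * (shuffle_sign {\<alpha>} U * f (insert \<alpha> U)) * g (S - U))"
        unfolding odd_convolution_def odd_derivative_def using False by (intro sum.cong) auto
      moreover have "neg_pow d (odd_convolution f (odd_derivative \<alpha> g) S) =
          (\<Sum>U | U \<subseteq> S. neg_pow d (shuffle_sign U (S - U) * f U * (shuffle_sign {\<alpha>} (S - U) * g (insert \<alpha> (S - U)))))"
        using False by (simp add: odd_convolution_def odd_derivative_def neg_pow_def sum_negf)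
      ultimately show ?thesis by simp
    qed
    finally show ?thesis .
  next
    case True
    \<comment> \<open>Both terms on the right reduce to sums over subsets of \<open>T\<close> in
      which each factor has lost or would have contained one \<alpha>. The derivative of
      \<open>f\<close> sees one odd variable fewer to its left, whence
      \<open>neg_pow (d + 1)\<close> against \<open>neg_pow d\<close>.\<close>
    define T where "T = S - {\<alpha>}"
    have S: "S = insert \<alpha> T" and T: "\<alpha> \<notin> T" using True by (auto simp: T_def)
    have "odd_convolution (odd_derivative \<alpha> f) g S =
        (\<Sum>U | U \<subseteq> T. shuffle_sign U (S - U) * (shuffle_sign {\<alpha>} U * f (insert \<alpha> U)) * g (S - U))"
      unfolding odd_convolution_def S sum_subset_insert[OF T finite]
      using T by (auto simp: odd_derivative_def intro!: sum.cong)
    also have "\<dots> = (\<Sum>U | U \<subseteq> T. neg_pow (d + 1) (shuffle_sign U (T - U) * f (insert \<alpha> U) * g (insert \<alpha> (T - U))))"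
    proof (intro sum.cong refl)
      fix U assume "U \<in> {U. U \<subseteq> T}"
      then have U: "\<alpha> \<notin> U" "S - U = insert \<alpha> (T - U)" using T S by auto
      have "shuffle_sign U (S - U) * (shuffle_sign {\<alpha>} U * f (insert \<alpha> U)) * g (S - U) =
          shuffle_sign U {\<alpha>} * shuffle_sign U (T - U) * (shuffle_sign {\<alpha>} U * f (insert \<alpha> U)) *
            g (insert \<alpha> (T - U))"
        unfolding U(2) by (subst ins_right) (use T in auto)
      also have "\<dots> = shuffle_sign U {\<alpha>} * (shuffle_sign {\<alpha>} U * f (insert \<alpha> U)) *
          (shuffle_sign U (T - U) * g (insert \<alpha> (T - U)))"
        by (simp only: mult_ac)
      also have "\<dots> = neg_pow (d + 1) (f (insert \<alpha> U)) * (shuffle_sign U (T - U) * g (insert \<alpha> (T - U)))"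
        using sgn[OF U(1), of "insert \<alpha> U" 1] U(1) by simp
      finally show "shuffle_sign U (S - U) * (shuffle_sign {\<alpha>} U * f (insert \<alpha> U)) * g (S - U) =
          neg_pow (d + 1) (shuffle_sign U (T - U) * f (insert \<alpha> U) * g (insert \<alpha> (T - U)))"
        by (simp add: neg_pow_def mult_ac)
    qed
    also have "\<dots> = - neg_pow d (odd_convolution f (odd_derivative \<alpha> g) S)"
    proof -
      have "shuffle_sign (insert \<alpha> U) (S - insert \<alpha> U) * f (insert \<alpha> U) * odd_derivative \<alpha> g (S - insert \<alpha> U) =
          shuffle_sign U (T - U) * f (insert \<alpha> U) * g (insert \<alpha> (T - U))" if "U \<subseteq> T" for U
      proof -
        have U: "\<alpha> \<notin> U" "S - insert \<alpha> U = T - U" "\<alpha> \<notin> T - U" using T S that by auto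
        have "shuffle_sign (insert \<alpha> U) (S - insert \<alpha> U) * f (insert \<alpha> U) * odd_derivative \<alpha> g (S - insert \<alpha> U) =
            (shuffle_sign {\<alpha>} (T - U) * shuffle_sign {\<alpha>} (T - U)) *
              (shuffle_sign U (T - U) * f (insert \<alpha> U) * g (insert \<alpha> (T - U)))"
          unfolding U(2) ins_left[OF U(1)] odd_derivative_def if_not_P[OF U(3)] by (simp only: mult_ac)
        then show ?thesis by (simp only: shuffle_sign_square mult_1_left)
      qed
      moreover have "odd_derivative \<alpha> g (S - U) = 0" if "U \<subseteq> T" for U
        using T S that by (auto simp: odd_derivative_def)
      then have zero: "(\<Sum>U | U \<subseteq> T. shuffle_sign U (S - U) * f U * odd_derivative \<alpha> g (S - U)) = 0"
        by (intro sum.neutral) simp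
      moreover have "odd_convolution f (odd_derivative \<alpha> g) S =
          (\<Sum>U | U \<subseteq> insert \<alpha> T. shuffle_sign U (S - U) * f U * odd_derivative \<alpha> g (S - U))"
        by (simp add: odd_convolution_def flip: S)
      ultimately have "odd_convolution f (odd_derivative \<alpha> g) S =
          (\<Sum>U | U \<subseteq> T. shuffle_sign U (T - U) * f (insert \<alpha> U) * g (insert \<alpha> (T - U)))"
        unfolding sum_subset_insert[OF T finite] by (metis (mono_tags, lifting) zero mem_Collect_eq
            sum.cong add_0)
      then show ?thesis by (simp add: neg_pow_def sum_negf)
    qed
    finally show ?thesis using True by (simp add: odd_derivative_def)
  qed
qed

lemma pv_dpsi_mult:
  fixes a b :: "'n::{finite, linorder} polyvec"
  assumes "a \<in> polyvec_deg d"
  shows "pv_dpsi \<alpha> (a * b) = pv_dpsi \<alpha> a * b + neg_pow d (a * pv_dpsi \<alpha> b)"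
proof (rule polyvec_eqI)
  fix m S
  have mult: "coeff (a * b) m = (\<lambda>S. \<Sum>p | p \<subseteq># m. odd_convolution (coeff a p) (coeff b (m - p)) S)"
    for a b :: "'n polyvec" and m
    by (simp add: coeff_mult odd_convolution_def fun_eq_iff)
  have dpsi: "coeff (pv_dpsi \<alpha> a) m = odd_derivative \<alpha> (coeff a m)" for a :: "'n polyvec" and m
    by (simp add: pv_dpsi.rep_eq odd_derivative_def fun_eq_iff)
  have "odd_derivative \<alpha> (odd_convolution (coeff a p) g) S =
      odd_convolution (odd_derivative \<alpha> (coeff a p)) g S +
      neg_pow d (odd_convolution (coeff a p) (odd_derivative \<alpha> g) S)" for p g
    by (rule odd_derivative_convolution) (use assms in \<open>simp add: polyvec_deg_def\<close>)
  moreover have "odd_derivative \<alpha> (\<lambda>S. \<Sum>j\<in>J. h j S) S = (\<Sum>j\<in>J. odd_derivative \<alpha> (h j) S)"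
    for h and J :: "'n multiset set"
    by (simp add: odd_derivative_def sum_distrib_left)
  ultimately show "coeff (pv_dpsi \<alpha> (a * b)) m S = coeff (pv_dpsi \<alpha> a * b + neg_pow d (a * pv_dpsi \<alpha> b)) m S"
    by (simp add: coeff_neg_pow mult dpsi sum.distrib) (simp add: neg_pow_def sum_negf)
qed


lemma linear_pv_dx: "linear (pv_dx \<alpha> :: 'n::{finite, linorder} polyvec \<Rightarrow> _)"
  by (rule linearI; rule polyvec_eqI) (simp_all add: pv_dx.rep_eq algebra_simps)

lemma linear_pv_dpsi: "linear (pv_dpsi \<alpha> :: 'n::{finite, linorder} polyvec \<Rightarrow> _)"
  by (rule linearI; rule polyvec_eqI) (simp_all add: pv_dpsi.rep_eq algebra_simps)

lemma linear_pv_par: "linear (pv_par :: 'n::{finite, linorder} polyvec \<Rightarrow> _)"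
  by (rule linearI; rule polyvec_eqI) (simp_all add: pv_par.rep_eq algebra_simps)

lemma pv_dx_D: "a \<in> polyvec_deg d \<Longrightarrow> pv_dx \<alpha> a \<in> polyvec_deg d"
  by (auto simp: polyvec_deg_def pv_dx.rep_eq)

lemma pv_dpsi_D: "a \<in> polyvec_deg d \<Longrightarrow> pv_dpsi \<alpha> a \<in> polyvec_deg (d - 1)"
  for a :: "'n::{finite, linorder} polyvec"
  by (auto simp: polyvec_deg_def pv_dpsi.rep_eq split: if_splits) fastforce

lemma pv_par_D: "a \<in> polyvec_deg d \<Longrightarrow> pv_par a = neg_pow d a"
  for a :: "'n::{finite, linorder} polyvec"
proof (rule polyvec_eqI)
  fix m S
  assume "a \<in> polyvec_deg d"
  then have "coeff a m S = 0 \<or> d = int (card S)" by (auto simp: polyvec_deg_def)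
  then show "coeff (pv_par a) m S = coeff (neg_pow d a) m S"
    by (auto simp: pv_par.rep_eq neg_pow_def uminus_power_if)
qed

lemma polyvec_generators:
  fixes \<alpha> \<beta> :: "'n::{finite, linorder}"
  shows xvar_D: "xvar \<alpha> \<in> polyvec_deg 0" and psi_D: "psi \<alpha> \<in> polyvec_deg 1"
    and pv_dx_xvar: "pv_dx \<alpha> (xvar \<beta>) = (if \<alpha> = \<beta> then 1 else 0)" and pv_dx_psi: "pv_dx \<alpha> (psi \<beta>) = 0"
    and pv_dpsi_xvar: "pv_dpsi \<alpha> (xvar \<beta>) = 0"
    and pv_dpsi_psi: "pv_dpsi \<alpha> (psi \<beta>) = (if \<alpha> = \<beta> then 1 else 0)"
proof -
  show "xvar \<alpha> \<in> polyvec_deg 0" "psi \<alpha> \<in> polyvec_deg 1"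
    by (auto simp: polyvec_deg_def xvar.rep_eq psi.rep_eq)
  show "pv_dx \<alpha> (xvar \<beta>) = (if \<alpha> = \<beta> then 1 else 0)"
    by (rule polyvec_eqI) (auto simp: pv_dx.rep_eq xvar.rep_eq)
  show "pv_dx \<alpha> (psi \<beta>) = 0"
    by (rule polyvec_eqI) (auto simp: pv_dx.rep_eq psi.rep_eq)
  show "pv_dpsi \<alpha> (xvar \<beta>) = 0"
    by (rule polyvec_eqI) (auto simp: pv_dpsi.rep_eq xvar.rep_eq)
  have "insert \<alpha> S = {\<beta>} \<longleftrightarrow> \<alpha> = \<beta> \<and> S = {}" if "\<alpha> \<notin> S" for S using that by auto
  then show "pv_dpsi \<alpha> (psi \<beta>) = (if \<alpha> = \<beta> then 1 else 0)"
    by (intro polyvec_eqI) (auto simp: pv_dpsi.rep_eq psi.rep_eq)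
qed

text \<open>Through this, odd derivatives of functions and brackets of two functions vanish for
  degree reasons.\<close>

lemma polyvec_deg_neg: "d < 0 \<Longrightarrow> polyvec_deg d = {0 :: 'n::{finite, linorder} polyvec}"
  by (force simp: polyvec_deg_def intro: polyvec_eqI)

section \<open>Monomials as words in the generators\<close>

definition generators :: "'n polyvec set" where
  "generators = range xvar \<union> range psi"

lemma coeff_xvar_mult:
  fixes a :: "'n::{finite, linorder} polyvec"
  shows "coeff (xvar \<alpha> * a) m S = (if \<alpha> \<in># m then coeff a (m - {#\<alpha>#}) S else 0)"
proof -
  have "coeff (xvar \<alpha> * a) m S = (\<Sum>p | p \<subseteq># m. \<Sum>U | U \<subseteq> S.
      if U = {} then if p = {#\<alpha>#} then coeff a (m - {#\<alpha>#}) S else 0 else 0)"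
    unfolding coeff_mult by (intro sum.cong refl) (auto simp: xvar.rep_eq)
  then show ?thesis by (simp add: sum.delta)
qed

lemma coeff_psi_mult:
  fixes a :: "'n::{finite, linorder} polyvec"
  shows "coeff (psi \<alpha> * a) m S =
    (if \<alpha> \<in> S then shuffle_sign {\<alpha>} (S - {\<alpha>}) * coeff a m (S - {\<alpha>}) else 0)"
proof -
  have "coeff (psi \<alpha> * a) m S = (\<Sum>p | p \<subseteq># m. \<Sum>U | U \<subseteq> S. if U = {\<alpha>} then if p = {#}
      then shuffle_sign {\<alpha>} (S - {\<alpha>}) * coeff a m (S - {\<alpha>}) else 0 else 0)"
    unfolding coeff_mult by (intro sum.cong refl) (auto simp: psi.rep_eq)
  then show ?thesis by (simp add: sum.delta)
qed

text \<open>The factor \<open>c\<close> is a sign: the set \<open>S\<close> is built up in no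
  particular order, so the word need not be the ordered monomial. Only \<open>c \<noteq> 0\<close>
  matters for the span.\<close>

lemma monomial_word:
  fixes m :: "'n::{finite, linorder} multiset"
  shows "\<exists>w c. set w \<subseteq> generators \<and> c \<noteq> 0 \<and>
    (\<forall>m' S'. coeff (prod_list w) m' S' = (if m' = m \<and> S' = S then c else 0))"
proof (induction m)
  case empty
  have "finite S" by simp
  then show ?case
  proof (induction S rule: finite_induct)
    case empty
    show ?case by (intro exI[of _ "[]"] exI[of _ 1]) simp
  next
    case (insert \<alpha> S)
    then obtain w c where w: "set w \<subseteq> generators" "c \<noteq> 0"
      "\<And>m' S'. coeff (prod_list w) m' S' = (if m' = {#} \<and> S' = S then c else 0)" by blast
    have "\<alpha> \<in> S' \<and> S' - {\<alpha>} = S \<longleftrightarrow> S' = insert \<alpha> S" for S' using insert(2) by auto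
    then have "coeff (prod_list (psi \<alpha> # w)) m' S' =
        (if m' = {#} \<and> S' = insert \<alpha> S then shuffle_sign {\<alpha>} S * c else 0)" for m' S'
      by (auto simp: coeff_psi_mult w(3))
    moreover have "shuffle_sign {\<alpha>} S * c \<noteq> 0" using w(2) by (simp add: shuffle_sign_def)
    moreover have "set (psi \<alpha> # w) \<subseteq> generators" using w(1) by (simp add: generators_def)
    ultimately show ?case by blast
  qed
next
  case (add \<alpha> m)
  then obtain w c where w: "set w \<subseteq> generators" "c \<noteq> 0"
    "\<And>m' S'. coeff (prod_list w) m' S' = (if m' = m \<and> S' = S then c else 0)" by blast
  have "\<alpha> \<in># m' \<and> m' - {#\<alpha>#} = m \<longleftrightarrow> m' = add_mset \<alpha> m" for m' by auto
  then have "coeff (prod_list (xvar \<alpha> # w)) m' S' = (if m' = add_mset \<alpha> m \<and> S' = S then c else 0)" for m' S'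
    by (auto simp: coeff_xvar_mult w(3))
  moreover have "set (xvar \<alpha> # w) \<subseteq> generators" using w(1) by (simp add: generators_def)
  ultimately show ?case using w(2) by blast
qed

interpretation pv: generated_algebra scaleR "polyvec_deg :: int \<Rightarrow> 'n::{finite, linorder} polyvec set"
  polyvec_topology generators
proof
  let ?T = "polyvec_topology :: 'n polyvec topology"
  show "topspace ?T = UNIV" by (simp flip: pv_topology)
  show "continuous_map (prod_topology ?T ?T) ?T (\<lambda>(a, b). a + b)"
    using pv.continuous_coeff_plus unfolding pv_topology .
  show "continuous_map ?T ?T uminus"
    unfolding pv_topology[symmetric]
    using pv.continuous_map_coeff_uminus[OF continuous_map_id] by simp
  show "\<exists>d. g \<in> polyvec_deg d" if "g \<in> generators" for g :: "'n polyvec"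
    using that xvar_D psi_D by (auto simp: generators_def)
  fix L :: "'n polyvec \<Rightarrow> 'n polyvec" and a
  assume L: "module_hom scaleR scaleR L" "continuous_map ?T ?T L"
    and zero: "\<And>w. set w \<subseteq> generators \<Longrightarrow> L (prod_list w) = 0"
  show "L a = 0"
  proof (rule pv.words_dense_criterion[OF L(1) L(2)[folded pv_topology]])
    show "L w = 0" if "w \<in> prod_list ` {w. set w \<subseteq> generators}" for w using that zero by blast
    fix i :: "'n multiset \<times> 'n set" and r :: real
    obtain m S where i: "i = (m, S)" by fastforce
    obtain w c where w: "set w \<subseteq> generators" "c \<noteq> 0"
      "\<And>m' S'. coeff (prod_list w) m' S' = (if m' = m \<and> S' = S then c else 0)"
      using monomial_word by blast
    have "(r / c) *\<^sub>R prod_list w \<in> module.span scaleR (prod_list ` {w. set w \<subseteq> generators})"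
      using w(1) by (intro module.span_scale[OF module_scaleR] module.span_base[OF module_scaleR]) blast
    moreover have "(case j of (m, S) \<Rightarrow> coeff ((r / c) *\<^sub>R prod_list w) m S) = (if j = i then r else 0)" for j
      using w(2) by (auto simp: i w(3) split: prod.split)
    ultimately show "\<exists>b\<in>module.span scaleR (prod_list ` {w. set w \<subseteq> generators}).
        \<forall>j. (case j of (m, S) \<Rightarrow> coeff b m S) = (if j = i then r else 0)" by blast
  qed
qed


section \<open>Power series in the deformation parameter\<close>

definition fps_lift :: "('a \<Rightarrow> 'b) \<Rightarrow> 'a fps \<Rightarrow> 'b fps" where
  "fps_lift f a = Abs_fps (\<lambda>n. f (fps_nth a n))"

lemma fps_lift_nth [simp]: "fps_nth (fps_lift f a) n = f (fps_nth a n)"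
  by (simp add: fps_lift_def)

lemma fps_nth_hscale: "fps_nth (hscale c a) n = (\<Sum>i=0..n. fps_nth c i *\<^sub>R fps_nth a (n - i))"
  by (simp add: hscale_def fps_mult_nth scaleR_conv_of_real)

lemma fps_nth_neg_pow: "fps_nth (neg_pow k a) n = neg_pow k (fps_nth a n)"
  for a :: "'a::ab_group_add fps"
  by (simp add: neg_pow_def)

text \<open>Scalar series stay central although the algebra is not commutative, because their
  coefficients are real.\<close>

lemma hscale_mult_right: "a * hscale c b = hscale c (a * b)"
  for a b :: "'a::real_algebra_1 fps"
proof -
  have "a * Abs_fps (\<lambda>k. of_real (fps_nth c k)) = Abs_fps (\<lambda>k. of_real (fps_nth c k)) * a"
  proof (rule fps_ext)
    fix n
    have "fps_nth (a * Abs_fps (\<lambda>k. of_real (fps_nth c k))) n =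
        (\<Sum>i=0..n. fps_nth c (n - i) *\<^sub>R fps_nth a i)"
      unfolding fps_mult_nth by (intro sum.cong refl) (simp add: of_real_def)
    also have "\<dots> = (\<Sum>i=0..n. fps_nth c i *\<^sub>R fps_nth a (n - i))"
      by (rule sum.reindex_bij_witness[of _ "\<lambda>i. n - i" "\<lambda>i. n - i"]) auto
    also have "\<dots> = fps_nth (Abs_fps (\<lambda>k. of_real (fps_nth c k)) * a) n"
      unfolding fps_mult_nth by (simp add: scaleR_conv_of_real)
    finally show "fps_nth (a * Abs_fps (\<lambda>k. of_real (fps_nth c k))) n =
        fps_nth (Abs_fps (\<lambda>k. of_real (fps_nth c k)) * a) n" .
  qed
  then show ?thesis by (simp add: hscale_def mult.assoc[symmetric])
qed

lemma module_hscale: "module (hscale :: real fps \<Rightarrow> 'a::real_algebra_1 fps \<Rightarrow> 'a fps)"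
proof
  fix c c' :: "real fps" and a b :: "'a fps"
  show "hscale c (a + b) = hscale c a + hscale c b" by (simp add: hscale_def distrib_left)
  have "Abs_fps (\<lambda>k. of_real (fps_nth (c + c') k)) =
      Abs_fps (\<lambda>k. of_real (fps_nth c k)) + (Abs_fps (\<lambda>k. of_real (fps_nth c' k)) :: 'a fps)"
    by (rule fps_ext) simp
  then show "hscale (c + c') a = hscale c a + hscale c' a" by (simp add: hscale_def distrib_right)
  have "Abs_fps (\<lambda>k. of_real (fps_nth (c * c') k)) =
      Abs_fps (\<lambda>k. of_real (fps_nth c k)) * (Abs_fps (\<lambda>k. of_real (fps_nth c' k)) :: 'a fps)"
    by (rule fps_ext) (simp add: fps_mult_nth)
  then show "hscale c (hscale c' a) = hscale (c * c') a" by (simp add: hscale_def mult.assoc)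
  have "Abs_fps (\<lambda>k. of_real (fps_nth 1 k)) = (1 :: 'a fps)" by (rule fps_ext) simp
  then show "hscale 1 a = a" by (simp add: hscale_def)
qed

lemma module_hom_fps_lift:
  fixes f :: "'a::real_algebra_1 \<Rightarrow> 'a"
  assumes "linear f"
  shows "module_hom hscale hscale (fps_lift f)"
  unfolding module_hom_iff
proof (intro conjI module_hscale allI)
  show "fps_lift f (a + b) = fps_lift f a + fps_lift f b" for a b
    by (rule fps_ext) (simp add: linear_add[OF assms])
  show "fps_lift f (hscale c a) = hscale c (fps_lift f a)" for c a
    by (rule fps_ext) (simp add: fps_nth_hscale linear_sum[OF assms] linear_scale[OF assms])
qed

interpretation hp: coefficient_space "\<lambda>a (k, m, S). coeff (fps_nth (a :: 'n::{finite, linorder} polyvec fps) k) m S"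
proof
  show "bij (\<lambda>a (k, m, S). coeff (fps_nth (a :: 'n polyvec fps) k) m S)"
  proof (rule bijI)
    show "inj (\<lambda>a (k, m, S). coeff (fps_nth (a :: 'n polyvec fps) k) m S)"
      by (rule injI, rule fps_ext, rule polyvec_eqI) (metis case_prod_conv)
    show "surj (\<lambda>a (k, m, S). coeff (fps_nth (a :: 'n polyvec fps) k) m S)"
      unfolding surj_def
    proof
      fix f :: "nat \<times> 'n multiset \<times> 'n set \<Rightarrow> real"
      have "f = (\<lambda>(k, m, S). coeff (fps_nth (Abs_fps (\<lambda>k. Polyvec (\<lambda>m S. f (k, m, S)))) k) m S)"
        by (auto simp: Polyvec_inverse)
      then show "\<exists>a. f = (\<lambda>(k, m, S). coeff (fps_nth a k) m S)" by blast
    qed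
  qed
qed auto

lemma hp_topology: "hp.coeff_topology = hpolyvec_topology"
  by (simp add: hp.coeff_topology_def hpolyvec_topology_def)

interpretation hp: graded_commutative_algebra hscale
  "hpolyvec_deg :: int \<Rightarrow> 'n::{finite, linorder} polyvec fps set"
proof (intro graded_commutative_algebra.intro module_hscale graded_commutative_algebra_axioms.intro)
  fix a b :: "'n polyvec fps" and c d e
  show "hscale c a * b = hscale c (a * b)" by (simp add: hscale_def mult.assoc)
  show "a * hscale c b = hscale c (a * b)" by (rule hscale_mult_right)
  show "module.subspace hscale (hpolyvec_deg d :: 'n polyvec fps set)"
    unfolding module.subspace_def[OF module_hscale]
    by (auto simp: hpolyvec_deg_def fps_nth_hscale intro!: pv.D_zero pv.D_add pv.D_sum pv.D_scale)
  show "1 \<in> (hpolyvec_deg 0 :: 'n polyvec fps set)"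
    by (auto simp: hpolyvec_deg_def pv.one_D pv.D_zero)
  show "\<exists>!c. finite {d. c d \<noteq> 0} \<and> (\<forall>d. c d \<in> hpolyvec_deg d) \<and> a = (\<Sum>d | c d \<noteq> 0. c d)"
    by (rule hp.direct_sum_by_index_degree[where deg="\<lambda>i. int (card (snd (snd i)))", OF finite_range_card])
      (simp add: hpolyvec_deg_def polyvec_deg_def)
  assume a: "a \<in> hpolyvec_deg d" and b: "b \<in> hpolyvec_deg e"
  then show "a * b \<in> hpolyvec_deg (d + e)"
    by (auto simp: hpolyvec_deg_def fps_mult_nth intro!: pv.D_sum pv.mult_D)
  show "a * b = neg_pow (d * e) (b * a)"
  proof (rule fps_ext)
    fix n
    have "fps_nth (a * b) n = (\<Sum>i=0..n. neg_pow (d * e) (fps_nth b (n - i) * fps_nth a i))"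
      unfolding fps_mult_nth using a b
      by (intro sum.cong refl polyvec_graded_commute) (auto simp: hpolyvec_deg_def)
    also have "\<dots> = (\<Sum>i=0..n. neg_pow (d * e) (fps_nth b i * fps_nth a (n - i)))"
      by (rule sum.reindex_bij_witness[of _ "\<lambda>i. n - i" "\<lambda>i. n - i"]) auto
    finally show "fps_nth (a * b) n = fps_nth (neg_pow (d * e) (b * a)) n"
      by (simp add: fps_nth_neg_pow fps_mult_nth neg_pow_sum)
  qed
qed

lemma hpolyvec_deg_const: "fps_const a \<in> hpolyvec_deg d \<longleftrightarrow> a \<in> polyvec_deg d"
  for a :: "'n::{finite, linorder} polyvec"
  by (auto simp: hpolyvec_deg_def pv.D_zero split: if_splits dest: spec[of _ 0])

lemma hpolyvec_deg_neg: "d < 0 \<Longrightarrow> hpolyvec_deg d = {0 :: 'n::{finite, linorder} polyvec fps}"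
  by (auto simp: hpolyvec_deg_def polyvec_deg_neg fps_eq_iff)

lemma prod_list_fps_const: "prod_list (map fps_const w) = fps_const (prod_list w)"
  for w :: "'a::ring_1 list"
  by (induction w) simp_all

interpretation hp: generated_algebra hscale "hpolyvec_deg :: int \<Rightarrow> 'n::{finite, linorder} polyvec fps set"
  hpolyvec_topology "fps_const ` generators"
proof
  let ?T = "hpolyvec_topology :: 'n polyvec fps topology"
  show "topspace ?T = UNIV" by (simp flip: hp_topology)
  show "continuous_map (prod_topology ?T ?T) ?T (\<lambda>(a, b). a + b)"
    using hp.continuous_coeff_plus unfolding hp_topology .
  show "continuous_map ?T ?T uminus"
    unfolding hp_topology[symmetric]
    using hp.continuous_map_coeff_uminus[OF continuous_map_id] by simp
  show "\<exists>d. g \<in> hpolyvec_deg d" if "g \<in> fps_const ` generators" for g :: "'n polyvec fps"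
    using that pv.generator_homogeneous by (auto simp: hpolyvec_deg_const)
  fix L :: "'n polyvec fps \<Rightarrow> 'n polyvec fps" and a
  assume L: "module_hom hscale hscale L" "continuous_map ?T ?T L"
    and zero: "\<And>w. set w \<subseteq> fps_const ` generators \<Longrightarrow> L (prod_list w) = 0"
  show "L a = 0"
  proof (rule hp.words_dense_criterion[OF L(1) L(2)[folded hp_topology]])
    let ?W = "prod_list ` {w. set w \<subseteq> fps_const ` (generators :: 'n polyvec set)}"
    show "L w = 0" if "w \<in> ?W" for w using that zero by blast
    fix i :: "nat \<times> 'n multiset \<times> 'n set" and r :: real
    obtain k m S where i: "i = (k, m, S)" by (metis prod_cases3)
    obtain w c where w: "set w \<subseteq> generators" "c \<noteq> 0"
      "\<And>m' S'. coeff (prod_list w) m' S' = (if m' = m \<and> S' = S then c else 0)"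
      using monomial_word by blast
    \<comment> \<open>The generators are constant in \<hbar>; the power \<hbar>^k is supplied by the
      scalar, and dividing by \<open>c\<close> removes the sign of the word.\<close>
    define b where "b = hscale (Abs_fps (\<lambda>n. if n = k then r / c else 0)) (fps_const (prod_list w))"
    have "fps_const (prod_list w) \<in> ?W"
      using w(1) by (intro image_eqI[of _ _ "map fps_const w"]) (auto simp: prod_list_fps_const)
    then have "b \<in> module.span hscale ?W"
      unfolding b_def by (intro hp.span_scale hp.span_base)
    moreover have "fps_nth b n = (if n = k then (r / c) *\<^sub>R prod_list w else 0)" for n
    proof -
      have "fps_nth b n = (\<Sum>j=0..n. if j = n then if n = k then (r / c) *\<^sub>R prod_list w else 0 else 0)"
        unfolding b_def fps_nth_hscale by (intro sum.cong refl) auto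
      then show ?thesis by simp
    qed
    then have "(case j of (k, m, S) \<Rightarrow> coeff (fps_nth b k) m S) = (if j = i then r else 0)" for j
      using w(2) by (auto simp: i w(3) split: prod.split)
    ultimately show "\<exists>b\<in>module.span hscale ?W.
        \<forall>j. (case j of (k, m, S) \<Rightarrow> coeff (fps_nth b k) m S) = (if j = i then r else 0)" by blast
  qed
qed


section \<open>The Maurer--Cartan equation in exponential coordinates\<close>

lemma sum_rotate4:
  fixes f :: "'a::finite \<Rightarrow> 'b::finite \<Rightarrow> 'c::finite \<Rightarrow> 'd::finite \<Rightarrow> 'e::comm_monoid_add"
  shows "(\<Sum>a\<in>UNIV. \<Sum>b\<in>UNIV. \<Sum>c\<in>UNIV. \<Sum>d\<in>UNIV. f a b c d) =
    (\<Sum>b\<in>UNIV. \<Sum>c\<in>UNIV. \<Sum>d\<in>UNIV. \<Sum>a\<in>UNIV. f a b c d)"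
proof -
  have "(\<Sum>a\<in>UNIV. \<Sum>b\<in>UNIV. \<Sum>c\<in>UNIV. \<Sum>d\<in>UNIV. f a b c d) =
      (\<Sum>b\<in>UNIV. \<Sum>a\<in>UNIV. \<Sum>c\<in>UNIV. \<Sum>d\<in>UNIV. f a b c d)"
    by (rule sum.swap)
  also have "\<dots> = (\<Sum>b\<in>UNIV. \<Sum>c\<in>UNIV. \<Sum>a\<in>UNIV. \<Sum>d\<in>UNIV. f a b c d)"
    by (intro sum.cong refl sum.swap)
  also have "\<dots> = (\<Sum>b\<in>UNIV. \<Sum>c\<in>UNIV. \<Sum>d\<in>UNIV. \<Sum>a\<in>UNIV. f a b c d)"
    by (intro sum.cong refl sum.swap)
  finally show ?thesis .
qed

lemma sum_delta_mult:
  fixes f :: "'n::finite \<Rightarrow> 'c::comm_ring_1"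
  shows "(\<Sum>\<beta>\<in>UNIV. (if \<alpha> = \<beta> then 1 else 0) * f \<beta>) = f \<alpha>"
    "(\<Sum>\<beta>\<in>UNIV. f \<beta> * (if \<beta> = \<alpha> then 1 else 0)) = f \<alpha>"
  by (simp_all add: if_distrib[of "\<lambda>x. x * _"] if_distrib[of "(*) _"] cong: if_cong)

text \<open>If \<open>G\<close> is the matrix of a Maurer--Cartan form, the frame dual to it, i.e. the rows of
  \<open>F = G\<inverse>\<close>, spans a copy of the Lie algebra: this is \<open>\<partial>F = - F (\<partial>G) F\<close>.\<close>

lemma dual_frame_commutator:
  fixes F G :: "'n::finite \<Rightarrow> 'n \<Rightarrow> 'r::comm_ring_1" and d :: "'n \<Rightarrow> 'r \<Rightarrow> 'r"
    and c :: "'n \<Rightarrow> 'n \<Rightarrow> 'n \<Rightarrow> 'r"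
  assumes d_add: "\<And>\<gamma> a b. d \<gamma> (a + b) = d \<gamma> a + d \<gamma> b"
    and d_mult: "\<And>\<gamma> a b. d \<gamma> (a * b) = d \<gamma> a * b + a * d \<gamma> b"
    and FG: "\<And>\<alpha> \<gamma>. (\<Sum>\<beta>\<in>UNIV. F \<alpha> \<beta> * G \<beta> \<gamma>) = (if \<alpha> = \<gamma> then 1 else 0)"
    and GF: "\<And>\<alpha> \<gamma>. (\<Sum>\<beta>\<in>UNIV. G \<alpha> \<beta> * F \<beta> \<gamma>) = (if \<alpha> = \<gamma> then 1 else 0)"
    and mc: "\<And>\<alpha> \<beta> \<kappa>. d \<alpha> (G \<beta> \<kappa>) - d \<beta> (G \<alpha> \<kappa>) =
      - (\<Sum>\<mu>\<in>UNIV. \<Sum>\<nu>\<in>UNIV. c \<mu> \<nu> \<kappa> * G \<alpha> \<mu> * G \<beta> \<nu>)"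
  shows "(\<Sum>\<gamma>\<in>UNIV. F \<alpha> \<gamma> * d \<gamma> (F \<beta> \<kappa>)) - (\<Sum>\<gamma>\<in>UNIV. F \<beta> \<gamma> * d \<gamma> (F \<alpha> \<kappa>)) =
    (\<Sum>\<nu>\<in>UNIV. c \<alpha> \<beta> \<nu> * F \<nu> \<kappa>)"
proof -
  have d0: "d \<gamma> 0 = 0" for \<gamma> using d_add[of \<gamma> 0 0] by simp
  have d1: "d \<gamma> 1 = 0" for \<gamma> using d_mult[of \<gamma> 1 1] by simp
  have d_sum: "d \<gamma> (sum f J) = (\<Sum>j\<in>J. d \<gamma> (f j))" for \<gamma> f and J :: "'n set"
    by (induction J rule: infinite_finite_induct) (simp_all add: d0 d_add)
  \<comment> \<open>Differentiate \<open>F G = 1\<close> and multiply by \<open>F\<close> on the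
    right, where \<open>G F = 1\<close> isolates the derivative of \<open>F\<close>.\<close>
  have dF: "d \<gamma> (F \<beta> \<kappa>) = - (\<Sum>\<mu>\<in>UNIV. \<Sum>\<nu>\<in>UNIV. F \<beta> \<mu> * d \<gamma> (G \<mu> \<nu>) * F \<nu> \<kappa>)" for \<beta> \<gamma> \<kappa>
  proof -
    have "(\<Sum>\<mu>\<in>UNIV. d \<gamma> (F \<beta> \<mu>) * G \<mu> \<nu>) = - (\<Sum>\<mu>\<in>UNIV. F \<beta> \<mu> * d \<gamma> (G \<mu> \<nu>))" for \<nu>
    proof -
      have "d \<gamma> (\<Sum>\<mu>\<in>UNIV. F \<beta> \<mu> * G \<mu> \<nu>) = 0" by (simp add: FG d0 d1)
      then show ?thesis by (simp add: d_sum d_mult sum.distrib add_eq_0_iff)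
    qed
    then have "(\<Sum>\<nu>\<in>UNIV. (\<Sum>\<mu>\<in>UNIV. d \<gamma> (F \<beta> \<mu>) * G \<mu> \<nu>) * F \<nu> \<kappa>) =
        - (\<Sum>\<nu>\<in>UNIV. \<Sum>\<mu>\<in>UNIV. F \<beta> \<mu> * d \<gamma> (G \<mu> \<nu>) * F \<nu> \<kappa>)"
      by (simp add: sum_distrib_right sum_negf)
    moreover have "(\<Sum>\<nu>\<in>UNIV. (\<Sum>\<mu>\<in>UNIV. d \<gamma> (F \<beta> \<mu>) * G \<mu> \<nu>) * F \<nu> \<kappa>) =
        (\<Sum>\<mu>\<in>UNIV. d \<gamma> (F \<beta> \<mu>) * (\<Sum>\<nu>\<in>UNIV. G \<mu> \<nu> * F \<nu> \<kappa>))"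
      unfolding sum_distrib_right sum_distrib_left by (subst sum.swap) (simp add: mult.assoc)
    ultimately show ?thesis by (simp add: GF sum_delta_mult) (rule sum.swap)
  qed
  have "(\<Sum>\<gamma>\<in>UNIV. F \<alpha> \<gamma> * d \<gamma> (F \<beta> \<kappa>)) - (\<Sum>\<gamma>\<in>UNIV. F \<beta> \<gamma> * d \<gamma> (F \<alpha> \<kappa>)) =
      (\<Sum>\<mu>\<in>UNIV. \<Sum>\<gamma>\<in>UNIV. \<Sum>\<nu>\<in>UNIV. F \<alpha> \<gamma> * F \<beta> \<mu> * d \<mu> (G \<gamma> \<nu>) * F \<nu> \<kappa>) -
      (\<Sum>\<gamma>\<in>UNIV. \<Sum>\<mu>\<in>UNIV. \<Sum>\<nu>\<in>UNIV. F \<alpha> \<gamma> * F \<beta> \<mu> * d \<gamma> (G \<mu> \<nu>) * F \<nu> \<kappa>)"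
    by (simp add: dF sum_distrib_left sum_negf mult_ac)
  also have "\<dots> = - (\<Sum>\<gamma>\<in>UNIV. \<Sum>\<mu>\<in>UNIV. \<Sum>\<nu>\<in>UNIV.
      F \<alpha> \<gamma> * F \<beta> \<mu> * (d \<gamma> (G \<mu> \<nu>) - d \<mu> (G \<gamma> \<nu>)) * F \<nu> \<kappa>)"
    by (subst sum.swap) (simp add: sum_subtractf algebra_simps)
  also have "\<dots> = (\<Sum>\<gamma>\<in>UNIV. \<Sum>\<mu>\<in>UNIV. \<Sum>\<nu>\<in>UNIV. \<Sum>\<rho>\<in>UNIV. \<Sum>\<sigma>\<in>UNIV.
      c \<rho> \<sigma> \<nu> * F \<nu> \<kappa> * (F \<alpha> \<gamma> * G \<gamma> \<rho>) * (F \<beta> \<mu> * G \<mu> \<sigma>))"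
    unfolding mc by (simp add: sum_distrib_left sum_distrib_right sum_negf mult_ac)
  \<comment> \<open>The sums over \<gamma> and \<mu> are moved innermost, so that each pairs a row
    of \<open>F\<close> with a column of \<open>G\<close> and collapses to a delta.\<close>
  also have "\<dots> = (\<Sum>\<nu>\<in>UNIV. \<Sum>\<rho>\<in>UNIV. \<Sum>\<sigma>\<in>UNIV. \<Sum>\<gamma>\<in>UNIV. \<Sum>\<mu>\<in>UNIV.
      c \<rho> \<sigma> \<nu> * F \<nu> \<kappa> * (F \<alpha> \<gamma> * G \<gamma> \<rho>) * (F \<beta> \<mu> * G \<mu> \<sigma>))"
    by (subst sum_rotate4, subst sum_rotate4) (intro sum.cong refl sum_rotate4[symmetric])
  also have "\<dots> = (\<Sum>\<nu>\<in>UNIV. \<Sum>\<rho>\<in>UNIV. \<Sum>\<sigma>\<in>UNIV. c \<rho> \<sigma> \<nu> * F \<nu> \<kappa> *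
      (\<Sum>\<gamma>\<in>UNIV. F \<alpha> \<gamma> * G \<gamma> \<rho>) * (\<Sum>\<mu>\<in>UNIV. F \<beta> \<mu> * G \<mu> \<sigma>))"
    by (simp add: sum_distrib_left sum_distrib_right mult_ac)
  also have "\<dots> = (\<Sum>\<nu>\<in>UNIV. c \<alpha> \<beta> \<nu> * F \<nu> \<kappa>)"
    by (simp add: FG if_distrib[of "(*) _"] cong: if_cong)
  finally show ?thesis .
qed

section \<open>Right bracketing with the coordinate vector\<close>

locale lie_functions =
  fixes C :: "'n::finite \<Rightarrow> 'n \<Rightarrow> 'n \<Rightarrow> real"
    and X :: "'n \<Rightarrow> 'c::{comm_ring_1, real_algebra_1}"
    and d :: "'n \<Rightarrow> 'c \<Rightarrow> 'c"
  assumes C_antisym: "C \<beta> \<alpha> \<gamma> = - C \<alpha> \<beta> \<gamma>"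
    and C_jacobi: "(\<Sum>\<mu>\<in>UNIV. C \<alpha> \<beta> \<mu> * C \<mu> \<xi> \<kappa>) =
      (\<Sum>\<mu>\<in>UNIV. C \<alpha> \<xi> \<mu> * C \<mu> \<beta> \<kappa>) + (\<Sum>\<mu>\<in>UNIV. C \<beta> \<xi> \<mu> * C \<alpha> \<mu> \<kappa>)"
    and d_linear: "linear (d \<gamma>)"
    and d_mult: "d \<gamma> (a * b) = d \<gamma> a * b + a * d \<gamma> b"
    and d_X: "d \<gamma> (X \<xi>) = (if \<gamma> = \<xi> then 1 else 0)"
begin

lemmas d_simps = linear_add[OF d_linear] linear_0[OF d_linear] linear_scale[OF d_linear]
  linear_sum[OF d_linear] linear_neg[OF d_linear]

text \<open>The Lie bracket extended to vectors of functions, bilinearly over the functions.\<close>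

definition vec_bracket :: "'c ^ 'n \<Rightarrow> 'c ^ 'n \<Rightarrow> 'c ^ 'n" where
  "vec_bracket u v = (\<chi> \<kappa>. \<Sum>\<alpha>\<in>UNIV. \<Sum>\<beta>\<in>UNIV. C \<alpha> \<beta> \<kappa> *\<^sub>R (u $ \<alpha> * v $ \<beta>))"

lemma linear_vec_bracket: "linear (vec_bracket u)" "linear (\<lambda>u. vec_bracket u v)"
  by (auto intro!: linearI simp: vec_bracket_def vec_eq_iff sum.distrib algebra_simps scaleR_sum_right)

lemmas vec_bracket_simps = linear_add[OF linear_vec_bracket(1)] linear_add[OF linear_vec_bracket(2)]
  linear_scale[OF linear_vec_bracket(1)] linear_scale[OF linear_vec_bracket(2)]
  linear_neg[OF linear_vec_bracket(1)] linear_neg[OF linear_vec_bracket(2)]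
  linear_sum[OF linear_vec_bracket(1)] linear_sum[OF linear_vec_bracket(2)]

lemma vec_bracket_antisym: "vec_bracket v u = - vec_bracket u v"
proof -
  have "C \<beta> \<alpha> \<kappa> *\<^sub>R (v $ \<beta> * u $ \<alpha>) = - (C \<alpha> \<beta> \<kappa> *\<^sub>R (u $ \<alpha> * v $ \<beta>))" for \<alpha> \<beta> \<kappa>
    using C_antisym[of \<beta> \<alpha> \<kappa>] by (simp add: mult.commute)
  then have "(\<Sum>\<alpha>\<in>UNIV. \<Sum>\<beta>\<in>UNIV. C \<alpha> \<beta> \<kappa> *\<^sub>R (v $ \<alpha> * u $ \<beta>)) =
      - (\<Sum>\<alpha>\<in>UNIV. \<Sum>\<beta>\<in>UNIV. C \<alpha> \<beta> \<kappa> *\<^sub>R (u $ \<alpha> * v $ \<beta>))" for \<kappa>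
    by (subst sum.swap) (simp add: sum_negf)
  then show ?thesis by (simp add: vec_bracket_def vec_eq_iff)
qed

text \<open>A normal form that isolates the quadratic expression in \<open>C\<close>, so that
  \<open>C_jacobi\<close> can be applied term by term.\<close>

lemma vec_bracket_vec_bracket_left:
  "vec_bracket (vec_bracket u v) w $ \<kappa> = (\<Sum>\<alpha>\<in>UNIV. \<Sum>\<beta>\<in>UNIV. \<Sum>\<xi>\<in>UNIV.
     (\<Sum>\<mu>\<in>UNIV. C \<alpha> \<beta> \<mu> * C \<mu> \<xi> \<kappa>) *\<^sub>R (u $ \<alpha> * v $ \<beta> * w $ \<xi>))"
proof -
  have "vec_bracket (vec_bracket u v) w $ \<kappa> = (\<Sum>\<mu>\<in>UNIV. \<Sum>\<xi>\<in>UNIV. \<Sum>\<alpha>\<in>UNIV. \<Sum>\<beta>\<in>UNIV.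
      (C \<alpha> \<beta> \<mu> * C \<mu> \<xi> \<kappa>) *\<^sub>R (u $ \<alpha> * v $ \<beta> * w $ \<xi>))"
    by (simp add: vec_bracket_def sum_distrib_left sum_distrib_right scaleR_sum_right mult_ac)
  also have "\<dots> = (\<Sum>\<alpha>\<in>UNIV. \<Sum>\<beta>\<in>UNIV. \<Sum>\<mu>\<in>UNIV. \<Sum>\<xi>\<in>UNIV.
      (C \<alpha> \<beta> \<mu> * C \<mu> \<xi> \<kappa>) *\<^sub>R (u $ \<alpha> * v $ \<beta> * w $ \<xi>))"
    by (subst sum_rotate4, subst sum_rotate4) rule
  also have "\<dots> = (\<Sum>\<alpha>\<in>UNIV. \<Sum>\<beta>\<in>UNIV. \<Sum>\<xi>\<in>UNIV. \<Sum>\<mu>\<in>UNIV.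
      (C \<alpha> \<beta> \<mu> * C \<mu> \<xi> \<kappa>) *\<^sub>R (u $ \<alpha> * v $ \<beta> * w $ \<xi>))"
    by (intro sum.cong refl sum.swap)
  finally show ?thesis by (simp add: scaleR_sum_left)
qed

text \<open>In this form the Jacobi identity says that bracketing with \<open>w\<close> from the
  right is a derivation, which is what is needed for \<open>R\<close>.\<close>

lemma vec_bracket_jacobi: "vec_bracket (vec_bracket u v) w = vec_bracket (vec_bracket u w) v + vec_bracket u (vec_bracket v w)"
proof (rule vec_eq_iff[THEN iffD2], rule allI)
  fix \<kappa>
  have 1: "vec_bracket (vec_bracket u w) v $ \<kappa> = (\<Sum>\<alpha>\<in>UNIV. \<Sum>\<beta>\<in>UNIV. \<Sum>\<xi>\<in>UNIV.
     (\<Sum>\<mu>\<in>UNIV. C \<alpha> \<xi> \<mu> * C \<mu> \<beta> \<kappa>) *\<^sub>R (u $ \<alpha> * v $ \<beta> * w $ \<xi>))"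
    unfolding vec_bracket_vec_bracket_left by (rule sum.cong[OF refl], subst sum.swap) (simp add: mult_ac)
  have anti: "(\<Sum>\<mu>\<in>UNIV. C \<beta> \<xi> \<mu> * C \<alpha> \<mu> \<kappa>) = - (\<Sum>\<mu>\<in>UNIV. C \<beta> \<xi> \<mu> * C \<mu> \<alpha> \<kappa>)" for \<alpha> \<beta> \<xi>
    unfolding sum_negf[symmetric] by (intro sum.cong refl) (simp add: C_antisym[of \<alpha>])
  have "vec_bracket u (vec_bracket v w) = - vec_bracket (vec_bracket v w) u" by (rule vec_bracket_antisym)
  then have "vec_bracket u (vec_bracket v w) $ \<kappa> = - (\<Sum>\<beta>\<in>UNIV. \<Sum>\<xi>\<in>UNIV. \<Sum>\<alpha>\<in>UNIV.
     (\<Sum>\<mu>\<in>UNIV. C \<beta> \<xi> \<mu> * C \<mu> \<alpha> \<kappa>) *\<^sub>R (v $ \<beta> * w $ \<xi> * u $ \<alpha>))"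
    by (simp add: vec_bracket_vec_bracket_left)
  also have "\<dots> = - (\<Sum>\<beta>\<in>UNIV. \<Sum>\<alpha>\<in>UNIV. \<Sum>\<xi>\<in>UNIV.
     (\<Sum>\<mu>\<in>UNIV. C \<beta> \<xi> \<mu> * C \<mu> \<alpha> \<kappa>) *\<^sub>R (v $ \<beta> * w $ \<xi> * u $ \<alpha>))"
    by (intro arg_cong[where f=uminus] sum.cong refl sum.swap)
  also have "\<dots> = - (\<Sum>\<alpha>\<in>UNIV. \<Sum>\<beta>\<in>UNIV. \<Sum>\<xi>\<in>UNIV.
     (\<Sum>\<mu>\<in>UNIV. C \<beta> \<xi> \<mu> * C \<mu> \<alpha> \<kappa>) *\<^sub>R (u $ \<alpha> * v $ \<beta> * w $ \<xi>))"
    by (subst sum.swap) (simp add: mult_ac)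
  also have "\<dots> = (\<Sum>\<alpha>\<in>UNIV. \<Sum>\<beta>\<in>UNIV. \<Sum>\<xi>\<in>UNIV.
     (\<Sum>\<mu>\<in>UNIV. C \<beta> \<xi> \<mu> * C \<alpha> \<mu> \<kappa>) *\<^sub>R (u $ \<alpha> * v $ \<beta> * w $ \<xi>))"
    by (simp add: anti sum_negf)
  finally have 2: "vec_bracket u (vec_bracket v w) $ \<kappa> = (\<Sum>\<alpha>\<in>UNIV. \<Sum>\<beta>\<in>UNIV. \<Sum>\<xi>\<in>UNIV.
     (\<Sum>\<mu>\<in>UNIV. C \<beta> \<xi> \<mu> * C \<alpha> \<mu> \<kappa>) *\<^sub>R (u $ \<alpha> * v $ \<beta> * w $ \<xi>))" .
  have "(\<Sum>\<mu>\<in>UNIV. C \<alpha> \<beta> \<mu> * C \<mu> \<xi> \<kappa>) *\<^sub>R y =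
      (\<Sum>\<mu>\<in>UNIV. C \<alpha> \<xi> \<mu> * C \<mu> \<beta> \<kappa>) *\<^sub>R y + (\<Sum>\<mu>\<in>UNIV. C \<beta> \<xi> \<mu> * C \<alpha> \<mu> \<kappa>) *\<^sub>R y"
    for \<alpha> \<beta> \<xi> and y :: 'c
    by (subst C_jacobi) (rule scaleR_add_left)
  then show "vec_bracket (vec_bracket u v) w $ \<kappa> = (vec_bracket (vec_bracket u w) v + vec_bracket u (vec_bracket v w)) $ \<kappa>"
    unfolding vector_add_component 1 2 unfolding vec_bracket_vec_bracket_left sum.distrib[symmetric]
    by (intro sum.cong refl)
qed

definition R :: "'c ^ 'n \<Rightarrow> 'c ^ 'n" where
  "R u = vec_bracket u (\<chi> \<xi>. X \<xi>)"

definition d_vec :: "'n \<Rightarrow> 'c ^ 'n \<Rightarrow> 'c ^ 'n" where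
  "d_vec \<gamma> u = (\<chi> \<kappa>. d \<gamma> (u $ \<kappa>))"

text \<open>\<open>pow_row n \<alpha> $ \<beta>\<close> is the \<open>\<alpha>\<beta>\<close>-entry of the \<open>n\<close>-th power of the matrix
  \<open>\<Sum>\<^sub>\<xi> C\<^sub>\<alpha>\<^sub>\<xi>\<^sup>\<beta> x\<^sup>\<xi>\<close>.\<close>

definition pow_row :: "nat \<Rightarrow> 'n \<Rightarrow> 'c ^ 'n" where
  "pow_row n \<alpha> = (R ^^ n) (axis \<alpha> 1)"

lemma linear_R: "linear R"
  unfolding R_def by (rule linear_vec_bracket)

lemma linear_R_pow: "linear (R ^^ n)"
proof (induction n)
  case (Suc n)
  then show ?case using linear_compose[OF Suc linear_R] by (simp add: comp_def)
qed (simp add: linear_id[unfolded id_def] id_def)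

lemma R_vec_bracket: "R (vec_bracket u v) = vec_bracket (R u) v + vec_bracket u (R v)"
  unfolding R_def by (rule vec_bracket_jacobi)

text \<open>Leibniz formula for the powers of a derivation, by Pascal's rule.\<close>

lemma R_pow_vec_bracket:
  "(R ^^ n) (vec_bracket u v) = (\<Sum>k\<le>n. real (n choose k) *\<^sub>R vec_bracket ((R ^^ k) u) ((R ^^ (n - k)) v))"
proof (induction n)
  case (Suc n)
  let ?b = "\<lambda>k. vec_bracket ((R ^^ k) u) ((R ^^ (Suc n - k)) v)"
  have "(R ^^ Suc n) (vec_bracket u v) = (\<Sum>k\<le>n. real (n choose k) *\<^sub>R
      (vec_bracket ((R ^^ Suc k) u) ((R ^^ (n - k)) v) + vec_bracket ((R ^^ k) u) ((R ^^ Suc (n - k)) v)))"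
    by (simp add: Suc linear_sum[OF linear_R] linear_scale[OF linear_R] R_vec_bracket)
  also have "\<dots> = (\<Sum>k\<le>n. real (n choose k) *\<^sub>R ?b (Suc k)) + (\<Sum>k\<le>n. real (n choose k) *\<^sub>R ?b k)"
    by (simp add: scaleR_add_right sum.distrib Suc_diff_le)
  also have "(\<Sum>k\<le>n. real (n choose k) *\<^sub>R ?b k) = (\<Sum>k\<le>Suc n. real (n choose k) *\<^sub>R ?b k)"
    by simp
  also have "\<dots> = ?b 0 + (\<Sum>k\<le>n. real (n choose Suc k) *\<^sub>R ?b (Suc k))"
    by (subst sum.atMost_Suc_shift) simp
  finally show ?case
    by (subst sum.atMost_Suc_shift) (simp add: sum.distrib scaleR_add_left add_ac)
qed simp

lemma d_vec_vec_bracket: "d_vec \<gamma> (vec_bracket u v) = vec_bracket (d_vec \<gamma> u) v + vec_bracket u (d_vec \<gamma> v)"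
  by (simp add: d_vec_def vec_bracket_def vec_eq_iff d_simps d_mult sum.distrib scaleR_add_right)

lemma linear_d_vec: "linear (d_vec \<gamma>)"
  by (rule linearI) (simp_all add: d_vec_def vec_eq_iff d_simps)

lemma d_one: "d \<gamma> 1 = 0"
  using d_mult[of \<gamma> 1 1] by simp

text \<open>Each of the \<open>n\<close> factors \<open>R\<close> depends on the coordinates through
  \<open>x\<close> alone, whose derivative is the basis vector \<open>axis \<gamma> 1\<close>; the
  initial vector is constant.\<close>

lemma d_vec_pow_row:
  "d_vec \<gamma> (pow_row n \<beta>) = (\<Sum>i<n. (R ^^ (n - 1 - i)) (vec_bracket (pow_row i \<beta>) (axis \<gamma> 1)))"
proof (induction n)
  case 0
  show ?case by (auto simp: d_vec_def pow_row_def vec_eq_iff axis_def d_one d_simps)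
next
  case (Suc n)
  have "d_vec \<gamma> (\<chi> \<xi>. X \<xi>) = axis \<gamma> 1" by (auto simp: d_vec_def vec_eq_iff axis_def d_X)
  then have "d_vec \<gamma> (pow_row (Suc n) \<beta>) = R (d_vec \<gamma> (pow_row n \<beta>)) + vec_bracket (pow_row n \<beta>) (axis \<gamma> 1)"
    by (simp add: pow_row_def R_def d_vec_vec_bracket)
  also have "R (d_vec \<gamma> (pow_row n \<beta>)) = (\<Sum>i<n. (R ^^ Suc (n - 1 - i)) (vec_bracket (pow_row i \<beta>) (axis \<gamma> 1)))"
    by (simp add: Suc linear_sum[OF linear_R])
  also have "\<dots> = (\<Sum>i<n. (R ^^ (Suc n - 1 - i)) (vec_bracket (pow_row i \<beta>) (axis \<gamma> 1)))"
    by (intro sum.cong refl) (simp add: Suc_diff_Suc flip: funpow.simps)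
  finally show ?case by simp
qed

text \<open>Expand each term of \<open>d_vec_pow_row\<close> by the Leibniz formula after moving
  \<open>axis \<gamma> 1\<close> to the left, which gives the minus sign. The resulting brackets no
  longer depend on the position of the differentiated factor, so only their multiplicities have to
  be added.\<close>

lemma d_vec_pow_row_binomial:
  "d_vec \<gamma> (pow_row n \<beta>) = - (\<Sum>k<n. real (n choose Suc k) *\<^sub>R vec_bracket (pow_row k \<gamma>) (pow_row (n - 1 - k) \<beta>))"
proof -
  let ?b = "\<lambda>k. vec_bracket (pow_row k \<gamma>) (pow_row (n - 1 - k) \<beta>)"
  have "d_vec \<gamma> (pow_row n \<beta>) = (\<Sum>i<n. (R ^^ i) (vec_bracket (pow_row (n - 1 - i) \<beta>) (axis \<gamma> 1)))"
    unfolding d_vec_pow_row by (subst sum.nat_diff_reindex[symmetric]) (intro sum.cong refl, simp)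
  also have "\<dots> = (\<Sum>i<n. - (\<Sum>k<n. real (i choose k) *\<^sub>R ?b k))"
  proof (intro sum.cong refl)
    fix i assume "i \<in> {..<n}"
    then have i: "i < n" by simp
    have "(R ^^ i) (vec_bracket (pow_row (n - 1 - i) \<beta>) (axis \<gamma> 1)) = - (R ^^ i) (vec_bracket (axis \<gamma> 1) (pow_row (n - 1 - i) \<beta>))"
      by (subst vec_bracket_antisym) (simp add: linear_neg[OF linear_R_pow])
    also have "(R ^^ i) (vec_bracket (axis \<gamma> 1) (pow_row (n - 1 - i) \<beta>)) = (\<Sum>k\<le>i. real (i choose k) *\<^sub>R ?b k)"
      unfolding R_pow_vec_bracket
    proof (intro sum.cong refl)
      fix k assume "k \<in> {..i}"
      \<comment> \<open>The exponents \<open>i - k\<close> and \<open>n - 1 - i\<close> add up to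
        \<open>n - 1 - k\<close>, which is free of \<open>i\<close>.\<close>
      then have "(R ^^ (i - k)) (pow_row (n - 1 - i) \<beta>) = pow_row (n - 1 - k) \<beta>"
        using i by (simp add: pow_row_def flip: funpow_add[unfolded comp_def, THEN fun_cong])
      then show "real (i choose k) *\<^sub>R vec_bracket ((R ^^ k) (axis \<gamma> 1)) ((R ^^ (i - k)) (pow_row (n - 1 - i) \<beta>)) =
          real (i choose k) *\<^sub>R ?b k" by (simp add: pow_row_def)
    qed
    \<comment> \<open>The added binomial coefficients vanish; a range independent of
      \<open>i\<close> allows the sums to be exchanged.\<close>
    also have "\<dots> = (\<Sum>k<n. real (i choose k) *\<^sub>R ?b k)"
      by (rule sum.mono_neutral_left) (use i in auto)
    finally show "(R ^^ i) (vec_bracket (pow_row (n - 1 - i) \<beta>) (axis \<gamma> 1)) = - (\<Sum>k<n. real (i choose k) *\<^sub>R ?b k)" .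
  qed
  also have "\<dots> = - (\<Sum>k<n. (\<Sum>i<n. real (i choose k)) *\<^sub>R ?b k)"
    by (simp add: sum_negf scaleR_sum_left) (rule sum.swap)
  also have "\<dots> = - (\<Sum>k<n. real (n choose Suc k) *\<^sub>R ?b k)"
  proof -
    \<comment> \<open>Summation along a diagonal of Pascal's triangle.\<close>
    have "(\<Sum>i<n. real (i choose k)) = real (n choose Suc k)" for k
      by (induction n) auto
    then show ?thesis by simp
  qed
  finally show ?thesis .
qed

text \<open>The two derivatives contribute \<open>n choose Suc k\<close> and, after reflection,
  \<open>n choose k\<close> to the same bracket. Their sum \<open>Suc n choose Suc k\<close>,
  divided by \<open>fact (Suc n)\<close>, factors as
  \<open>1 / (fact (Suc k) * fact (n - k))\<close>: this is why the coefficients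
  \<open>1 / fact (Suc n)\<close> work.\<close>

lemma maurer_cartan:
  "d_vec \<alpha> (pow_row n \<beta> /\<^sub>R fact (Suc n)) - d_vec \<beta> (pow_row n \<alpha> /\<^sub>R fact (Suc n)) =
    - (\<Sum>k<n. vec_bracket (pow_row k \<alpha> /\<^sub>R fact (Suc k)) (pow_row (n - 1 - k) \<beta> /\<^sub>R fact (n - k)))"
proof -
  let ?b = "\<lambda>k. vec_bracket (pow_row k \<alpha>) (pow_row (n - 1 - k) \<beta>)"
  have "d_vec \<beta> (pow_row n \<alpha>) = (\<Sum>k<n. real (n choose Suc k) *\<^sub>R vec_bracket (pow_row (n - 1 - k) \<alpha>) (pow_row k \<beta>))"
    unfolding d_vec_pow_row_binomial by (subst vec_bracket_antisym) (simp add: sum_negf)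
  \<comment> \<open>Reflection of the summation index in \<open>n - 1\<close>, followed by the
    symmetry of binomial coefficients.\<close>
  also have "\<dots> = (\<Sum>k<n. real (n choose k) *\<^sub>R ?b k)"
  proof (subst sum.nat_diff_reindex[symmetric], intro sum.cong refl)
    fix k assume "k \<in> {..<n}"
    then have k: "k < n" by simp
    then have "Suc (n - Suc k) = n - k" "n - 1 - (n - Suc k) = k" by auto
    moreover have "n choose (n - k) = n choose k" using k binomial_symmetric[of k n] by simp
    ultimately show "real (n choose Suc (n - Suc k)) *\<^sub>R
        vec_bracket (pow_row (n - 1 - (n - Suc k)) \<alpha>) (pow_row (n - Suc k) \<beta>) = real (n choose k) *\<^sub>R ?b k"
      by simp
  qed
  finally have "d_vec \<alpha> (pow_row n \<beta>) - d_vec \<beta> (pow_row n \<alpha>) = - (\<Sum>k<n. real (Suc n choose Suc k) *\<^sub>R ?b k)"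
    by (simp add: d_vec_pow_row_binomial[of \<alpha> n \<beta>] sum.distrib scaleR_add_left)
  then have "(d_vec \<alpha> (pow_row n \<beta>) - d_vec \<beta> (pow_row n \<alpha>)) /\<^sub>R fact (Suc n) =
      - (\<Sum>k<n. (real (Suc n choose Suc k) / fact (Suc n)) *\<^sub>R ?b k)"
    by (simp add: scaleR_sum_right divide_inverse mult.commute del: fact_Suc binomial_Suc_Suc)
  also have "\<dots> = - (\<Sum>k<n. vec_bracket (pow_row k \<alpha> /\<^sub>R fact (Suc k)) (pow_row (n - 1 - k) \<beta> /\<^sub>R fact (n - k)))"
  proof (intro arg_cong[where f=uminus] sum.cong refl)
    fix k assume "k \<in> {..<n}"
    then have "real (Suc n choose Suc k) / fact (Suc n) = inverse (fact (Suc k)) * inverse (fact (n - k))"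
      by (subst binomial_fact) (simp_all add: field_simps del: fact_Suc)
    then show "(real (Suc n choose Suc k) / fact (Suc n)) *\<^sub>R ?b k =
        vec_bracket (pow_row k \<alpha> /\<^sub>R fact (Suc k)) (pow_row (n - 1 - k) \<beta> /\<^sub>R fact (n - k))"
      by (simp add: vec_bracket_simps del: fact_Suc binomial_Suc_Suc)
  qed
  finally show ?thesis
    by (simp add: linear_scale[OF linear_d_vec] scaleR_diff_right del: fact_Suc)
qed

lemma pow_row_0: "pow_row 0 \<alpha> $ \<beta> = (if \<alpha> = \<beta> then 1 else 0)"
  by (auto simp: pow_row_def axis_def)

lemma pow_row_Suc: "pow_row (Suc n) \<alpha> $ \<kappa> = (\<Sum>\<mu>\<in>UNIV. pow_row n \<alpha> $ \<mu> * (\<Sum>\<xi>\<in>UNIV. C \<mu> \<xi> \<kappa> *\<^sub>R X \<xi>))"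
  by (simp add: pow_row_def R_def vec_bracket_def sum_distrib_left)

lemma pow_row_add: "pow_row (m + n) \<alpha> $ \<kappa> = (\<Sum>\<mu>\<in>UNIV. pow_row m \<alpha> $ \<mu> * pow_row n \<mu> $ \<kappa>)"
proof (induction n arbitrary: \<kappa>)
  case 0
  show ?case by (simp add: pow_row_0 sum_delta_mult)
next
  case (Suc n)
  have "(\<Sum>\<mu>\<in>UNIV. (\<Sum>\<nu>\<in>UNIV. pow_row m \<alpha> $ \<nu> * pow_row n \<nu> $ \<mu>) * M \<mu>) =
      (\<Sum>\<nu>\<in>UNIV. pow_row m \<alpha> $ \<nu> * (\<Sum>\<mu>\<in>UNIV. pow_row n \<nu> $ \<mu> * M \<mu>))" for M
    by (simp add: sum_distrib_left sum_distrib_right mult.assoc) (rule sum.swap)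
  then show ?case unfolding add_Suc_right pow_row_Suc Suc .
qed

section \<open>Power series in the matrix and the dual frame\<close>

definition series :: "(nat \<Rightarrow> real) \<Rightarrow> 'n \<Rightarrow> 'n \<Rightarrow> 'c fps" where
  "series p \<alpha> \<beta> = Abs_fps (\<lambda>n. p n *\<^sub>R pow_row n \<alpha> $ \<beta>)"

text \<open>Powers of a single matrix multiply by adding exponents, so scalar series that are
  reciprocal yield inverse matrices.\<close>

lemma series_mult:
  assumes "\<And>n. (\<Sum>i\<le>n. p i * q (n - i)) = (if n = 0 then 1 else 0)"
  shows "(\<Sum>\<beta>\<in>UNIV. series p \<alpha> \<beta> * series q \<beta> \<gamma>) = (if \<alpha> = \<gamma> then 1 else 0)"
proof (rule fps_ext)
  fix n
  have "fps_nth (\<Sum>\<beta>\<in>UNIV. series p \<alpha> \<beta> * series q \<beta> \<gamma>) n =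
      (\<Sum>\<beta>\<in>UNIV. \<Sum>i\<le>n. (p i * q (n - i)) *\<^sub>R (pow_row i \<alpha> $ \<beta> * pow_row (n - i) \<beta> $ \<gamma>))"
    by (simp add: fps_sum_nth fps_mult_nth series_def atLeast0AtMost mult.commute[of "q _"])
  also have "\<dots> = (\<Sum>i\<le>n. (p i * q (n - i)) *\<^sub>R (\<Sum>\<beta>\<in>UNIV. pow_row i \<alpha> $ \<beta> * pow_row (n - i) \<beta> $ \<gamma>))"
    by (subst sum.swap) (simp add: scaleR_sum_right)
  also have "\<dots> = (\<Sum>i\<le>n. (p i * q (n - i)) *\<^sub>R pow_row n \<alpha> $ \<gamma>)"
    by (intro sum.cong refl) (simp flip: pow_row_add)
  also have "\<dots> = fps_nth (if \<alpha> = \<gamma> then 1 else 0) n"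
    by (simp add: assms pow_row_0 flip: scaleR_sum_left)
  finally show "fps_nth (\<Sum>\<beta>\<in>UNIV. series p \<alpha> \<beta> * series q \<beta> \<gamma>) n =
      fps_nth (if \<alpha> = \<gamma> then 1 else 0) n" .
qed

text \<open>The series \<open>t / (e^t - 1)\<close> and \<open>(e^t - 1) / t\<close> are reciprocal;
  after clearing factorials this is the Bernoulli recurrence.\<close>

lemma bernoulli_convolution:
  "(\<Sum>i\<le>n. bernoulli i / fact i * inverse (fact (Suc (n - i)))) = (if n = 0 then 1 else 0)"
proof -
  have "bernoulli i / fact i * inverse (fact (Suc (n - i))) =
      real (Suc n choose i) * bernoulli i / fact (Suc n)" if "i \<le> n" for i
    using that by (simp add: binomial_fact Suc_diff_le field_simps del: fact_Suc)
  then have "(\<Sum>i\<le>n. bernoulli i / fact i * inverse (fact (Suc (n - i)))) =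
      (\<Sum>i\<le>n. real (Suc n choose i) * bernoulli i) / fact (Suc n)"
    by (simp add: sum_divide_distrib del: fact_Suc)
  then show ?thesis by (simp add: bernoulli_recurrence)
qed

definition fps_d :: "'n \<Rightarrow> 'c fps \<Rightarrow> 'c fps" where
  "fps_d \<gamma> a = Abs_fps (\<lambda>n. d \<gamma> (fps_nth a n))"

definition frame :: "'n \<Rightarrow> 'n \<Rightarrow> 'c fps" where
  "frame = series (\<lambda>n. bernoulli n / fact n)"

text \<open>The structure constants acquire a factor \<open>fps_X\<close> because order in \<hbar>
  equals the power of the matrix, and the bracket of two rows in \<open>maurer_cartan\<close> has
  total power \<open>n - 1\<close> at order \<open>n\<close>.\<close>

lemma frame_commutator:
  "(\<Sum>\<gamma>\<in>UNIV. frame \<alpha> \<gamma> * fps_d \<gamma> (frame \<beta> \<kappa>)) - (\<Sum>\<gamma>\<in>UNIV. frame \<beta> \<gamma> * fps_d \<gamma> (frame \<alpha> \<kappa>)) =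
    (\<Sum>\<nu>\<in>UNIV. fps_X * fps_const (of_real (C \<alpha> \<beta> \<nu>)) * frame \<nu> \<kappa>)"
proof (rule dual_frame_commutator)
  define G where "G = series (\<lambda>n. inverse (fact (Suc n)))"
  show "fps_d \<gamma> (a + b) = fps_d \<gamma> a + fps_d \<gamma> b" for \<gamma> a b
    by (rule fps_ext) (simp add: fps_d_def d_simps)
  show "fps_d \<gamma> (a * b) = fps_d \<gamma> a * b + a * fps_d \<gamma> b" for \<gamma> a b
    by (rule fps_ext) (simp add: fps_d_def d_simps fps_mult_nth d_mult sum.distrib)
  show "(\<Sum>\<beta>\<in>UNIV. frame \<alpha> \<beta> * G \<beta> \<gamma>) = (if \<alpha> = \<gamma> then 1 else 0)" for \<alpha> \<gamma>
    unfolding frame_def G_def by (intro series_mult bernoulli_convolution)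
  show "(\<Sum>\<beta>\<in>UNIV. G \<alpha> \<beta> * frame \<beta> \<gamma>) = (if \<alpha> = \<gamma> then 1 else 0)" for \<alpha> \<gamma>
    unfolding frame_def G_def
  proof (intro series_mult)
    fix n
    show "(\<Sum>i\<le>n. inverse (fact (Suc i)) * (bernoulli (n - i) / fact (n - i))) = (if n = 0 then 1 else 0)"
      by (subst bernoulli_convolution[symmetric], rule sum.reindex_bij_witness[of _ "\<lambda>i. n - i" "\<lambda>i. n - i"])
        (auto simp del: fact_Suc)
  qed
  have G: "fps_nth (G \<alpha> \<beta>) n = (pow_row n \<alpha> /\<^sub>R fact (Suc n)) $ \<beta>" for \<alpha> \<beta> n
    by (simp add: G_def series_def del: fact_Suc)
  show "fps_d \<alpha> (G \<beta> \<kappa>) - fps_d \<beta> (G \<alpha> \<kappa>) =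
      - (\<Sum>\<mu>\<in>UNIV. \<Sum>\<nu>\<in>UNIV. fps_X * fps_const (of_real (C \<mu> \<nu> \<kappa>)) * G \<alpha> \<mu> * G \<beta> \<nu>)" for \<alpha> \<beta> \<kappa>
  proof (rule fps_ext)
    fix n
    have "fps_nth (\<Sum>\<mu>\<in>UNIV. \<Sum>\<nu>\<in>UNIV. fps_X * fps_const (of_real (C \<mu> \<nu> \<kappa>)) * G \<alpha> \<mu> * G \<beta> \<nu>) n =
        (\<Sum>k<n. vec_bracket (pow_row k \<alpha> /\<^sub>R fact (Suc k)) (pow_row (n - 1 - k) \<beta> /\<^sub>R fact (n - k))) $ \<kappa>"
    \<comment> \<open>The factor \<open>fps_X\<close> shifts the convolution to order
      \<open>n - 1\<close>; at \<open>n = 0\<close> both sides are 0.\<close>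
    proof (cases n)
      case (Suc m)
      have "fps_nth (\<Sum>\<mu>\<in>UNIV. \<Sum>\<nu>\<in>UNIV. fps_X * fps_const (of_real (C \<mu> \<nu> \<kappa>)) * G \<alpha> \<mu> * G \<beta> \<nu>) n =
          (\<Sum>\<mu>\<in>UNIV. \<Sum>\<nu>\<in>UNIV. C \<mu> \<nu> \<kappa> *\<^sub>R (\<Sum>k\<le>m. fps_nth (G \<alpha> \<mu>) k * fps_nth (G \<beta> \<nu>) (m - k)))"
        by (simp add: Suc fps_sum_nth mult.assoc fps_mult_nth[of "G _ _"] atLeast0AtMost scaleR_conv_of_real)
      also have "\<dots> = (\<Sum>k\<le>m. \<Sum>\<mu>\<in>UNIV. \<Sum>\<nu>\<in>UNIV. C \<mu> \<nu> \<kappa> *\<^sub>R (fps_nth (G \<alpha> \<mu>) k * fps_nth (G \<beta> \<nu>) (m - k)))"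
        by (simp add: scaleR_sum_right) (simp add: sum.swap[where B="{..m}"])
      also have "\<dots> = (\<Sum>k<n. vec_bracket (pow_row k \<alpha> /\<^sub>R fact (Suc k)) (pow_row (n - 1 - k) \<beta> /\<^sub>R fact (n - k)) $ \<kappa>)"
        unfolding Suc lessThan_Suc_atMost
        by (intro sum.cong refl) (simp add: vec_bracket_def G Suc_diff_le del: fact_Suc)
      finally show ?thesis by simp
    qed (simp add: fps_sum_nth mult.assoc)
    moreover have "fps_nth (fps_d \<alpha> (G \<beta> \<kappa>) - fps_d \<beta> (G \<alpha> \<kappa>)) n =
        (d_vec \<alpha> (pow_row n \<beta> /\<^sub>R fact (Suc n)) - d_vec \<beta> (pow_row n \<alpha> /\<^sub>R fact (Suc n))) $ \<kappa>"
      by (simp add: fps_d_def G d_vec_def del: fact_Suc)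
    ultimately show "fps_nth (fps_d \<alpha> (G \<beta> \<kappa>) - fps_d \<beta> (G \<alpha> \<kappa>)) n =
        fps_nth (- (\<Sum>\<mu>\<in>UNIV. \<Sum>\<nu>\<in>UNIV. fps_X * fps_const (of_real (C \<mu> \<nu> \<kappa>)) * G \<alpha> \<mu> * G \<beta> \<nu>)) n"
      by (simp only: maurer_cartan fps_neg_nth vector_uminus_component)
  qed
qed

end


section \<open>Formal functions as a commutative ring\<close>

text \<open>Commutativity of functions becomes a type class instance here, as required by the matrix
  computations in \<open>lie_functions\<close>.\<close>

typedef (overloaded) ('n::"{finite, linorder}") formal_function = "polyvec_deg 0 :: 'n polyvec set"
  morphisms of_formal Formal
  by (rule exI[of _ 0]) (rule pv.D_zero)

setup_lifting type_definition_formal_function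

instantiation formal_function :: ("{finite, linorder}") "{comm_ring_1, real_algebra_1}"
begin

lift_definition zero_formal_function :: "'a formal_function" is 0 by (rule pv.D_zero)

lift_definition one_formal_function :: "'a formal_function" is 1 by (rule pv.one_D)

lift_definition plus_formal_function :: "'a formal_function \<Rightarrow> 'a formal_function \<Rightarrow> 'a formal_function"
  is "(+)" by (rule pv.D_add)

lift_definition minus_formal_function :: "'a formal_function \<Rightarrow> 'a formal_function \<Rightarrow> 'a formal_function"
  is "(-)" by (rule pv.D_diff)

lift_definition uminus_formal_function :: "'a formal_function \<Rightarrow> 'a formal_function"
  is uminus by (rule pv.D_uminus)

lift_definition times_formal_function :: "'a formal_function \<Rightarrow> 'a formal_function \<Rightarrow> 'a formal_function"
  is "(*)" using pv.mult_D[of _ 0 _ 0] by simp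

lift_definition scaleR_formal_function :: "real \<Rightarrow> 'a formal_function \<Rightarrow> 'a formal_function"
  is scaleR by (rule pv.D_scale)

instance
proof
  fix a b c :: "'a formal_function" and r s :: real
  show "a * b = b * a" by transfer (use pv.graded_commute[of _ 0 _ 0] in \<open>simp add: neg_pow_def\<close>)
qed (transfer, simp add: algebra_simps)+

end

lemma of_formal_D: "of_formal a \<in> polyvec_deg 0"
  by (rule of_formal)

lemmas of_formal_simps = zero_formal_function.rep_eq one_formal_function.rep_eq
  plus_formal_function.rep_eq minus_formal_function.rep_eq uminus_formal_function.rep_eq
  times_formal_function.rep_eq scaleR_formal_function.rep_eq

lemma of_formal_sum: "of_formal (sum f J) = (\<Sum>j\<in>J. of_formal (f j))"
  by (induction J rule: infinite_finite_induct) (simp_all add: of_formal_simps)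

lift_definition formal_x :: "'n::{finite, linorder} \<Rightarrow> 'n formal_function" is xvar
  by (rule xvar_D)

lift_definition formal_dx :: "'n::{finite, linorder} \<Rightarrow> 'n formal_function \<Rightarrow> 'n formal_function" is pv_dx
  by (rule pv_dx_D)

section \<open>Chain sums as entries of matrix powers\<close>

lemma sum_lists_Suc:
  fixes f :: "'n::finite list \<Rightarrow> 'b::comm_monoid_add"
  shows "(\<Sum>xs | length xs = Suc n. f xs) = (\<Sum>xs | length xs = n. \<Sum>x\<in>UNIV. f (xs @ [x]))"
proof -
  have "finite {xs :: 'n list. length xs = n}"
    using finite_lists_length_eq[of "UNIV :: 'n set" n] by simp
  then have "(\<Sum>xs | length xs = n. \<Sum>x\<in>UNIV. f (xs @ [x])) =
      (\<Sum>(xs, x)\<in>{xs. length xs = n} \<times> UNIV. f (xs @ [x]))"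
    by (simp add: sum.cartesian_product)
  also have "\<dots> = (\<Sum>xs | length xs = Suc n. f xs)"
    by (rule sum.reindex_bij_witness[of _ "\<lambda>xs. (butlast xs, last xs)" "\<lambda>(xs, x). xs @ [x]"])
      (auto simp: length_Suc_conv_rev)
  finally show ?thesis ..
qed

text \<open>The recursion starts at 1: at 0 the definition of \<open>chain_sum\<close> gives 1 for
  all \<alpha> and \<beta>, not the identity matrix.\<close>

lemma chain_sum_1: "chain_sum C (Suc 0) \<alpha> \<beta> = (\<Sum>\<xi>\<in>UNIV. C \<alpha> \<xi> \<beta> *\<^sub>R xvar \<xi>)"
  by (simp add: chain_sum_def sum_lists_Suc)

text \<open>Split off the last factor of the chain; its first lower index \<mu> is the last entry of
  the list of intermediate indices. This is multiplication by the matrix from the right, as in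
  \<open>pow_row_Suc\<close>.\<close>

lemma chain_sum_Suc:
  "chain_sum C (Suc (Suc n)) \<alpha> \<beta> =
    (\<Sum>\<mu>\<in>UNIV. chain_sum C (Suc n) \<alpha> \<mu> * (\<Sum>\<xi>\<in>UNIV. C \<mu> \<xi> \<beta> *\<^sub>R xvar \<xi>))"
proof -
  let ?p = "\<lambda>n \<xi> \<zeta>. \<Prod>i<n. C (\<zeta> ! i) (\<xi> ! i) (\<zeta> ! Suc i)"
  \<comment> \<open>The first \<open>Suc n\<close> factors read only the entries up to \<mu>, so the
    appended \<beta> and \<open>x\<close> affect the last factor alone.\<close>
  have split: "?p (Suc (Suc n)) (\<xi> @ [x]) (\<alpha> # (\<zeta> @ [\<mu>]) @ [\<beta>]) = ?p (Suc n) \<xi> (\<alpha> # \<zeta> @ [\<mu>]) * C \<mu> x \<beta>"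
    if "length \<xi> = Suc n" "length \<zeta> = n" for \<xi> \<zeta> x \<mu>
  proof -
    define u v where "u = \<alpha> # (\<zeta> @ [\<mu>]) @ [\<beta>]" and "v = \<alpha> # \<zeta> @ [\<mu>]"
    define \<xi>' where "\<xi>' = \<xi> @ [x]"
    have "u ! i = v ! i" if "i \<le> Suc n" for i
      using that \<open>length \<zeta> = n\<close> nth_append[of v "[\<beta>]" i] by (simp add: u_def v_def)
    moreover have "\<xi>' ! i = \<xi> ! i" if "i < Suc n" for i
      using that \<open>length \<xi> = Suc n\<close> by (simp add: nth_append \<xi>'_def)
    ultimately have "?p (Suc n) \<xi>' u = ?p (Suc n) \<xi> v"
      by (intro prod.cong refl) auto
    moreover have "u ! Suc n = \<mu>" "u ! Suc (Suc n) = \<beta>" "\<xi>' ! Suc n = x"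
      using that by (simp_all add: nth_append u_def \<xi>'_def)
    ultimately have "?p (Suc (Suc n)) \<xi>' u = ?p (Suc n) \<xi> v * C \<mu> x \<beta>"
      by (subst prod.lessThan_Suc) simp
    then show ?thesis by (simp only: u_def v_def \<xi>'_def)
  qed
  have "chain_sum C (Suc (Suc n)) \<alpha> \<beta> =
      (\<Sum>\<xi> | length \<xi> = Suc n. \<Sum>x\<in>UNIV. \<Sum>\<zeta> | length \<zeta> = n. \<Sum>\<mu>\<in>UNIV.
        (?p (Suc n) \<xi> (\<alpha> # \<zeta> @ [\<mu>]) * C \<mu> x \<beta>) *\<^sub>R (prod_list (map xvar \<xi>) * xvar x))"
    (is "_ = ?rhs")
  proof -
    have "chain_sum C (Suc (Suc n)) \<alpha> \<beta> =
        (\<Sum>\<xi> | length \<xi> = Suc n. \<Sum>x\<in>UNIV. \<Sum>\<zeta> | length \<zeta> = n. \<Sum>\<mu>\<in>UNIV.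
          ?p (Suc (Suc n)) (\<xi> @ [x]) (\<alpha> # (\<zeta> @ [\<mu>]) @ [\<beta>]) *\<^sub>R prod_list (map xvar (\<xi> @ [x])))"
      unfolding chain_sum_def diff_Suc_1 sum_lists_Suc[of _ "Suc n"]
      by (rule sum.cong[OF refl], rule sum.cong[OF refl], rule sum_lists_Suc)
    also have "\<dots> = ?rhs"
      by (intro sum.cong refl) (simp only: mem_Collect_eq split, simp)
    finally show ?thesis .
  qed
  also have "\<dots> = (\<Sum>\<xi> | length \<xi> = Suc n. \<Sum>\<mu>\<in>UNIV. \<Sum>\<zeta> | length \<zeta> = n. \<Sum>x\<in>UNIV.
        (?p (Suc n) \<xi> (\<alpha> # \<zeta> @ [\<mu>]) * C \<mu> x \<beta>) *\<^sub>R (prod_list (map xvar \<xi>) * xvar x))"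
    (is "(\<Sum>\<xi>\<in>_. \<Sum>x\<in>_. \<Sum>\<zeta>\<in>?Z. \<Sum>\<mu>\<in>_. ?f \<xi> x \<zeta> \<mu>) = _")
  proof (rule sum.cong[OF refl])
    fix \<xi>
    have "(\<Sum>x\<in>UNIV. \<Sum>\<zeta>\<in>?Z. \<Sum>\<mu>\<in>UNIV. ?f \<xi> x \<zeta> \<mu>) = (\<Sum>\<zeta>\<in>?Z. \<Sum>x\<in>UNIV. \<Sum>\<mu>\<in>UNIV. ?f \<xi> x \<zeta> \<mu>)"
      by (rule sum.swap)
    also have "\<dots> = (\<Sum>\<zeta>\<in>?Z. \<Sum>\<mu>\<in>UNIV. \<Sum>x\<in>UNIV. ?f \<xi> x \<zeta> \<mu>)"
      by (intro sum.cong refl sum.swap)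
    also have "\<dots> = (\<Sum>\<mu>\<in>UNIV. \<Sum>\<zeta>\<in>?Z. \<Sum>x\<in>UNIV. ?f \<xi> x \<zeta> \<mu>)"
      by (rule sum.swap)
    finally show "(\<Sum>x\<in>UNIV. \<Sum>\<zeta>\<in>?Z. \<Sum>\<mu>\<in>UNIV. ?f \<xi> x \<zeta> \<mu>) =
      (\<Sum>\<mu>\<in>UNIV. \<Sum>\<zeta>\<in>?Z. \<Sum>x\<in>UNIV. ?f \<xi> x \<zeta> \<mu>)" .
  qed
  also have "\<dots> = (\<Sum>\<mu>\<in>UNIV. \<Sum>\<xi> | length \<xi> = Suc n. \<Sum>\<zeta> | length \<zeta> = n. \<Sum>x\<in>UNIV.
        (?p (Suc n) \<xi> (\<alpha> # \<zeta> @ [\<mu>]) * C \<mu> x \<beta>) *\<^sub>R (prod_list (map xvar \<xi>) * xvar x))"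
    by (rule sum.swap)
  also have "\<dots> = (\<Sum>\<mu>\<in>UNIV. chain_sum C (Suc n) \<alpha> \<mu> * (\<Sum>\<xi>\<in>UNIV. C \<mu> \<xi> \<beta> *\<^sub>R xvar \<xi>))"
    unfolding chain_sum_def diff_Suc_1 sum_distrib_right unfolding sum_distrib_left
    by (simp add: mult.commute)
  finally show ?thesis .
qed


section \<open>The deformed bracket\<close>

text \<open>Each coefficient of a product is a polynomial in finitely many coefficients of the
  factors.\<close>

lemma continuous_map_hp_mult:
  fixes f g :: "'x \<Rightarrow> 'n::{finite, linorder} polyvec fps"
  assumes "continuous_map X hpolyvec_topology f" "continuous_map X hpolyvec_topology g"
  shows "continuous_map X hpolyvec_topology (\<lambda>z. f z * g z)"
proof -
  have "continuous_map X (discrete_topology UNIV) (\<lambda>z. coeff (fps_nth (h z) k) m S)"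
    if "continuous_map X hpolyvec_topology h" for h :: "'x \<Rightarrow> 'n polyvec fps" and k m S
    using hp.continuous_map_cf[of X h "(k, m, S)"] that by (simp add: hp_topology)
  note c = this[OF assms(1)] this[OF assms(2)]
  have "continuous_map X (discrete_topology UNIV) (\<lambda>z. coeff (fps_nth (f z * g z) k) m S)" for k m S
    unfolding fps_mult_nth coeff_sum coeff_mult
    by (intro continuous_map_discrete_sum continuous_map_discrete_binop[where h="(*)"] c) simp
  then show ?thesis by (simp add: hp.continuous_map_into_coeff_topology flip: hp_topology)
qed

text \<open>The hypothesis fits the parity operator and both partial derivatives: each output
  coefficient is a multiple of one input coefficient.\<close>

lemma continuous_map_fps_lift:
  fixes f :: "'x \<Rightarrow> 'n::{finite, linorder} polyvec fps" and h :: "'n polyvec \<Rightarrow> 'n polyvec"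
  assumes f: "continuous_map X hpolyvec_topology f"
    and h: "\<And>m S. \<exists>m' S' r. \<forall>a. coeff (h a) m S = r * coeff a m' S'"
  shows "continuous_map X hpolyvec_topology (\<lambda>z. fps_lift h (f z))"
proof -
  have c: "continuous_map X (discrete_topology UNIV) (\<lambda>z. coeff (fps_nth (f z) k) m S)" for k m S
    using hp.continuous_map_cf[of X f "(k, m, S)"] f by (simp add: hp_topology)
  have "continuous_map X (discrete_topology UNIV) (\<lambda>z. coeff (h (fps_nth (f z) k)) m S)" for k m S
  proof -
    obtain m' S' r where "\<And>a. coeff (h a) m S = r * coeff a m' S'" using h by metis
    then show ?thesis by (simp add: continuous_map_discrete_binop[where h="(*)"] c)
  qed
  then show ?thesis by (simp add: hp.continuous_map_into_coeff_topology flip: hp_topology)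
qed

lemma hscale_fps_X: "hscale (fps_X * fps_const c) a = fps_X * fps_const (of_real c) * a"
  for a :: "'a::real_algebra_1 fps"
proof -
  have "Abs_fps (\<lambda>k. of_real (fps_nth (fps_X * fps_const c) k)) = fps_X * (fps_const (of_real c) :: 'a fps)"
    by (rule fps_ext) simp
  then show ?thesis by (simp add: hscale_def)
qed

locale lie_structure =
  fixes C :: "'n::{finite, linorder} \<Rightarrow> 'n \<Rightarrow> 'n \<Rightarrow> real"
  assumes C_antisym: "C \<beta> \<alpha> \<gamma> = - C \<alpha> \<beta> \<gamma>"
    and C_jacobi: "(\<Sum>\<mu>\<in>UNIV. C \<alpha> \<beta> \<mu> * C \<mu> \<xi> \<kappa>) =
      (\<Sum>\<mu>\<in>UNIV. C \<alpha> \<xi> \<mu> * C \<mu> \<beta> \<kappa>) + (\<Sum>\<mu>\<in>UNIV. C \<beta> \<xi> \<mu> * C \<alpha> \<mu> \<kappa>)"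
begin

sublocale lf: lie_functions C formal_x formal_dx
proof (rule lie_functions.intro)
  show "C \<beta> \<alpha> \<gamma> = - C \<alpha> \<beta> \<gamma>" for \<alpha> \<beta> \<gamma> by (rule C_antisym)
  show "(\<Sum>\<mu>\<in>UNIV. C \<alpha> \<beta> \<mu> * C \<mu> \<xi> \<kappa>) =
      (\<Sum>\<mu>\<in>UNIV. C \<alpha> \<xi> \<mu> * C \<mu> \<beta> \<kappa>) + (\<Sum>\<mu>\<in>UNIV. C \<beta> \<xi> \<mu> * C \<alpha> \<mu> \<kappa>)" for \<alpha> \<beta> \<xi> \<kappa>
    by (rule C_jacobi)
  show "linear (formal_dx \<gamma> :: 'n formal_function \<Rightarrow> _)" for \<gamma>
    by (rule linearI; transfer) (simp_all add: linear_add[OF linear_pv_dx] linear_scale[OF linear_pv_dx])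
  show "formal_dx \<gamma> (a * b) = formal_dx \<gamma> a * b + a * formal_dx \<gamma> b" for \<gamma> a and b :: "'n formal_function"
    by transfer (rule pv_dx_mult)
  show "formal_dx \<gamma> (formal_x \<xi>) = (if \<gamma> = \<xi> then 1 else 0)" for \<gamma> \<xi> :: 'n
    by transfer (rule pv_dx_xvar)
qed

lemma of_formal_pow_row: "of_formal (lf.pow_row (Suc n) \<alpha> $ \<beta>) = chain_sum C (Suc n) \<alpha> \<beta>"
proof (induction n arbitrary: \<beta>)
  case 0
  show ?case
    by (simp add: lf.pow_row_Suc lf.pow_row_0 sum_delta_mult of_formal_sum of_formal_simps formal_x.rep_eq chain_sum_1)
next
  case (Suc n)
  show ?case
    by (subst lf.pow_row_Suc) (simp add: Suc of_formal_sum of_formal_simps formal_x.rep_eq chain_sum_Suc)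
qed

definition psi_x_bracket :: "'n \<Rightarrow> 'n \<Rightarrow> 'n polyvec fps" where
  "psi_x_bracket \<alpha> \<beta> = Abs_fps (\<lambda>n. if n = 0 then if \<alpha> = \<beta> then 1 else 0
     else (bernoulli n / fact n) *\<^sub>R chain_sum C n \<alpha> \<beta>)"

definition psi_psi_bracket :: "'n \<Rightarrow> 'n \<Rightarrow> 'n polyvec fps" where
  "psi_psi_bracket \<alpha> \<beta> = fps_X * fps_const (\<Sum>\<gamma>\<in>UNIV. C \<alpha> \<beta> \<gamma> *\<^sub>R psi \<gamma>)"

text \<open>Order 0 is treated separately on the left; it fits the series because
  \<open>bernoulli 0 = 1\<close> and the zeroth matrix power is the identity.\<close>

lemma psi_x_bracket_eq: "psi_x_bracket \<alpha> \<beta> = fps_lift of_formal (lf.frame \<alpha> \<beta>)"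
proof (rule fps_ext)
  fix n
  show "fps_nth (psi_x_bracket \<alpha> \<beta>) n = fps_nth (fps_lift of_formal (lf.frame \<alpha> \<beta>)) n"
    by (cases n) (simp_all add: psi_x_bracket_def lf.frame_def lf.series_def of_formal_simps of_formal_pow_row
        lf.pow_row_0 bernoulli_values)
qed

lemma psi_psi_bracket_eq: "psi_psi_bracket \<alpha> \<beta> = (\<Sum>\<gamma>\<in>UNIV. hscale (fps_X * fps_const (C \<alpha> \<beta> \<gamma>)) (fps_const (psi \<gamma>)))"
  unfolding hscale_fps_X
  by (rule fps_ext) (simp add: psi_psi_bracket_def fps_sum_nth mult.assoc scaleR_conv_of_real)

sublocale gc: graded_calculus hscale hpolyvec_deg "fps_lift pv_par" "\<lambda>\<alpha>. fps_lift (pv_dx \<alpha>)"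
  "\<lambda>\<alpha>. fps_lift (pv_dpsi \<alpha>)" "\<lambda>\<alpha>. fps_const (xvar \<alpha>)" "\<lambda>\<alpha>. fps_const (psi \<alpha>)" psi_x_bracket psi_psi_bracket
proof (intro graded_calculus.intro hp.graded_commutative_algebra_axioms graded_calculus_axioms.intro)
  fix a b :: "'n polyvec fps" and \<alpha> \<beta> :: 'n and d
  show "module_hom hscale hscale (fps_lift (pv_par :: 'n polyvec \<Rightarrow> _))"
    "module_hom hscale hscale (fps_lift (pv_dx \<alpha>))" "module_hom hscale hscale (fps_lift (pv_dpsi \<alpha>))"
    by (intro module_hom_fps_lift linear_pv_par linear_pv_dx linear_pv_dpsi)+
  show "fps_lift (pv_dx \<alpha>) (a * b) = fps_lift (pv_dx \<alpha>) a * b + a * fps_lift (pv_dx \<alpha>) b"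
    by (rule fps_ext) (simp add: fps_mult_nth linear_sum[OF linear_pv_dx] pv_dx_mult sum.distrib)
  show "fps_const (xvar \<alpha>) \<in> hpolyvec_deg 0" "fps_const (psi \<alpha>) \<in> hpolyvec_deg 1"
    by (simp_all add: hpolyvec_deg_const xvar_D psi_D)
  show "fps_lift (pv_dx \<alpha>) (fps_const (xvar \<beta>)) = (if \<alpha> = \<beta> then 1 else 0)"
    "fps_lift (pv_dx \<alpha>) (fps_const (psi \<beta>)) = 0"
    "fps_lift (pv_dpsi \<alpha>) (fps_const (xvar \<beta>)) = 0"
    "fps_lift (pv_dpsi \<alpha>) (fps_const (psi \<beta>)) = (if \<alpha> = \<beta> then 1 else 0)"
    by (auto intro!: fps_ext simp: pv_dx_xvar pv_dx_psi pv_dpsi_xvar pv_dpsi_psi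
        linear_0[OF linear_pv_dx] linear_0[OF linear_pv_dpsi])
  show "psi_x_bracket \<alpha> \<beta> \<in> hpolyvec_deg 0" by (simp add: psi_x_bracket_eq hpolyvec_deg_def of_formal_D)
  show "psi_psi_bracket \<alpha> \<beta> \<in> hpolyvec_deg 1"
    by (auto simp: psi_psi_bracket_def hpolyvec_deg_def pv.D_zero intro!: pv.D_sum pv.D_scale psi_D)
  show "psi_psi_bracket \<beta> \<alpha> = - psi_psi_bracket \<alpha> \<beta>"
    by (simp add: psi_psi_bracket_def C_antisym[of \<beta> \<alpha>] sum_negf flip: fps_const_neg)
  assume a: "a \<in> hpolyvec_deg d"
  then have an: "fps_nth a n \<in> polyvec_deg d" for n by (simp add: hpolyvec_deg_def)
  show "fps_lift pv_par a = neg_pow d a"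
    by (rule fps_ext) (simp add: fps_nth_neg_pow pv_par_D[OF an])
  show "fps_lift (pv_dx \<alpha>) a \<in> hpolyvec_deg d" "fps_lift (pv_dpsi \<alpha>) a \<in> hpolyvec_deg (d - 1)"
    by (auto simp: hpolyvec_deg_def intro!: pv_dx_D pv_dpsi_D an)
  show "fps_lift (pv_dpsi \<alpha>) (a * b) = fps_lift (pv_dpsi \<alpha>) a * b + neg_pow d (a * fps_lift (pv_dpsi \<alpha>) b)"
    by (rule fps_ext) (simp add: fps_mult_nth linear_sum[OF linear_pv_dpsi] pv_dpsi_mult[OF an]
        sum.distrib fps_nth_neg_pow neg_pow_sum)
qed

lemma bracket_continuous: "continuous_bracket hpolyvec_topology gc.bracket"
proof -
  have 1: "\<exists>m' S' r. \<forall>a. coeff (pv_par a) m S = r * coeff a m' S'" for m and S :: "'n set"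
    unfolding pv_par.rep_eq by blast
  have 2: "\<exists>m' S' r. \<forall>a. coeff (pv_dx \<alpha> a) m S = r * coeff a m' S'" for \<alpha> m and S :: "'n set"
    unfolding pv_dx.rep_eq by blast
  have 3: "\<exists>m' S' r. \<forall>a. coeff (pv_dpsi \<alpha> a) m S = r * coeff a m' S'" for \<alpha> m and S :: "'n set"
    unfolding pv_dpsi.rep_eq by (cases "\<alpha> \<in> S") (auto intro: exI[of _ 0])
  have sum: "continuous_map X hpolyvec_topology (\<lambda>z. \<Sum>j\<in>J. f j z)"
    if "\<And>j. j \<in> J \<Longrightarrow> continuous_map X hpolyvec_topology (f j)"
    for X :: "('n polyvec fps \<times> 'n polyvec fps) topology" and f and J :: "'n set"
    using that hp.continuous_map_coeff_sum unfolding hp_topology by blast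
  show ?thesis
    unfolding continuous_bracket_def gc.bracket_def case_prod_beta
    by (intro hp.continuous_uminus sum hp.continuous_add continuous_map_hp_mult
        continuous_map_fps_lift 1 2 3 continuous_map_fst continuous_map_snd) (simp_all)
qed

sublocale cb: continuous_biderivation hscale hpolyvec_deg hpolyvec_topology "fps_const ` generators" gc.bracket
  by (intro continuous_biderivation.intro hp.generated_algebra_axioms gc.bracket_skew_biderivation
      continuous_biderivation_axioms.intro bracket_continuous)

lemma is_deformed_bracket: "is_deformed_bracket C gc.bracket"
  unfolding is_deformed_bracket_def
  using gc.bracket_skew_biderivation bracket_continuous gc.bracket_x_x gc.bracket_psi_x gc.bracket_psi_psi
  by (simp add: psi_x_bracket_def psi_psi_bracket_def)

section \<open>The Jacobi identity, first on generators\<close>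

lemma jacobi_psi_psi_x: "cb.jacobi_at 1 1 (fps_const (psi \<alpha>)) (fps_const (psi \<beta>)) (fps_const (xvar \<kappa>))"
proof -
  \<comment> \<open>The inclusion of functions into polyvector fields respects sums, products,
    derivatives and \<hbar>, and so transports \<open>frame_commutator\<close>.\<close>
  let ?i = "fps_lift of_formal :: 'n formal_function fps \<Rightarrow> _"
  have i: "?i (a + b) = ?i a + ?i b" "?i (a - b) = ?i a - ?i b" "?i (a * b) = ?i a * ?i b" for a b
    by (rule fps_ext; simp add: of_formal_simps fps_mult_nth of_formal_sum)+
  have i0: "?i 0 = 0" by (rule fps_ext) (simp add: of_formal_simps)
  have i_sum: "?i (sum f J) = (\<Sum>j\<in>J. ?i (f j))" for f and J :: "'n set"
    by (induction J rule: infinite_finite_induct) (simp_all add: i i0)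
  have i_d: "?i (lf.fps_d \<gamma> a) = fps_lift (pv_dx \<gamma>) (?i a)" for \<gamma> a
    by (rule fps_ext) (simp add: lf.fps_d_def formal_dx.rep_eq)
  have i_X: "?i fps_X = fps_X" by (rule fps_ext) (simp add: fps_X_def of_formal_simps)
  have i_c: "?i (fps_const (of_real r)) = fps_const (of_real r)" for r
    by (rule fps_ext) (simp add: of_formal_simps of_real_def)
  \<comment> \<open>Only the vector field part acts: odd derivatives of
    \<open>psi_x_bracket \<beta> \<kappa>\<close> lie in degree -1.\<close>
  have psi_F: "gc.bracket (fps_const (psi \<alpha>)) (psi_x_bracket \<beta> \<kappa>) =
      (\<Sum>\<gamma>\<in>UNIV. psi_x_bracket \<alpha> \<gamma> * fps_lift (pv_dx \<gamma>) (psi_x_bracket \<beta> \<kappa>))" for \<alpha> \<beta>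
    unfolding gc.bracket_psi using gc.dpsi_D[OF gc.F_D] by (simp add: hpolyvec_deg_neg)
  have "gc.bracket (fps_const (psi \<alpha>)) (psi_x_bracket \<beta> \<kappa>) - gc.bracket (fps_const (psi \<beta>)) (psi_x_bracket \<alpha> \<kappa>) =
      (\<Sum>\<nu>\<in>UNIV. hscale (fps_X * fps_const (C \<alpha> \<beta> \<nu>)) (psi_x_bracket \<nu> \<kappa>))"
    using arg_cong[OF lf.frame_commutator[of \<alpha> \<beta> \<kappa>], of ?i]
    by (simp add: psi_F i i_sum i_d i_X i_c hscale_fps_X flip: psi_x_bracket_eq)
  also have "\<dots> = gc.bracket (psi_psi_bracket \<alpha> \<beta>) (fps_const (xvar \<kappa>))"
    by (simp add: psi_psi_bracket_eq cb.br_sum_left cb.br_left_simps gc.bracket_psi_x)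
  finally show ?thesis
    by (simp add: cb.jacobi_at_def gc.bracket_psi_x gc.bracket_psi_psi neg_pow_def diff_eq_eq)
qed

text \<open>All three terms are of order \<hbar>^2 and linear in \<psi>; comparing coefficients
  leaves the Jacobi identity of the structure constants.\<close>

lemma jacobi_psi_psi_psi: "cb.jacobi_at 1 1 (fps_const (psi \<alpha>)) (fps_const (psi \<beta>)) (fps_const (psi \<gamma>))"
proof -
  have comb: "(\<Sum>\<nu>\<in>UNIV. hscale (fps_X * fps_const (c \<nu>))
        (\<Sum>\<kappa>\<in>UNIV. hscale (fps_X * fps_const (e \<nu> \<kappa>)) (fps_const (psi \<kappa>)))) =
      (\<Sum>\<kappa>\<in>UNIV. hscale (fps_X * fps_X * fps_const (\<Sum>\<nu>\<in>UNIV. c \<nu> * e \<nu> \<kappa>)) (fps_const (psi \<kappa>)))"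
    for c :: "'n \<Rightarrow> real" and e :: "'n \<Rightarrow> 'n \<Rightarrow> real"
  proof -
    have "fps_const (\<Sum>\<nu>\<in>UNIV. c \<nu> * e \<nu> \<kappa>) = (\<Sum>\<nu>\<in>UNIV. fps_const (c \<nu>) * fps_const (e \<nu> \<kappa>))" for \<kappa>
      by (rule fps_ext) (simp add: fps_sum_nth)
    then show ?thesis
      by (simp add: hp.scale_sum_right sum_distrib_left hp.scale_sum_left mult_ac del: fps_const_mult)
        (rule sum.swap)
  qed
  have "(\<Sum>\<nu>\<in>UNIV. C \<beta> \<gamma> \<nu> * C \<alpha> \<nu> \<kappa>) =
      (\<Sum>\<nu>\<in>UNIV. C \<alpha> \<beta> \<nu> * C \<nu> \<gamma> \<kappa>) + (\<Sum>\<nu>\<in>UNIV. C \<alpha> \<gamma> \<nu> * C \<beta> \<nu> \<kappa>)" for \<kappa>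
    using C_jacobi[of \<alpha> \<beta> \<gamma> \<kappa>] by (simp add: C_antisym[of \<beta> _ \<kappa>] sum_negf)
  then show ?thesis
    unfolding cb.jacobi_at_def gc.bracket_psi_psi
    by (simp add: psi_psi_bracket_eq cb.br_sum_left cb.br_sum_right cb.br_left_simps cb.br_right_simps gc.bracket_psi_psi
        neg_pow_def)
      (simp add: psi_psi_bracket_eq comb distrib_left hp.scale_left_distrib sum.distrib flip: fps_const_add)
qed

text \<open>Up to permutation there are four types of triples of generators, by the number of
  \<psi>. With at most one \<psi> all double brackets vanish, since two functions have bracket
  0.\<close>

lemma jacobi: 
  assumes "a \<in> hpolyvec_deg d" "b \<in> hpolyvec_deg e" "c \<in> hpolyvec_deg f"
  shows "cb.jacobi_at d e a b c"
proof (rule cb.jacobi_from_generators[OF _ _ assms])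
  let ?x = "\<lambda>\<alpha>. fps_const (xvar \<alpha>) :: 'n polyvec fps" and ?p = "\<lambda>\<alpha>. fps_const (psi \<alpha>) :: 'n polyvec fps"
  note D = gc.x_D gc.psi_D
  \<comment> \<open>Such a bracket would have degree -1.\<close>
  have zero: "gc.bracket u v = 0" if "u \<in> hpolyvec_deg 0" "v \<in> hpolyvec_deg 0" for u v
    using gc.bracket_D[OF that] by (simp add: hpolyvec_deg_neg)
  have xxx: "cb.jacobi_at 0 0 (?x \<alpha>) (?x \<beta>) (?x \<gamma>)" for \<alpha> \<beta> \<gamma>
    by (simp add: cb.jacobi_at_def gc.bracket_x_x cb.br_right_simps cb.br_left_simps neg_pow_simps)
  have pxx: "cb.jacobi_at 1 0 (?p \<alpha>) (?x \<beta>) (?x \<gamma>)" for \<alpha> \<beta> \<gamma>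
    by (simp add: cb.jacobi_at_def gc.bracket_x_x gc.bracket_psi_x cb.br_right_simps
        zero gc.F_D gc.x_D neg_pow_simps)
  note xpx = cb.jacobi_swap_left[OF D(2,1) pxx]
  note xxp = cb.jacobi_swap_right[OF D(1,2,1) xpx]
  \<comment> \<open>The remaining orders of two \<psi> and one x follow from the one already
    proved.\<close>
  note pxp = cb.jacobi_swap_right[OF D(2,2,1) jacobi_psi_psi_x]
  note xpp = cb.jacobi_swap_left[OF D(2,1) pxp]
  show "\<exists>d e. g \<in> hpolyvec_deg d \<and> h \<in> hpolyvec_deg e \<and> cb.jacobi_at d e g h k"
    if "g \<in> fps_const ` generators" "h \<in> fps_const ` generators" "k \<in> fps_const ` generators" for g h k
  proof -
    have gen: "(\<exists>\<alpha>. g = ?x \<alpha>) \<or> (\<exists>\<alpha>. g = ?p \<alpha>)" if "g \<in> fps_const ` generators" for g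
      using that by (auto simp: generators_def)
    from gen[OF that(1)] gen[OF that(2)] gen[OF that(3)] show ?thesis
      by (elim disjE exE)
        (metis D xxx pxx xpx xxp jacobi_psi_psi_x pxp xpp jacobi_psi_psi_psi)+
  qed
  show "d = e" if "g \<in> fps_const ` generators" "g \<in> hpolyvec_deg d" "g \<in> hpolyvec_deg e"
    for g :: "'n polyvec fps" and d e
  proof -
    \<comment> \<open>A generator is nonzero, and any nonzero coefficient determines its
      degree.\<close>
    have "\<exists>m S. coeff g m S \<noteq> 0" if "g \<in> generators" for g :: "'n polyvec"
      using that by (auto simp: generators_def xvar.rep_eq psi.rep_eq)
    with that show ?thesis by (auto simp: hpolyvec_deg_const polyvec_deg_def)
  qed
qed

lemma deformed_gerstenhaber: "gerstenhaber_algebra hscale hpolyvec_deg gc.bracket"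
  by (intro gerstenhaber_algebra.intro hp.graded_commutative_algebra_axioms gc.bracket_skew_biderivation
      gerstenhaber_algebra_axioms.intro jacobi[unfolded cb.jacobi_at_def])

text \<open>The brackets of x with \<psi> are not among the prescribed values; skew symmetry
  supplies them.\<close>

lemma deformed_bracket_unique:
  assumes "is_deformed_bracket C br"
  shows "br = gc.bracket"
proof (rule continuous_biderivation_unique)
  interpret b: skew_biderivation hscale hpolyvec_deg br using assms by (simp add: is_deformed_bracket_def)
  show "continuous_biderivation hscale hpolyvec_deg hpolyvec_topology (fps_const ` generators) br"
    using assms
    by (intro continuous_biderivation.intro hp.generated_algebra_axioms b.skew_biderivation_axioms
      continuous_biderivation_axioms.intro) (simp add: is_deformed_bracket_def)
  have "br (fps_const (xvar \<alpha>)) (fps_const (psi \<beta>)) = gc.bracket (fps_const (xvar \<alpha>)) (fps_const (psi \<beta>))" for \<alpha> \<beta>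
    using assms is_deformed_bracket
    by (subst b.skew[OF gc.x_D gc.psi_D], subst gc.bracket_skew[OF gc.x_D gc.psi_D])
      (simp add: is_deformed_bracket_def)
  then show "br g h = gc.bracket g h" if "g \<in> fps_const ` generators" "h \<in> fps_const ` generators" for g h
    using that assms is_deformed_bracket by (auto simp: is_deformed_bracket_def generators_def)
qed (rule cb.continuous_biderivation_axioms)

section \<open>Reduction at \<hbar> = 0 and the Schouten bracket\<close>

definition bracket0 :: "'n polyvec \<Rightarrow> 'n polyvec \<Rightarrow> 'n polyvec" where
  "bracket0 a b = fps_nth (gc.bracket (fps_const a) (fps_const b)) 0"

text \<open>Write each argument as its constant term plus \<hbar> times a series; by bilinearity
  over scalar series the second part contributes nothing at order 0.\<close>

lemma fps_nth_bracket_0: "fps_nth (gc.bracket u v) 0 = bracket0 (fps_nth u 0) (fps_nth v 0)"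
proof -
  have dec: "u = fps_const (fps_nth u 0) + hscale fps_X (fps_shift 1 u)" for u :: "'n polyvec fps"
  proof -
    have "hscale fps_X (fps_shift 1 u) = fps_X * fps_shift 1 u"
      using hscale_fps_X[of 1 "fps_shift 1 u"] by simp
    then show ?thesis by (intro fps_ext) simp
  qed
  have "fps_nth (hscale fps_X w) 0 = 0" for w :: "'n polyvec fps" by (simp add: fps_nth_hscale)
  then show ?thesis
    by (subst dec[of u], subst dec[of v])
      (simp add: bracket0_def cb.br_left_simps cb.br_right_simps)
qed

lemma bracket0_skew_biderivation: "skew_biderivation scaleR polyvec_deg bracket0"
proof (intro skew_biderivation.intro)
  have const_scale: "fps_const (r *\<^sub>R a) = hscale (fps_const r) (fps_const a)" for r and a :: "'n polyvec"
    by (rule fps_ext) (simp add: fps_nth_hscale sum.atLeast0_atMost_Suc_shift if_distrib[of "\<lambda>x. x *\<^sub>R _"] cong: if_cong)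
  have nth_scale: "fps_nth (hscale (fps_const r) a) 0 = r *\<^sub>R fps_nth a 0" for r and a :: "'n polyvec fps"
    by (simp add: fps_nth_hscale)
  fix a b c :: "'n polyvec" and r and d e f
  show "module_hom scaleR scaleR (\<lambda>a. bracket0 a b)" "module_hom scaleR scaleR (bracket0 a)"
    unfolding module_hom_iff using module_scaleR
    by (simp_all add: bracket0_def const_scale nth_scale cb.br_left_simps cb.br_right_simps flip: fps_const_add)
  assume "a \<in> polyvec_deg d" "b \<in> polyvec_deg e"
  then have ab: "fps_const a \<in> hpolyvec_deg d" "fps_const b \<in> hpolyvec_deg e"
    by (simp_all add: hpolyvec_deg_const)
  show "bracket0 a b \<in> polyvec_deg (d + e - 1)"
    using gc.bracket_D[OF ab] by (simp add: bracket0_def hpolyvec_deg_def)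
  show "bracket0 a b = - neg_pow ((d - 1) * (e - 1)) (bracket0 b a)"
    unfolding bracket0_def by (subst gc.bracket_skew[OF ab]) (simp add: fps_nth_neg_pow)
  assume "c \<in> polyvec_deg f"
  then have c: "fps_const c \<in> hpolyvec_deg f" by (simp add: hpolyvec_deg_const)
  show "bracket0 (a * b) c = a * bracket0 b c + neg_pow (e * (f - 1)) (bracket0 a c * b)"
    using gc.bracket_derivation_left[OF ab c] by (simp add: bracket0_def fps_nth_neg_pow)
  show "bracket0 a (b * c) = bracket0 a b * c + neg_pow ((d - 1) * e) (b * bracket0 a c)"
    using gc.bracket_derivation_right[OF ab, of "fps_const c"] by (simp add: bracket0_def fps_nth_neg_pow)
qed

lemma bracket0_continuous: "continuous_bracket polyvec_topology bracket0"
proof -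
  have "continuous_map X (discrete_topology UNIV) (\<lambda>z. coeff (f z) m S)"
    if "continuous_map X polyvec_topology f"
    for X :: "('n polyvec \<times> 'n polyvec) topology" and f :: "_ \<Rightarrow> 'n polyvec" and m S
    using pv.continuous_map_cf[of X f "(m, S)"] that by (simp add: pv_topology)
  then have const: "continuous_map X hpolyvec_topology (\<lambda>z. fps_const (f z))"
    if "continuous_map X polyvec_topology f"
    for X :: "('n polyvec \<times> 'n polyvec) topology" and f :: "_ \<Rightarrow> 'n polyvec"
    using that by (simp add: hp.continuous_map_into_coeff_topology flip: hp_topology)
  let ?X = "prod_topology polyvec_topology polyvec_topology :: ('n polyvec \<times> 'n polyvec) topology"
  have "continuous_map ?X (prod_topology hpolyvec_topology hpolyvec_topology)
      (\<lambda>z. (fps_const (fst z), fps_const (snd z)))"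
    by (intro continuous_map_pairedI const continuous_map_fst continuous_map_snd)
  then have "continuous_map ?X hpolyvec_topology
      ((\<lambda>(u, v). gc.bracket u v) \<circ> (\<lambda>z. (fps_const (fst z), fps_const (snd z))))"
    by (rule continuous_map_compose) (use bracket_continuous in \<open>simp add: continuous_bracket_def\<close>)
  then have "continuous_map ?X (discrete_topology UNIV) (\<lambda>z. coeff (bracket0 (fst z) (snd z)) m S)" for m S
    using hp.continuous_map_cf[of ?X _ "(0, m, S)"] unfolding hp_topology bracket0_def comp_def by fastforce
  then show ?thesis
    unfolding continuous_bracket_def
    by (simp add: pv.continuous_map_into_coeff_topology case_prod_beta flip: pv_topology)
qed

text \<open>The constant terms of the deformed values on generators are the Schouten values, and the
  uniqueness theorem makes the definite description refer to this bracket.\<close>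

lemma schouten_eq: "schouten = bracket0"
  unfolding schouten_def
proof (rule the_equality)
  show 0: "is_schouten_bracket bracket0"
    unfolding is_schouten_bracket_def
    using bracket0_skew_biderivation bracket0_continuous
    by (simp add: bracket0_def gc.bracket_x_x gc.bracket_psi_x gc.bracket_psi_psi psi_x_bracket_def psi_psi_bracket_def)
  fix br :: "'n polyvec \<Rightarrow> 'n polyvec \<Rightarrow> 'n polyvec" assume br: "is_schouten_bracket br"
  have cont: "continuous_biderivation scaleR polyvec_deg polyvec_topology generators b"
    if "is_schouten_bracket b" for b :: "'n polyvec \<Rightarrow> 'n polyvec \<Rightarrow> 'n polyvec"
    using that
    by (intro continuous_biderivation.intro pv.generated_algebra_axioms continuous_biderivation_axioms.intro)
      (simp_all add: is_schouten_bracket_def)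
  show "br = bracket0"
  proof (rule continuous_biderivation_unique[OF cont[OF br] cont[OF 0]])
    interpret b: skew_biderivation scaleR polyvec_deg br using br by (simp add: is_schouten_bracket_def)
    interpret b0: skew_biderivation scaleR polyvec_deg bracket0 by (rule bracket0_skew_biderivation)
    have "br (xvar \<alpha>) (psi \<beta>) = bracket0 (xvar \<alpha>) (psi \<beta>)" for \<alpha> \<beta>
      using br 0
      by (subst b.skew[OF xvar_D psi_D], subst b0.skew[OF xvar_D psi_D])
        (simp add: is_schouten_bracket_def)
    then show "br g h = bracket0 g h" if "g \<in> generators" "h \<in> generators" for g h
      using that br 0 by (auto simp: is_schouten_bracket_def generators_def)
  qed
qed

text \<open>This is the constant term of the deformed Jacobi identity. The inner bracket of
  constants may contain higher powers of \<hbar>, which \<open>fps_nth_bracket_0\<close>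
  discards.\<close>

lemma schouten_gerstenhaber: "gerstenhaber_algebra scaleR polyvec_deg bracket0"
proof (intro gerstenhaber_algebra.intro pv.graded_commutative_algebra_axioms bracket0_skew_biderivation
    gerstenhaber_algebra_axioms.intro)
  fix a b c :: "'n polyvec" and d e f
  assume "a \<in> polyvec_deg d" "b \<in> polyvec_deg e" "c \<in> polyvec_deg f"
  then have "cb.jacobi_at d e (fps_const a) (fps_const b) (fps_const c)"
    by (intro jacobi) (simp_all add: hpolyvec_deg_const)
  from arg_cong[OF this[unfolded cb.jacobi_at_def], of "\<lambda>u. fps_nth u 0"]
  show "bracket0 a (bracket0 b c) =
      bracket0 (bracket0 a b) c + neg_pow ((d - 1) * (e - 1)) (bracket0 b (bracket0 a c))"
    by (simp add: fps_nth_bracket_0 fps_nth_neg_pow)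
qed

lemma deformation: "gerstenhaber_deformation schouten gc.bracket"
  unfolding gerstenhaber_deformation_def schouten_eq
  using schouten_gerstenhaber deformed_gerstenhaber fps_nth_bracket_0 by blast

end

section \<open>From a Lie coalgebra to its structure constants\<close>

lemma lie_structure_of_coalgebra:
  assumes "lie_coalgebra \<Delta>"
  shows "lie_structure (structure_const \<Delta>)"
proof
  let ?C = "structure_const \<Delta>" and ?b = "dual_bracket \<Delta>"
  have t: "transpose (\<Delta> w) $ \<alpha> $ \<beta> = (- \<Delta> w) $ \<alpha> $ \<beta>" for w \<alpha> \<beta>
    using assms by (simp add: lie_coalgebra_def)
  have anti: "?C \<beta> \<alpha> \<gamma> = - ?C \<alpha> \<beta> \<gamma>" for \<alpha> \<beta> \<gamma>
    using t[of "axis \<gamma> 1" \<alpha> \<beta>] by (simp add: transpose_def structure_const_def)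
  then show "?C \<beta> \<alpha> \<gamma> = - ?C \<alpha> \<beta> \<gamma>" for \<alpha> \<beta> \<gamma> .
  have bil: "linear (?b u)" for u
    using assms by (simp add: lie_coalgebra_def lie_bracket_def bilinear_def)
  have bb: "?b (axis \<alpha> 1) (?b (axis \<beta> 1) (axis \<gamma> 1)) $ \<kappa> = (\<Sum>\<nu>\<in>UNIV. ?C \<beta> \<gamma> \<nu> * ?C \<alpha> \<nu> \<kappa>)" for \<alpha> \<beta> \<gamma> \<kappa>
    unfolding dual_bracket_axis[of _ \<beta>] linear_sum[OF bil] linear_scale[OF bil] dual_bracket_axis
    by (simp add: sum_component axis_def if_distrib[of "(*) _"] cong: if_cong)
  show "(\<Sum>\<mu>\<in>UNIV. ?C \<alpha> \<beta> \<mu> * ?C \<mu> \<xi> \<kappa>) =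
      (\<Sum>\<mu>\<in>UNIV. ?C \<alpha> \<xi> \<mu> * ?C \<mu> \<beta> \<kappa>) + (\<Sum>\<mu>\<in>UNIV. ?C \<beta> \<xi> \<mu> * ?C \<alpha> \<mu> \<kappa>)" for \<alpha> \<beta> \<xi> \<kappa>
  proof -
    have "?b (axis \<alpha> 1) (?b (axis \<beta> 1) (axis \<xi> 1)) + ?b (axis \<beta> 1) (?b (axis \<xi> 1) (axis \<alpha> 1)) +
        ?b (axis \<xi> 1) (?b (axis \<alpha> 1) (axis \<beta> 1)) = 0"
      using assms by (simp add: lie_coalgebra_def lie_bracket_def)
    from arg_cong[OF this, of "\<lambda>u. u $ \<kappa>"]
    have "(\<Sum>\<nu>\<in>UNIV. ?C \<beta> \<xi> \<nu> * ?C \<alpha> \<nu> \<kappa>) + (\<Sum>\<nu>\<in>UNIV. ?C \<xi> \<alpha> \<nu> * ?C \<beta> \<nu> \<kappa>) +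
        (\<Sum>\<nu>\<in>UNIV. ?C \<alpha> \<beta> \<nu> * ?C \<xi> \<nu> \<kappa>) = 0" by (simp add: bb)
    \<comment> \<open>Antisymmetry turns the cyclic Jacobi identity into the derivation form of
      \<open>C_jacobi\<close>.\<close>
    moreover have "(\<Sum>\<nu>\<in>UNIV. ?C \<xi> \<alpha> \<nu> * ?C \<beta> \<nu> \<kappa>) = (\<Sum>\<nu>\<in>UNIV. ?C \<alpha> \<xi> \<nu> * ?C \<nu> \<beta> \<kappa>)"
      by (intro sum.cong refl) (simp add: anti[of \<xi> \<alpha>] anti[of \<beta>])
    moreover have "(\<Sum>\<nu>\<in>UNIV. ?C \<alpha> \<beta> \<nu> * ?C \<xi> \<nu> \<kappa>) = - (\<Sum>\<nu>\<in>UNIV. ?C \<alpha> \<beta> \<nu> * ?C \<nu> \<xi> \<kappa>)"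
      unfolding sum_negf[symmetric] by (intro sum.cong refl) (simp add: anti[of \<xi>])
    ultimately show ?thesis by simp
  qed
qed

theorem corollary9p5p1:
  fixes \<Delta> :: "(real, 'n::{finite, linorder}) vec \<Rightarrow> ((real, 'n) vec, 'n) vec"
  assumes "lie_coalgebra \<Delta>"
  shows "(\<exists>!br. is_deformed_bracket (structure_const \<Delta>) br) \<and>
    (\<forall>br. is_deformed_bracket (structure_const \<Delta>) br \<longrightarrow> gerstenhaber_deformation schouten br)"
proof -
  interpret lie_structure "structure_const \<Delta>" using assms by (rule lie_structure_of_coalgebra)
  show ?thesis using is_deformed_bracket deformed_bracket_unique deformation by blast
qed

end
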